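(* Consider the affine and uniform model and its interior penalty DG discretization as described in the context, under all assumptions (U1)–(U5) listed there, with a sufficiently large penalty constant $\eta>0$ independent of $\boldsymbol y$ (in the sense of the context). Then there exist constants $\alpha>0$ and $C_{\rm DG}>0$, independent of $\boldsymbol y$ and $h$, namely a coercivity constant $\alpha$ and a derivative-recursion constant $C_{\rm DG}$ as specified in the context, such that, with $$\boldsymbol b=(b_j)_{j\ge1},\qquad b_j:=\frac{C_{\rm DG}\|\psi_j\|_{L^\infty(D)}}{\alpha\,a_{\min}},$$ for all finitely supported multi-indices $\boldsymbol\nu\in\mathscr F$ and all $\boldsymbol y\in U$, $$\|\partial_{\boldsymbol y}^{\boldsymbol\nu}u_h(\cdot,\boldsymbol y)\|_{V_h}\le|\boldsymbol\nu|!\,\boldsymbol b^{\boldsymbol\nu}\,\frac{C_{\rm Poin}^{V_h}}{\alpha}\,\|f\|_{L^2(D)}.$$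
   Context: **Multi-indices.** $\mathscr F:=\{\boldsymbol\nu\in\mathbb N_0^{\mathbb N}:|{\rm supp}(\boldsymbol\nu)|<\infty\}$, ${\rm supp}(\boldsymbol\nu)=\{j:\nu_j\ne0\}$, $|\boldsymbol\nu|=\sum_j\nu_j$, $\boldsymbol b^{\boldsymbol\nu}=\prod_{j\in{\rm supp}(\boldsymbol\nu)}b_j^{\nu_j}$. **Affine and uniform model.** $D\subset\mathbb R^d$, $d\in\{1,2,3\}$, $f\in L^2(D)$, $U:=[-\frac12,\frac12]^{\mathbb N}$, and $a(\boldsymbol x,\boldsymbol y):=a_0(\boldsymbol x)+\sum_{j\ge1}y_j\psi_j(\boldsymbol x)$ for $\boldsymbol x\in D$, $\boldsymbol y\in U$, with real-valued functions $a_0,\psi_j$. Assumptions: (U1) $a_0\in L^\infty(D)$ and $\sum_{j\ge1}\|\psi_j\|_{L^\infty}<\infty$; (U2) there are constants $a_{\min},a_{\max}>0$ with $a_{\min}\le a(\boldsymbol x,\boldsymbol y)\le a_{\max}$ for all $\boldsymbol x\in D$, $\boldsymbol y\in U$; (U3) $\sum_{j\ge1}\|\psi_j\|_{L^\infty}^p<\infty$ for some $0<p<1$; (U4) $a_0\in W^{1,\infty}(D)$ and $\sum_{j\ge1}\|\psi_j\|_{W^{1,\infty}}<\infty$, where $\|v\|_{W^{1,\infty}}:=\max\{\|v\|_{L^\infty},\|\nabla v\|_{L^\infty}\}$; (U5) $D$ is a convex and bounded polyhedron. **Mesh and DG space.** $\mathcal T_h$ is a member of a shape- and contact-regular sequence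 of meshes of $D$ without hanging nodes: each $\mathcal T_h$ is a partition of $D$ into polyhedral elements admitting a matching simplicial submesh $\mathcal S_h$, and there are $\rho_1,\rho_2>0$ independent of $h$ such that every simplex $T'\in\mathcal S_h$ has inradius $\ge\rho_1\operatorname{diam}T'$, and $\rho_2\operatorname{diam}T\le\operatorname{diam}T'$ whenever $T'\subset T\in\mathcal T_h$. $\mathcal F$ is the set of all faces; $h_F$ is the diameter of the face $F$ (if $d=1$, $h_F$ is the minimum of the diameters of the elements adjacent to $F$). $N_\partial$ is the maximal number of faces of a mesh element. For a fixed polynomial degree $k\in\mathbb N$, $$V_h=\{v_h\in L^2(D): v_h|_T\in\mathcal P_k(T)\ \forall T\in\mathcal T_h\},$$ with $\mathcal P_k(T)$ the polynomials of total degree at most $k$. On a face shared by $T^+\ne T^-$, put $\{\![v]\!\}=\frac12(v|_{T^+}+v|_{T^-})$ (componentwise for vector fields) and $[\![v]\!]=v|_{T^+}\boldsymbol n_{T^+}+v|_{T^-}\boldsymbol n_{T^-}$ with outward unit normals; on $F\subset\partial D\cap\partial T$ put $\{\![v]\!\}=v|_T$, $[\![v]\!]=v|_T\boldsymbol n$. $C_{\rm tr}$ is a constant independent of $h$ with $(\operatorname{diam}T)^{1/2}\|v_h\|_{L^2(F)}\le C_{\rm tr}\|v_h\|_{L^2(T)}$ for all $v_h\in V_h$, $T\in\mathcal T_h$, faces $F\subset\partial T$. **DG problem.** Let $\theta\in\{-1,0,1\}$ and $$B_h(\boldsymbol y;w,v)=\sum_{T\in\mathcal T_h}\int_T a\nabla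 w\cdot\nabla v\,{\rm d}\boldsymbol x+\sum_{F\in\mathcal F}\int_F\Big[\theta\{\![a\nabla v]\!\}\cdot[\![w]\!]-\{\![a\nabla w]\!\}\cdot[\![v]\!]+\tfrac{\eta}{h_F}[\![w]\!]\cdot[\![v]\!]\Big]{\rm d}\sigma,\qquad a=a(\cdot,\boldsymbol y).$$ $u_h(\cdot,\boldsymbol y)\in V_h$ is the solution of $B_h(\boldsymbol y;u_h(\cdot,\boldsymbol y),v_h)=\int_D f v_h\,{\rm d}\boldsymbol x$ for all $v_h\in V_h$. The norm on $V_h$ is $\|v_h\|_{V_h}^2=\sum_T\|\sqrt{a(\cdot,\boldsymbol y)}\nabla v_h\|_{L^2(T)}^2+\sum_F\frac{\eta}{h_F}\|[\![v_h]\!]\|_{L^2(F)}^2$ (it depends on $\boldsymbol y$). The penalty $\eta>0$ is *sufficiently large*: for some $\tau>1$ and $\tilde\tau>0$ (independent of $\boldsymbol y,h$), $\eta\ge\tau\frac{a_{\max}^2C_{\rm tr}^2N_\partial(\theta-1)^2}{4a_{\min}}$ and $\eta\ge\tilde\tau\frac{a_{\max}^2}{a_{\min}}$. **Constants.** Coercivity constant $\alpha>0$: $\alpha\|v_h\|_{V_h}^2\le B_h(\boldsymbol y;v_h,v_h)$ for all $v_h\in V_h$, $\boldsymbol y\in U$. Derivative-recursion constant $C_{\rm DG}>0$: for all $\boldsymbol y\in U$ and all $\boldsymbol0\neq\boldsymbol\nu\in\mathscr F$, $\|\partial_{\boldsymbol y}^{\boldsymbol\nu}u_h(\cdot,\boldsymbol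 y)\|_{V_h}\le C_{\rm DG}\sum_{\boldsymbol0\ne\boldsymbol m\le\boldsymbol\nu}\binom{\boldsymbol\nu}{\boldsymbol m}\big\|\frac{\partial_{\boldsymbol y}^{\boldsymbol m}a(\cdot,\boldsymbol y)}{a(\cdot,\boldsymbol y)}\big\|_{L^\infty(D)}\|\partial_{\boldsymbol y}^{\boldsymbol\nu-\boldsymbol m}u_h(\cdot,\boldsymbol y)\|_{V_h}$. Poincaré constant: $C_{\rm Poin}^{V_h}:=\sigma/\min\{\sqrt{a_{\min}},\sqrt\eta\}$, where $\sigma>0$ is a constant independent of $h$ with $\|v_h\|_{L^2(D)}\le\sigma\big(\sum_T\|\nabla v_h\|_{L^2(T)}^2+\sum_F\frac1{h_F}\|[\![v_h]\!]\|_{L^2(F)}^2\big)^{1/2}$ for all $v_h\in V_h$. *)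

theory Defs
  imports "HOL-Analysis.Analysis" "HOL-Probability.Essential_Supremum"
begin

section \<open>Function spaces on a domain\<close>

definition L2_norm_on :: "'a measure \<Rightarrow> ('a \<Rightarrow> 'b::real_normed_vector) \<Rightarrow> real" where
  "L2_norm_on M g = sqrt (LINT x|M. (norm (g x))\<^sup>2)"

definition L2_space :: "'a::euclidean_space set \<Rightarrow> ('a \<Rightarrow> real) set" where
  "L2_space D = {v. v \<in> borel_measurable (lebesgue_on D) \<and>
                    integrable (lebesgue_on D) (\<lambda>x. (v x)\<^sup>2)}"

definition Linf_space :: "'a::euclidean_space set \<Rightarrow> ('a \<Rightarrow> 'b::real_normed_vector) set" where
  "Linf_space D = {v. v \<in> borel_measurable (lebesgue_on D) \<and>
                      esssup (lebesgue_on D) (\<lambda>x. ereal (norm (v x))) < \<infinity>}"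

definition Linf_norm :: "'a::euclidean_space set \<Rightarrow> ('a \<Rightarrow> 'b::real_normed_vector) \<Rightarrow> real" where
  "Linf_norm D v = real_of_ereal (esssup (lebesgue_on D) (\<lambda>x. ereal (norm (v x))))"

definition grad :: "('a::euclidean_space \<Rightarrow> real) \<Rightarrow> 'a \<Rightarrow> 'a" where
  "grad v x = (THE g. GDERIV v x :> g)"

text \<open>\<open>C\<^sub>c\<^sup>1(D)\<close>; for weak derivatives of first order these test functions give the same notion
  as \<open>C\<^sub>c\<^sup>\<infinity>(D)\<close>.\<close>

definition test_functions :: "'a::euclidean_space set \<Rightarrow> ('a \<Rightarrow> real) set" where
  "test_functions D = {\<phi>. (\<forall>x. GDERIV \<phi> x :> grad \<phi> x) \<and> continuous_on UNIV (grad \<phi>) \<and>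
                          (\<exists>K. compact K \<and> K \<subseteq> D \<and> (\<forall>x. x \<notin> K \<longrightarrow> \<phi> x = 0))}"

definition is_weak_gradient ::
  "'a::euclidean_space set \<Rightarrow> ('a \<Rightarrow> real) \<Rightarrow> ('a \<Rightarrow> 'a) \<Rightarrow> bool" where
  "is_weak_gradient D v g \<longleftrightarrow>
     (\<forall>K. compact K \<and> K \<subseteq> D \<longrightarrow> integrable (lebesgue_on K) v \<and> integrable (lebesgue_on K) g) \<and>
     (\<forall>\<phi>\<in>test_functions D.
        (LINT x|lebesgue_on D. v x *\<^sub>R grad \<phi> x) = - (LINT x|lebesgue_on D. \<phi> x *\<^sub>R g x))"

definition weak_grad :: "'a::euclidean_space set \<Rightarrow> ('a \<Rightarrow> real) \<Rightarrow> 'a \<Rightarrow> 'a" where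
  "weak_grad D v = (SOME g. is_weak_gradient D v g)"

text \<open>On a convex bounded domain every class in \<open>W\<^sup>1\<^sup>,\<^sup>\<infinity>\<close> has exactly one representative that is
  continuous up to the boundary. The elements of the following set are these representatives, so
  that point values and traces on mesh faces are meaningful.\<close>

definition W1inf_space :: "'a::euclidean_space set \<Rightarrow> ('a \<Rightarrow> real) set" where
  "W1inf_space D = {v. continuous_on (closure D) v \<and> v \<in> Linf_space D \<and>
                       (\<exists>g. is_weak_gradient D v g \<and> g \<in> Linf_space D)}"

definition W1inf_norm :: "'a::euclidean_space set \<Rightarrow> ('a \<Rightarrow> real) \<Rightarrow> real" where
  "W1inf_norm D v = max (Linf_norm D v) (Linf_norm D (weak_grad D v))"


section \<open>Parameters, multi-indices and parametric derivatives\<close>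

text \<open>The parameters \<open>y\<^sub>1, y\<^sub>2, \<dots>\<close> are indexed from \<open>0\<close>.\<close>

definition param_box :: "(nat \<Rightarrow> real) set" where
  "param_box = {y. \<forall>j. y j \<in> {-1/2..1/2}}"

definition affine_coeff :: "('a \<Rightarrow> real) \<Rightarrow> (nat \<Rightarrow> 'a \<Rightarrow> real) \<Rightarrow> (nat \<Rightarrow> real) \<Rightarrow> 'a \<Rightarrow> real" where
  "affine_coeff a0 \<psi> y x = a0 x + (\<Sum>j. y j * \<psi> j x)"

definition supp :: "(nat \<Rightarrow> nat) \<Rightarrow> nat set" where
  "supp \<nu> = {j. \<nu> j \<noteq> 0}"

definition multi_indices :: "(nat \<Rightarrow> nat) set" where
  "multi_indices = {\<nu>. finite (supp \<nu>)}"

definition mi_abs :: "(nat \<Rightarrow> nat) \<Rightarrow> nat" where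
  "mi_abs \<nu> = (\<Sum>j\<in>supp \<nu>. \<nu> j)"

definition mi_power :: "(nat \<Rightarrow> real) \<Rightarrow> (nat \<Rightarrow> nat) \<Rightarrow> real" where
  "mi_power b \<nu> = (\<Prod>j\<in>supp \<nu>. b j ^ \<nu> j)"

definition mi_choose :: "(nat \<Rightarrow> nat) \<Rightarrow> (nat \<Rightarrow> nat) \<Rightarrow> nat" where
  "mi_choose \<nu> m = (\<Prod>j\<in>supp \<nu>. \<nu> j choose m j)"

text \<open>Functions of \<open>y\<close> are only given on the closed box, so the partial derivative is one-sided
  where \<open>y j = \<plusminus>1/2\<close>.\<close>

definition pderiv_y ::
  "nat \<Rightarrow> ((nat \<Rightarrow> real) \<Rightarrow> 'a \<Rightarrow> real) \<Rightarrow> (nat \<Rightarrow> real) \<Rightarrow> 'a \<Rightarrow> real" where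
  "pderiv_y j G y x = vector_derivative (\<lambda>t. G (y(j := t)) x) (at (y j) within {-1/2..1/2})"

definition mderiv_y ::
  "(nat \<Rightarrow> nat) \<Rightarrow> ((nat \<Rightarrow> real) \<Rightarrow> 'a \<Rightarrow> real) \<Rightarrow> (nat \<Rightarrow> real) \<Rightarrow> 'a \<Rightarrow> real" where
  "mderiv_y \<nu> G = fold (\<lambda>j. pderiv_y j ^^ \<nu> j) (sorted_list_of_set (supp \<nu>)) G"


section \<open>Polyhedra and their faces\<close>

text \<open>Polyhedra (domain and mesh elements) are open sets and need not be convex. The faces lying in
  a hyperplane \<open>H\<close> are the closures of the connected components of the interior, relative to \<open>H\<close>, of
  the part of the boundary inside \<open>H\<close>. For a convex polyhedron these are the facets of its
  closure; in dimension one they are the end points.\<close>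

definition flat_faces :: "'a::euclidean_space set \<Rightarrow> 'a set set" where
  "flat_faces T = {closure C | C n c. n \<noteq> 0 \<and>
     C \<in> components (top_of_set {x. n \<bullet> x = c} interior_of (frontier T \<inter> {x. n \<bullet> x = c}))}"

text \<open>Near a point in the relative interior of \<open>F\<close>, the set \<open>T\<close> is the half-space behind \<open>F\<close>. Hence
  slits and boundaries with \<open>T\<close> on both sides are excluded.\<close>

definition is_outward_normal :: "'a::euclidean_space set \<Rightarrow> 'a set \<Rightarrow> 'a \<Rightarrow> bool" where
  "is_outward_normal T F n \<longleftrightarrow> norm n = 1 \<and>
     (\<forall>x\<in>rel_interior F. \<exists>e>0. T \<inter> ball x e = {z \<in> ball x e. n \<bullet> z < n \<bullet> x})"

definition outward_normal :: "'a::euclidean_space set \<Rightarrow> 'a set \<Rightarrow> 'a" where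
  "outward_normal T F = (THE n. is_outward_normal T F n)"

definition polyhedral :: "'a::euclidean_space set \<Rightarrow> bool" where
  "polyhedral T \<longleftrightarrow> T \<noteq> {} \<and> open T \<and> connected T \<and> bounded T \<and>
     finite (flat_faces T) \<and> frontier T = \<Union> (flat_faces T) \<and>
     (\<forall>F\<in>flat_faces T. \<exists>n. is_outward_normal T F n)"

text \<open>The \<open>(d-1)\<close>-dimensional Lebesgue measure on the hyperplane \<open>n \<bullet> x = c\<close> with unit normal \<open>n\<close>:
  the area of \<open>A\<close> is the volume of the prism \<open>{x + t n | x \<in> A, 0 \<le> t \<le> 1}\<close>. In dimension
  one this is the unit point mass.\<close>

definition hyperplane_measure :: "'a::euclidean_space \<Rightarrow> real \<Rightarrow> 'a measure" where
  "hyperplane_measure n c =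
     distr (restrict_space lborel {x. c \<le> n \<bullet> x \<and> n \<bullet> x \<le> c + 1}) borel
       (\<lambda>x. x - (n \<bullet> x - c) *\<^sub>R n)"

definition face_measure :: "'a::euclidean_space set \<Rightarrow> 'a measure" where
  "face_measure F =
     (let (n, c) = (SOME (n, c). norm n = 1 \<and> F \<subseteq> {x. n \<bullet> x = c})
      in restrict_space (hyperplane_measure n c) F)"


section \<open>Meshes\<close>

definition is_mesh :: "'a::euclidean_space set \<Rightarrow> 'a set set \<Rightarrow> bool" where
  "is_mesh D \<T> \<longleftrightarrow> finite \<T> \<and> (\<forall>T\<in>\<T>. polyhedral T \<and> T \<subseteq> D) \<and> pairwise disjnt \<T> \<and>
     closure D = (\<Union>T\<in>\<T>. closure T)"

definition no_hanging_nodes :: "'a::euclidean_space set \<Rightarrow> 'a set set \<Rightarrow> bool" where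
  "no_hanging_nodes D \<T> \<longleftrightarrow>
     (\<forall>T\<in>\<T>. \<forall>F\<in>flat_faces T. F \<subseteq> frontier D \<or> (\<exists>T'\<in>\<T>. T' \<noteq> T \<and> F \<in> flat_faces T'))"

text \<open>The simplices of the submesh are closed, whereas mesh elements are open.\<close>

definition is_matching_simplicial_submesh ::
  "'a::euclidean_space set set \<Rightarrow> 'a set set \<Rightarrow> bool" where
  "is_matching_simplicial_submesh \<T> \<S> \<longleftrightarrow> triangulation \<S> \<and>
     (\<forall>S\<in>\<S>. int DIM('a) simplex S) \<and>
     (\<forall>S\<in>\<S>. \<exists>T\<in>\<T>. S \<subseteq> closure T) \<and>
     (\<forall>T\<in>\<T>. closure T = \<Union> {S\<in>\<S>. S \<subseteq> closure T})"

definition inradius :: "'a::euclidean_space set \<Rightarrow> real" where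
  "inradius S = Sup {r. 0 \<le> r \<and> (\<exists>z. cball z r \<subseteq> S)}"

definition regular_mesh_sequence ::
  "'a::euclidean_space set \<Rightarrow> (nat \<Rightarrow> 'a set set) \<Rightarrow> bool" where
  "regular_mesh_sequence D \<T> \<longleftrightarrow>
     (\<forall>h. is_mesh D (\<T> h) \<and> no_hanging_nodes D (\<T> h)) \<and>
     (\<exists>\<rho>1>0. \<exists>\<rho>2>0. \<forall>h. \<exists>\<S>. is_matching_simplicial_submesh (\<T> h) \<S> \<and>
        (\<forall>S\<in>\<S>. \<rho>1 * diameter S \<le> inradius S) \<and>
        (\<forall>T\<in>\<T> h. \<forall>S\<in>\<S>. S \<subseteq> closure T \<longrightarrow> \<rho>2 * diameter T \<le> diameter S))"

definition mesh_faces :: "'a::euclidean_space set set \<Rightarrow> 'a set set" where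
  "mesh_faces \<T> = (\<Union>T\<in>\<T>. flat_faces T)"

definition adjacent :: "'a::euclidean_space set set \<Rightarrow> 'a set \<Rightarrow> 'a set set" where
  "adjacent \<T> F = {T\<in>\<T>. F \<in> flat_faces T}"

definition face_size :: "'a::euclidean_space set set \<Rightarrow> 'a set \<Rightarrow> real" where
  "face_size \<T> F = (if DIM('a) = 1 then Min (diameter ` adjacent \<T> F) else diameter F)"

definition is_max_face_number :: "(nat \<Rightarrow> 'a::euclidean_space set set) \<Rightarrow> nat \<Rightarrow> bool" where
  "is_max_face_number \<T> N \<longleftrightarrow>
     (\<forall>h. \<forall>T\<in>\<T> h. card (flat_faces T) \<le> N) \<and> (\<exists>h. \<exists>T\<in>\<T> h. card (flat_faces T) = N)"


section \<open>The interior penalty discontinuous Galerkin method\<close>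

definition poly_exponents :: "nat \<Rightarrow> ('a::euclidean_space \<Rightarrow> nat) set" where
  "poly_exponents k = {e \<in> Basis \<rightarrow>\<^sub>E UNIV. (\<Sum>b\<in>Basis. e b) \<le> k}"

definition is_poly_of_degree_le :: "nat \<Rightarrow> ('a::euclidean_space \<Rightarrow> real) \<Rightarrow> bool" where
  "is_poly_of_degree_le k p \<longleftrightarrow>
     (\<exists>c. \<forall>x. p x = (\<Sum>e\<in>poly_exponents k. c e * (\<Prod>b\<in>Basis. (x \<bullet> b) ^ e b)))"

text \<open>The elements of the DG space are functions, not classes. Everything below depends only on
  their values inside the open mesh elements; traces on faces are limits from inside.\<close>

definition DG_space ::
  "'a::euclidean_space set \<Rightarrow> 'a set set \<Rightarrow> nat \<Rightarrow> ('a \<Rightarrow> real) set" where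
  "DG_space D \<T> k = {v \<in> L2_space D.
     \<forall>T\<in>\<T>. \<exists>p. is_poly_of_degree_le k p \<and> (\<forall>x\<in>T. v x = p x)}"

definition trace :: "'a::euclidean_space set \<Rightarrow> ('a \<Rightarrow> 'b::real_normed_vector) \<Rightarrow> 'a \<Rightarrow> 'b" where
  "trace T q x = Lim (at x within T) q"

text \<open>An interior face has two adjacent elements and a boundary face has one, so each of the
  following two formulas covers both cases.\<close>

definition average ::
  "'a::euclidean_space set set \<Rightarrow> 'a set \<Rightarrow> ('a \<Rightarrow> 'b::real_normed_vector) \<Rightarrow> 'a \<Rightarrow> 'b" where
  "average \<T> F q x = (1 / real (card (adjacent \<T> F))) *\<^sub>R (\<Sum>T\<in>adjacent \<T> F. trace T q x)"

definition jump ::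
  "'a::euclidean_space set set \<Rightarrow> 'a set \<Rightarrow> ('a \<Rightarrow> real) \<Rightarrow> 'a \<Rightarrow> 'a" where
  "jump \<T> F v x = (\<Sum>T\<in>adjacent \<T> F. trace T v x *\<^sub>R outward_normal T F)"

definition DG_form ::
  "'a::euclidean_space set set \<Rightarrow> real \<Rightarrow> real \<Rightarrow> ('a \<Rightarrow> real) \<Rightarrow>
     ('a \<Rightarrow> real) \<Rightarrow> ('a \<Rightarrow> real) \<Rightarrow> real" where
  "DG_form \<T> \<theta> \<eta> a w v =
     (\<Sum>T\<in>\<T>. LINT x|lebesgue_on T. (a x *\<^sub>R grad w x) \<bullet> grad v x) +
     (\<Sum>F\<in>mesh_faces \<T>. LINT x|face_measure F.
        \<theta> * (average \<T> F (\<lambda>z. a z *\<^sub>R grad v z) x \<bullet> jump \<T> F w x)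
        - average \<T> F (\<lambda>z. a z *\<^sub>R grad w z) x \<bullet> jump \<T> F v x
        + \<eta> / face_size \<T> F * (jump \<T> F w x \<bullet> jump \<T> F v x))"

definition DG_norm ::
  "'a::euclidean_space set set \<Rightarrow> real \<Rightarrow> ('a \<Rightarrow> real) \<Rightarrow> ('a \<Rightarrow> real) \<Rightarrow> real" where
  "DG_norm \<T> \<eta> a v = sqrt (
     (\<Sum>T\<in>\<T>. (L2_norm_on (lebesgue_on T) (\<lambda>x. sqrt (a x) *\<^sub>R grad v x))\<^sup>2) +
     (\<Sum>F\<in>mesh_faces \<T>. \<eta> / face_size \<T> F * (L2_norm_on (face_measure F) (jump \<T> F v))\<^sup>2))"

definition is_trace_const ::
  "'a::euclidean_space set \<Rightarrow> (nat \<Rightarrow> 'a set set) \<Rightarrow> nat \<Rightarrow> real \<Rightarrow> bool" where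
  "is_trace_const D \<T> k C \<longleftrightarrow>
     (\<forall>h. \<forall>v\<in>DG_space D (\<T> h) k. \<forall>T\<in>\<T> h. \<forall>F\<in>flat_faces T.
        sqrt (diameter T) * L2_norm_on (face_measure F) (trace T v) \<le> C * L2_norm_on (lebesgue_on T) v)"

definition is_broken_Poincare_const ::
  "'a::euclidean_space set \<Rightarrow> (nat \<Rightarrow> 'a set set) \<Rightarrow> nat \<Rightarrow> real \<Rightarrow> bool" where
  "is_broken_Poincare_const D \<T> k \<sigma> \<longleftrightarrow> \<sigma> > 0 \<and>
     (\<forall>h. \<forall>v\<in>DG_space D (\<T> h) k.
        L2_norm_on (lebesgue_on D) v \<le> \<sigma> * sqrt (
          (\<Sum>T\<in>\<T> h. (L2_norm_on (lebesgue_on T) (grad v))\<^sup>2) +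
          (\<Sum>F\<in>mesh_faces (\<T> h).
             1 / face_size (\<T> h) F * (L2_norm_on (face_measure F) (jump (\<T> h) F v))\<^sup>2)))"

definition is_DG_solution ::
  "'a::euclidean_space set \<Rightarrow> 'a set set \<Rightarrow> nat \<Rightarrow> real \<Rightarrow> real \<Rightarrow> ('a \<Rightarrow> real) \<Rightarrow>
     ('a \<Rightarrow> real) \<Rightarrow> ('a \<Rightarrow> real) \<Rightarrow> bool" where
  "is_DG_solution D \<T> k \<theta> \<eta> a f u \<longleftrightarrow> u \<in> DG_space D \<T> k \<and>
     (\<forall>v\<in>DG_space D \<T> k. DG_form \<T> \<theta> \<eta> a u v = (LINT x|lebesgue_on D. f x * v x))"

text \<open>Here \<open>a\<close> is a parametric coefficient \<open>y \<mapsto> a y\<close>, and \<open>u h\<close> is the solution map on the mesh with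
  index \<open>h\<close>; the constants are uniform in \<open>y\<close> and in the mesh.\<close>

definition is_coercivity_const ::
  "'a::euclidean_space set \<Rightarrow> (nat \<Rightarrow> 'a set set) \<Rightarrow> nat \<Rightarrow> real \<Rightarrow> real \<Rightarrow>
     ((nat \<Rightarrow> real) \<Rightarrow> 'a \<Rightarrow> real) \<Rightarrow> real \<Rightarrow> bool" where
  "is_coercivity_const D \<T> k \<theta> \<eta> a \<alpha> \<longleftrightarrow> \<alpha> > 0 \<and>
     (\<forall>h. \<forall>y\<in>param_box. \<forall>v\<in>DG_space D (\<T> h) k.
        \<alpha> * (DG_norm (\<T> h) \<eta> (a y) v)\<^sup>2 \<le> DG_form (\<T> h) \<theta> \<eta> (a y) v v)"

definition is_recursion_const ::
  "'a::euclidean_space set \<Rightarrow> (nat \<Rightarrow> 'a set set) \<Rightarrow> real \<Rightarrow>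
     ((nat \<Rightarrow> real) \<Rightarrow> 'a \<Rightarrow> real) \<Rightarrow> (nat \<Rightarrow> (nat \<Rightarrow> real) \<Rightarrow> 'a \<Rightarrow> real) \<Rightarrow> real \<Rightarrow> bool" where
  "is_recursion_const D \<T> \<eta> a u C \<longleftrightarrow> C > 0 \<and>
     (\<forall>h. \<forall>y\<in>param_box. \<forall>\<nu>\<in>multi_indices. \<nu> \<noteq> (\<lambda>_. 0) \<longrightarrow>
        DG_norm (\<T> h) \<eta> (a y) (mderiv_y \<nu> (u h) y) \<le>
        C * (\<Sum>m | m \<noteq> (\<lambda>_. 0) \<and> (\<forall>j. m j \<le> \<nu> j).
               real (mi_choose \<nu> m) * Linf_norm D (\<lambda>x. mderiv_y m a y x / a y x) *
               DG_norm (\<T> h) \<eta> (a y) (mderiv_y (\<lambda>j. \<nu> j - m j) (u h) y)))"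

text \<open>\<open>vector_derivative\<close> is total; this says that all the partial derivatives used above exist.\<close>

definition has_all_derivs_y ::
  "(nat \<Rightarrow> 'a::euclidean_space set set) \<Rightarrow> (nat \<Rightarrow> (nat \<Rightarrow> real) \<Rightarrow> 'a \<Rightarrow> real) \<Rightarrow> bool" where
  "has_all_derivs_y \<T> u \<longleftrightarrow>
     (\<forall>h. \<forall>\<nu>\<in>multi_indices. \<forall>y\<in>param_box. \<forall>j. \<forall>T\<in>\<T> h. \<forall>x\<in>T.
        (\<lambda>t. mderiv_y \<nu> (u h) (y(j := t)) x) differentiable (at (y j) within {-1/2..1/2}))"

end

theory Submission
  imports Defs
begin

text \<open>The lower bound on the penalty makes the consistency terms absorbable by Young's inequality;
  this gives coercivity with \<open>\<alpha> = 1 - 1 / sqrt \<tau>\<close>. With respect to a basis of the DG space the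
  problem is a linear system whose matrix is positive definite and affine in \<open>y\<close>, so that its solution
  has all partial derivatives, and differentiating the system gives
  \<open>B(y; \<partial>\<^sup>\<nu> u, v) = - (\<Sum>j. \<nu>\<^sub>j \<Psi>\<^sub>j(\<partial>\<^sup>\<nu>\<^sup>-\<^sup>e\<^sup>j u, v))\<close>, where \<open>\<Psi>\<^sub>j\<close> is the form with coefficient \<open>\<psi>\<^sub>j\<close> and
  without penalty. It is bounded by \<open>(1 + 2 K) \<parallel>\<psi>\<^sub>j / a\<parallel>\<close> in the energy norm, where the trace
  inequality determines \<open>K\<close>. Testing with \<open>v = \<partial>\<^sup>\<nu> u\<close> gives the recursion with
  \<open>C_DG = (1 + 2 K) / \<alpha>\<close>, and induction on \<open>|\<nu>|\<close> gives the bound.\<close>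

section \<open>Parametric linear systems\<close>

text \<open>\<open>vector_derivative\<close> has a value even where no derivative exists, so the
  differentiability of \<open>u\<close> has to be established along with the differentiated
  equation. Elements of the DG space are functions that are determined only inside the mesh
  elements: identities between derivatives hold there, and the norm and the form are shown not to
  see any other value. Faces are null sets, so an essential bound says nothing about them by itself;
  the continuity up to the boundary contained in \<open>W1inf_space\<close> carries the bounds on a,
  \<psi>_j and \<psi>_j / a over to the faces. The constant K is \<open>face_const\<close>. The
  penalty condition says exactly that (\<theta> - 1)^2 K^2 \<le> 4 / \<tau>, which is what Young's
  inequality needs in order to leave 1 - 1 / sqrt \<tau>. In 1 + 2 K the volume term counts 1 and
  each of the two consistency terms counts K. The induction by itself would give b_j with the
  denominator a_min; the further factor \<alpha> there only enlarges b_j, because \<alpha> \<le>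
  1.\<close>

lemma differentiable_cong_within:
  fixes f g :: "'a::real_normed_vector \<Rightarrow> 'b::real_normed_vector"
  assumes "f differentiable (at x within S)" "x \<in> S" "\<And>t. t \<in> S \<Longrightarrow> g t = f t"
  shows "g differentiable (at x within S)"
  using assms has_derivative_transform[of x S g f] unfolding differentiable_def by blast

text \<open>Elimination of one unknown preserves positive definiteness, so the solution is obtained by
  finitely many divisions by positive pivots.\<close>

lemma positive_definite_solution_differentiable:
  fixes A :: "real \<Rightarrow> 'i \<Rightarrow> 'i \<Rightarrow> real" and b c :: "real \<Rightarrow> 'i \<Rightarrow> real"
  assumes "finite I" and t0: "t0 \<in> S"
    and "\<And>i j. i \<in> I \<Longrightarrow> j \<in> I \<Longrightarrow> (\<lambda>t. A t i j) differentiable (at t0 within S)"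
    and "\<And>i. i \<in> I \<Longrightarrow> (\<lambda>t. b t i) differentiable (at t0 within S)"
    and "\<And>t x. t \<in> S \<Longrightarrow> \<exists>i\<in>I. x i \<noteq> 0 \<Longrightarrow> (\<Sum>i\<in>I. x i * (\<Sum>j\<in>I. A t i j * x j)) > 0"
    and "\<And>t i. t \<in> S \<Longrightarrow> i \<in> I \<Longrightarrow> (\<Sum>j\<in>I. A t i j * c t j) = b t i"
  shows "\<forall>i\<in>I. (\<lambda>t. c t i) differentiable (at t0 within S)"
  using assms(1,3-)
proof (induction I arbitrary: A b rule: finite_induct)
  case empty
  then show ?case by simp
next
  case (insert k I)
  note dA = insert.prems(1) and db = insert.prems(2) and pos = insert.prems(3) and sol = insert.prems(4)
  have piv: "A t k k > 0" if "t \<in> S" for t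
  proof -
    \<comment> \<open>The quadratic form at the k-th unit vector is the diagonal entry.\<close>
    have "(\<Sum>i\<in>insert k I. (if i = k then 1 else 0) *
        (\<Sum>j\<in>insert k I. A t i j * (if j = k then 1 else (0::real)))) > 0"
      by (rule pos[OF that]) auto
    also have "(\<Sum>i\<in>insert k I. (if i = k then 1 else 0) *
        (\<Sum>j\<in>insert k I. A t i j * (if j = k then 1 else (0::real)))) = A t k k"
      using insert.hyps by (simp add: if_distrib if_distribR sum.delta' cong: if_cong)
    finally show ?thesis .
  qed
  \<comment> \<open>Schur complement of the pivot, with the right-hand side transformed
    accordingly.\<close>
  define A' where "A' = (\<lambda>t i j. A t i j - A t i k * A t k j / A t k k)"
  define b' where "b' = (\<lambda>t i. b t i - A t i k * b t k / A t k k)"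
  have piv0: "A t0 k k \<noteq> 0" using piv[OF t0] by simp
  have "\<forall>i\<in>I. (\<lambda>t. c t i) differentiable (at t0 within S)"
  proof (rule insert.IH[of A' b'])
    show "(\<lambda>t. A' t i j) differentiable (at t0 within S)" if "i \<in> I" "j \<in> I" for i j
      unfolding A'_def using that dA piv0
      by (intro differentiable_diff differentiable_divide differentiable_mult) auto
    show "(\<lambda>t. b' t i) differentiable (at t0 within S)" if "i \<in> I" for i
      unfolding b'_def using that dA db piv0
      by (intro differentiable_diff differentiable_divide differentiable_mult) auto
    show "(\<Sum>i\<in>I. x i * (\<Sum>j\<in>I. A' t i j * x j)) > 0" if t: "t \<in> S" and x: "\<exists>i\<in>I. x i \<noteq> 0" for t x
    proof -
      \<comment> \<open>The component z is chosen so that row k of A annihilates the extended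
        vector; the form of A there then equals the form of A' at x.\<close>
      define z where "z = - (\<Sum>j\<in>I. A t k j * x j) / A t k k"
      define x' where "x' = x(k := z)"
      have x'I: "x' i = x i" if "i \<in> I" for i using that insert.hyps by (auto simp: x'_def)
      have row: "(\<Sum>j\<in>insert k I. A t i j * x' j) = A t i k * z + (\<Sum>j\<in>I. A t i j * x j)" for i
        using insert.hyps x'I by (simp add: x'_def)
      have "0 < (\<Sum>i\<in>insert k I. x' i * (\<Sum>j\<in>insert k I. A t i j * x' j))"
        using x x'I by (intro pos[OF t]) auto
      also have "\<dots> = z * (A t k k * z + (\<Sum>j\<in>I. A t k j * x j))
          + (\<Sum>i\<in>I. x i * (A t i k * z + (\<Sum>j\<in>I. A t i j * x j)))"
        unfolding row using insert.hyps x'I by (simp add: x'_def)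
      also have "A t k k * z + (\<Sum>j\<in>I. A t k j * x j) = 0"
        using piv[OF t] by (simp add: z_def)
      also have "(\<Sum>i\<in>I. x i * (A t i k * z + (\<Sum>j\<in>I. A t i j * x j))) =
          (\<Sum>i\<in>I. x i * (\<Sum>j\<in>I. A' t i j * x j))"
      proof (rule sum.cong)
        fix i
        have "(\<Sum>j\<in>I. A' t i j * x j) = (\<Sum>j\<in>I. A t i j * x j) - A t i k / A t k k * (\<Sum>j\<in>I. A t k j * x j)"
          by (simp add: A'_def sum_distrib_left flip: sum_subtractf) (simp add: algebra_simps)
        then show "x i * (A t i k * z + (\<Sum>j\<in>I. A t i j * x j)) = x i * (\<Sum>j\<in>I. A' t i j * x j)"
          by (simp add: z_def)
      qed simp
      finally show ?thesis by simp
    qed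
    show "(\<Sum>j\<in>I. A' t i j * c t j) = b' t i" if t: "t \<in> S" and i: "i \<in> I" for t i
    proof -
      have 1: "A t k k * c t k + (\<Sum>j\<in>I. A t k j * c t j) = b t k"
        using sol[OF t, of k] insert.hyps by simp
      have 2: "A t i k * c t k + (\<Sum>j\<in>I. A t i j * c t j) = b t i"
        using sol[OF t, of i] i insert.hyps by simp
      have 3: "c t k = (b t k - (\<Sum>j\<in>I. A t k j * c t j)) / A t k k"
        using 1 piv[OF t] by (simp add: field_simps)
      have "(\<Sum>j\<in>I. A' t i j * c t j) = (\<Sum>j\<in>I. A t i j * c t j) - A t i k / A t k k * (\<Sum>j\<in>I. A t k j * c t j)"
        by (simp add: A'_def sum_distrib_left flip: sum_subtractf) (simp add: algebra_simps)
      with 2 3 show ?thesis using piv[OF t] by (simp add: b'_def field_simps)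
    qed
  qed
  \<comment> \<open>Back substitution: row k expresses this component through those already known to
    be differentiable.\<close>
  moreover have "(\<lambda>t. c t k) differentiable (at t0 within S)"
  proof (rule differentiable_cong_within[OF _ t0])
    show "(\<lambda>t. (b t k - (\<Sum>j\<in>I. A t k j * c t j)) / A t k k) differentiable (at t0 within S)"
      using calculation dA db piv0 insert.hyps
      by (intro differentiable_diff differentiable_divide differentiable_sum differentiable_mult) auto
    show "c t k = (b t k - (\<Sum>j\<in>I. A t k j * c t j)) / A t k k" if t: "t \<in> S" for t
      using sol[OF t, of k] insert.hyps piv[OF t] by (simp add: field_simps)
  qed
  ultimately show ?case by simp
qed

text \<open>The family is thinned out one function at a time: a function is kept exactly if on X it
  is not a combination of those kept before. Span and independence refer to values on X only, since
  DG functions are determined only inside the mesh elements.\<close>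

lemma finite_family_has_basis:
  fixes \<phi> :: "'k \<Rightarrow> 'a \<Rightarrow> real"
  assumes "finite K"
  shows "\<exists>J\<subseteq>K. (\<forall>c. \<exists>c'. \<forall>x\<in>X. (\<Sum>i\<in>K. c i * \<phi> i x) = (\<Sum>i\<in>J. c' i * \<phi> i x)) \<and>
     (\<forall>c. (\<forall>x\<in>X. (\<Sum>i\<in>J. c i * \<phi> i x) = 0) \<longrightarrow> (\<forall>i\<in>J. c i = 0))"
  using assms
proof (induction K rule: finite_induct)
  case empty
  then show ?case by auto
next
  case (insert k K)
  then obtain J where J: "J \<subseteq> K" 
    and span: "\<And>c. \<exists>c'. \<forall>x\<in>X. (\<Sum>i\<in>K. c i * \<phi> i x) = (\<Sum>i\<in>J. c' i * \<phi> i x)"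
    and ind: "\<And>c. \<forall>x\<in>X. (\<Sum>i\<in>J. c i * \<phi> i x) = 0 \<Longrightarrow> \<forall>i\<in>J. c i = 0"
    by blast
  have fJ: "finite J" and kJ: "k \<notin> J" using J insert.hyps finite_subset by blast+
  show ?case
  proof (cases "\<exists>d. \<forall>x\<in>X. \<phi> k x = (\<Sum>i\<in>J. d i * \<phi> i x)")
    case True
    then obtain d where d: "\<And>x. x \<in> X \<Longrightarrow> \<phi> k x = (\<Sum>i\<in>J. d i * \<phi> i x)" by auto
    have "\<exists>c'. \<forall>x\<in>X. (\<Sum>i\<in>insert k K. c i * \<phi> i x) = (\<Sum>i\<in>J. c' i * \<phi> i x)" for c
    proof -
      obtain c' where c': "\<And>x. x \<in> X \<Longrightarrow> (\<Sum>i\<in>K. c i * \<phi> i x) = (\<Sum>i\<in>J. c' i * \<phi> i x)"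
        using span[of c] by auto
      have "(\<Sum>i\<in>insert k K. c i * \<phi> i x) = (\<Sum>i\<in>J. (c k * d i + c' i) * \<phi> i x)" if "x \<in> X" for x
        using insert.hyps c'[OF that] d[OF that]
        by (simp add: sum_distrib_left algebra_simps sum.distrib)
      then show ?thesis by (intro exI[of _ "\<lambda>i. c k * d i + c' i"]) simp
    qed
    with J ind show ?thesis by (intro exI[of _ J]) auto
  next
    case False
    have "\<exists>c'. \<forall>x\<in>X. (\<Sum>i\<in>insert k K. c i * \<phi> i x) = (\<Sum>i\<in>insert k J. c' i * \<phi> i x)" for c
    proof -
      obtain c' where c': "\<And>x. x \<in> X \<Longrightarrow> (\<Sum>i\<in>K. c i * \<phi> i x) = (\<Sum>i\<in>J. c' i * \<phi> i x)"
        using span[of c] by auto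
      have "(\<Sum>i\<in>J. (c'(k := c k)) i * \<phi> i x) = (\<Sum>i\<in>J. c' i * \<phi> i x)" for x
        using kJ by (intro sum.cong) auto
      then have "(\<Sum>i\<in>insert k K. c i * \<phi> i x) = (\<Sum>i\<in>insert k J. (c'(k := c k)) i * \<phi> i x)" if "x \<in> X" for x
        using insert.hyps c'[OF that] fJ kJ by simp
      then show ?thesis by blast
    qed
    moreover have "\<forall>i\<in>insert k J. c i = 0" if c: "\<forall>x\<in>X. (\<Sum>i\<in>insert k J. c i * \<phi> i x) = 0" for c
    proof -
      have "c k = 0"
      proof (rule ccontr)
        assume ck: "c k \<noteq> 0"
        have eq: "\<phi> k x = (\<Sum>i\<in>J. (- c i / c k) * \<phi> i x)" if "x \<in> X" for x
        proof -
          define r where "r = (\<Sum>i\<in>J. c i * \<phi> i x)"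
          have "c k * \<phi> k x + r = 0" using c that fJ kJ by (simp add: r_def)
          then have "\<phi> k x = - r / c k" using ck by (simp add: field_simps)
          also have "\<dots> = (\<Sum>i\<in>J. (- c i / c k) * \<phi> i x)"
            by (simp add: r_def sum_divide_distrib sum_negf)
          finally show ?thesis .
        qed
        have "\<exists>d. \<forall>x\<in>X. \<phi> k x = (\<Sum>i\<in>J. d i * \<phi> i x)"
          by (rule exI[where x = "\<lambda>i. - c i / c k"]) (use eq in blast)
        with False show False by contradiction
      qed
      with c ind[of c] fJ kJ show ?thesis by simp
    qed
    ultimately show ?thesis using J by (intro exI[of _ "insert k J"]) auto
  qed
qed

section \<open>Multi-indices and iterated parametric derivatives\<close>

lemma multi_index_zero [simp]: "supp (\<lambda>_. 0) = {}" "supp \<nu> = {} \<longleftrightarrow> \<nu> = (\<lambda>_. 0)"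
  by (auto simp: supp_def)

lemma finite_supp_upd [simp]: "finite (supp (\<nu>(j := n))) \<longleftrightarrow> finite (supp \<nu>)"
proof -
  have "supp (\<nu>(j := n)) \<subseteq> insert j (supp \<nu>)" "supp \<nu> \<subseteq> insert j (supp (\<nu>(j := n)))"
    by (auto simp: supp_def)
  then show ?thesis by (meson finite_insert finite_subset)
qed

text \<open>Changing one exponent may change the support, so sums for two multi-indices are compared
  over a common index set.\<close>

lemma mi_abs_superset: "finite A \<Longrightarrow> supp \<nu> \<subseteq> A \<Longrightarrow> mi_abs \<nu> = sum \<nu> A"
  unfolding mi_abs_def by (rule sum.mono_neutral_left) (auto simp: supp_def)

lemma mi_abs_Suc:
  assumes "finite (supp \<nu>)"
  shows "mi_abs (\<nu>(j := Suc (\<nu> j))) = Suc (mi_abs \<nu>)"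
proof -
  let ?A = "insert j (supp \<nu>)"
  have "mi_abs (\<nu>(j := Suc (\<nu> j))) = sum (\<nu>(j := Suc (\<nu> j))) ?A"
    using assms by (intro mi_abs_superset) (auto simp: supp_def)
  also have "\<dots> = Suc (sum \<nu> ?A)"
    using assms by (simp add: sum.insert_remove)
  also have "sum \<nu> ?A = mi_abs \<nu>"
    using assms by (intro mi_abs_superset[symmetric]) auto
  finally show ?thesis .
qed

lemma mi_abs_pred:
  assumes "finite (supp \<nu>)" "j \<in> supp \<nu>"
  shows "mi_abs \<nu> = Suc (mi_abs (\<nu>(j := \<nu> j - 1)))"
proof -
  have "\<nu> j \<noteq> 0" using assms(2) by (simp add: supp_def)
  then show ?thesis using mi_abs_Suc[of "\<nu>(j := \<nu> j - 1)" j] assms(1) by simp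
qed

lemma mi_power_superset: "finite A \<Longrightarrow> supp \<nu> \<subseteq> A \<Longrightarrow> mi_power b \<nu> = (\<Prod>j\<in>A. b j ^ \<nu> j)"
  unfolding mi_power_def by (rule prod.mono_neutral_left) (auto simp: supp_def)

lemma mi_power_pred:
  assumes "finite (supp \<nu>)" "j \<in> supp \<nu>"
  shows "mi_power b \<nu> = b j * mi_power b (\<nu>(j := \<nu> j - 1))"
proof -
  have "mi_power b (\<nu>(j := \<nu> j - 1)) = (\<Prod>i\<in>supp \<nu>. b i ^ (\<nu>(j := \<nu> j - 1)) i)"
    using assms by (intro mi_power_superset) (auto simp: supp_def)
  also have "\<dots> = b j ^ (\<nu> j - 1) * (\<Prod>i\<in>supp \<nu> - {j}. b i ^ (\<nu>(j := \<nu> j - 1)) i)"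
    using assms by (simp add: prod.remove)
  also have "(\<Prod>i\<in>supp \<nu> - {j}. b i ^ (\<nu>(j := \<nu> j - 1)) i) = (\<Prod>i\<in>supp \<nu> - {j}. b i ^ \<nu> i)"
    by (intro prod.cong) auto
  finally have "b j * mi_power b (\<nu>(j := \<nu> j - 1)) =
      (b j ^ (\<nu> j - 1) * b j) * (\<Prod>i\<in>supp \<nu> - {j}. b i ^ \<nu> i)"
    by (simp only: mult.assoc mult.left_commute)
  also have "b j ^ (\<nu> j - 1) * b j = b j ^ \<nu> j"
    using assms by (intro power_minus_mult) (simp add: supp_def)
  finally show ?thesis
    using assms by (simp only: mi_power_def[of b \<nu>] prod.remove)
qed

lemma mderiv_y_zero [simp]: "mderiv_y (\<lambda>_. 0) G = G"
  by (simp add: mderiv_y_def)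

text \<open>\<open>mderiv_y\<close> folds over the indices in increasing order, so the largest one
  is applied last and stands outermost. J may lie outside the support; its exponent is then 0 and
  the iterate is the identity.\<close>

lemma mderiv_y_last:
  assumes "finite (supp \<nu>)" "\<And>i. i \<in> supp \<nu> \<Longrightarrow> i \<le> J"
  shows "mderiv_y \<nu> G = (pderiv_y J ^^ \<nu> J)
    (fold (\<lambda>j. pderiv_y j ^^ \<nu> j) (sorted_list_of_set (supp \<nu> - {J})) G)"
proof (cases "J \<in> supp \<nu>")
  case True
  have "sorted_list_of_set (supp \<nu>) = insort J (sorted_list_of_set (supp \<nu> - {J}))"
    using True assms(1) by (metis sorted_list_of_set.fold_insort_key.remove)
  also have "\<dots> = sorted_list_of_set (supp \<nu> - {J}) @ [J]"
    using assms by (intro sorted_insort_is_snoc) auto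
  finally show ?thesis by (simp add: mderiv_y_def)
next
  case False
  then show ?thesis by (simp add: mderiv_y_def supp_def)
qed

lemma mderiv_y_Suc:
  assumes "finite (supp \<nu>)" "\<And>i. i \<in> supp \<nu> \<Longrightarrow> i \<le> J"
  shows "mderiv_y (\<nu>(J := Suc (\<nu> J))) G = pderiv_y J (mderiv_y \<nu> G)"
proof -
  have s: "supp (\<nu>(J := Suc (\<nu> J))) - {J} = supp \<nu> - {J}" by (auto simp: supp_def)
  have "fold (\<lambda>j. pderiv_y j ^^ (\<nu>(J := Suc (\<nu> J))) j) (sorted_list_of_set (supp \<nu> - {J})) G =
      fold (\<lambda>j. pderiv_y j ^^ \<nu> j) (sorted_list_of_set (supp \<nu> - {J})) G"
    using assms by (intro fold_cong) auto
  moreover have "\<And>i. i \<in> supp (\<nu>(J := Suc (\<nu> J))) \<Longrightarrow> i \<le> J"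
    using assms(2) by (auto simp: supp_def split: if_splits)
  ultimately show ?thesis
    using assms by (subst (1 2) mderiv_y_last[where J = J]) (auto simp: s)
qed

text \<open>The form in which nonzero multi-indices enter the inductions: lowering the exponent of
  the largest index of the support lowers the order and leaves an index to which
  \<open>mderiv_y_Suc\<close> applies.\<close>

lemma multi_index_last_cases:
  assumes "finite (supp \<nu>)" "\<nu> \<noteq> (\<lambda>_. 0)"
  obtains J \<mu> where "finite (supp \<mu>)" "\<And>i. i \<in> supp \<mu> \<Longrightarrow> i \<le> J" "\<nu> = \<mu>(J := Suc (\<mu> J))"
    "mi_abs \<mu> < mi_abs \<nu>"
proof -
  define J where "J = Max (supp \<nu>)"
  have J: "J \<in> supp \<nu>" unfolding J_def using assms by (intro Max_in) auto
  define \<mu> where "\<mu> = \<nu>(J := \<nu> J - 1)"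
  show ?thesis
  proof (rule that[of \<mu> J])
    show "finite (supp \<mu>)" using assms by (simp add: \<mu>_def)
    show "i \<le> J" if "i \<in> supp \<mu>" for i
    proof (cases "i = J")
      case False
      then have "i \<in> supp \<nu>" using that by (auto simp: \<mu>_def supp_def)
      then show ?thesis unfolding J_def using assms by simp
    qed simp
    show "\<nu> = \<mu>(J := Suc (\<mu> J))" using J by (auto simp: \<mu>_def supp_def)
    show "mi_abs \<mu> < mi_abs \<nu>" using mi_abs_pred[OF assms(1) J] by (simp add: \<mu>_def)
  qed
qed

section \<open>One-sided partial derivatives on the parameter box\<close>

lemma param_box_upd: "y \<in> param_box \<Longrightarrow> t \<in> {-1/2..1/2} \<Longrightarrow> y(j := t) \<in> param_box"
  by (auto simp: param_box_def)

lemma param_boxD: "y \<in> param_box \<Longrightarrow> y j \<in> {-1/2..1/2}"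
  by (auto simp: param_box_def)

lemma param_box_abs_le: "y \<in> param_box \<Longrightarrow> \<bar>y j\<bar> \<le> 1/2"
  using param_boxD[of y j] unfolding atLeastAtMost_iff by linarith

text \<open>Derivatives within a nondegenerate closed interval are unique, at its end points as
  well.\<close>

lemma pderiv_yI:
  assumes "((\<lambda>t. G (y(j := t)) x) has_real_derivative g) (at (y j) within {-1/2..1/2})"
    and "y \<in> param_box"
  shows "pderiv_y j G y x = g"
  unfolding pderiv_y_def using assms(1) param_boxD[OF assms(2), of j]
  by (intro vector_derivative_within_closed_interval)
     (auto simp: has_real_derivative_iff_has_vector_derivative)

lemma pderiv_y_works:
  assumes "(\<lambda>t. G (y(j := t)) x) differentiable (at (y j) within {-1/2..1/2})"
  shows "((\<lambda>t. G (y(j := t)) x) has_real_derivative pderiv_y j G y x) (at (y j) within {-1/2..1/2})"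
  using assms vector_derivative_works
  by (auto simp: has_real_derivative_iff_has_vector_derivative pderiv_y_def)

text \<open>Always differentiating in the direction of the largest index of the support avoids
  interchanging mixed derivatives.\<close>

lemma mderiv_y_linear_system:
  fixes B :: "(nat \<Rightarrow> real) \<Rightarrow> 'i \<Rightarrow> 'i \<Rightarrow> real" and \<Psi> :: "nat \<Rightarrow> 'i \<Rightarrow> 'i \<Rightarrow> real"
    and c :: "(nat \<Rightarrow> real) \<Rightarrow> 'i \<Rightarrow> real"
  assumes I: "finite I"
    and aff: "\<And>y j t i i'. \<lbrakk>y \<in> param_box; t \<in> {-1/2..1/2}; i \<in> I; i' \<in> I\<rbrakk> \<Longrightarrow>
        B (y(j := t)) i i' = B y i i' + (t - y j) * \<Psi> j i i'"
    and pos: "\<And>y x. \<lbrakk>y \<in> param_box; \<exists>i\<in>I. x i \<noteq> 0\<rbrakk> \<Longrightarrow> (\<Sum>i\<in>I. x i * (\<Sum>j\<in>I. B y i j * x j)) > 0"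
    and sol: "\<And>y i. \<lbrakk>y \<in> param_box; i \<in> I\<rbrakk> \<Longrightarrow> (\<Sum>j\<in>I. B y i j * c y j) = l i"
    and \<nu>: "finite (supp \<nu>)"
  shows "(\<forall>y\<in>param_box. \<forall>i\<in>I. (\<Sum>i'\<in>I. B y i i' * mderiv_y \<nu> c y i') =
      (if \<nu> = (\<lambda>_. 0) then l i else 0) -
      (\<Sum>j\<in>supp \<nu>. real (\<nu> j) * (\<Sum>i'\<in>I. \<Psi> j i i' * mderiv_y (\<nu>(j := \<nu> j - 1)) c y i'))) \<and>
    (\<forall>y\<in>param_box. \<forall>j. \<forall>i\<in>I.
      (\<lambda>t. mderiv_y \<nu> c (y(j := t)) i) differentiable (at (y j) within {-1/2..1/2}))"
    (is "?eq \<nu> \<and> ?diff \<nu>")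
  using \<nu>
\<comment> \<open>Equation and differentiability depend on each other: the equation for \<nu> arises
  by differentiating that of a lower index, and the differentiability at \<nu> is read off from the
  equation for \<nu>. Hence both are proved in one induction on the order.\<close>
proof (induction "mi_abs \<nu>" arbitrary: \<nu> rule: less_induct)
  case less
  note fin = less.prems
  let ?S = "{-1/2..1/2::real}"
  have IHeq: "?eq \<mu>" and IHdiff: "?diff \<mu>" if "finite (supp \<mu>)" "mi_abs \<mu> < mi_abs \<nu>" for \<mu>
    using less.hyps[OF that(2,1)] by blast+
  have eq: "?eq \<nu>"
  proof (cases "\<nu> = (\<lambda>_. 0)")
    case True
    then show ?thesis using sol by simp
  next
    case False
    obtain J \<mu> where \<mu>: "finite (supp \<mu>)" "\<And>i. i \<in> supp \<mu> \<Longrightarrow> i \<le> J"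
      and \<nu>: "\<nu> = \<mu>(J := Suc (\<mu> J))" and lt: "mi_abs \<mu> < mi_abs \<nu>"
      by (rule multi_index_last_cases[OF less.prems(1) False]) blast
    show ?thesis
    proof (intro ballI)
      fix y i assume y: "y \<in> param_box" and i: "i \<in> I"
      have e: "mderiv_y \<nu> c = pderiv_y J (mderiv_y \<mu> c)"
        unfolding \<nu> by (rule mderiv_y_Suc[OF \<mu>])
      have yJ: "y J \<in> ?S" using y param_boxD by blast
      have dmu: "((\<lambda>t. mderiv_y \<mu> c (y(J := t)) i') has_real_derivative mderiv_y \<nu> c y i') (at (y J) within ?S)"
        if "i' \<in> I" for i'
        unfolding e
        by (rule pderiv_y_works[of "mderiv_y \<mu> c"]) (use IHdiff[OF \<mu>(1) lt] that y in blast)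
      \<comment> \<open>Lowering j and raising J commute because j lies in the support of \<mu>,
        also if j = J. The index J still dominates the support of \<kappa>, so the derivative in
        direction J is again the outermost one.\<close>
      have dpred: "((\<lambda>t. mderiv_y (\<mu>(j := \<mu> j - 1)) c (y(J := t)) i') has_real_derivative
          mderiv_y (\<nu>(j := \<nu> j - 1)) c y i') (at (y J) within ?S)"
        if "i' \<in> I" "j \<in> supp \<mu>" for i' j
      proof -
        define \<kappa> where "\<kappa> = \<mu>(j := \<mu> j - 1)"
        have \<kappa>1: "finite (supp \<kappa>)" using \<mu>(1) by (simp add: \<kappa>_def)
        have \<kappa>2: "i \<le> J" if "i \<in> supp \<kappa>" for i
          using \<mu> \<open>j \<in> supp \<mu>\<close> that by (auto simp: \<kappa>_def supp_def split: if_splits)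
        have "mi_abs \<kappa> < mi_abs \<nu>" using mi_abs_pred[OF \<mu>(1) that(2)] lt by (simp add: \<kappa>_def)
        moreover have "\<nu>(j := \<nu> j - 1) = \<kappa>(J := Suc (\<kappa> J))"
          using that(2) by (auto simp: \<nu> \<kappa>_def supp_def)
        ultimately show ?thesis
          unfolding \<kappa>_def[symmetric] using mderiv_y_Suc[OF \<kappa>1 \<kappa>2, of c]
          by (simp only:) (rule pderiv_y_works[of "mderiv_y \<kappa> c"], use IHdiff[OF \<kappa>1] that y in blast)
      qed
      have dB: "((\<lambda>t. B (y(J := t)) i i') has_real_derivative \<Psi> J i i') (at (y J) within ?S)" if "i' \<in> I" for i'
      proof -
        have "((\<lambda>t. B y i i' + (t - y J) * \<Psi> J i i') has_real_derivative \<Psi> J i i') (at (y J) within ?S)"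
          by (auto intro!: derivative_eq_intros)
        then show ?thesis
          by (rule has_field_derivative_transform_within[OF _ zero_less_one yJ])
             (use aff[OF y _ i that] in auto)
      qed
      \<comment> \<open>The two sides of the system for \<mu> along the line in direction J. They
        agree on the whole interval, so their derivatives agree, at an end point too.\<close>
      let ?L = "\<lambda>t. \<Sum>i'\<in>I. B (y(J := t)) i i' * mderiv_y \<mu> c (y(J := t)) i'"
      let ?R = "\<lambda>t. (if \<mu> = (\<lambda>_. 0) then l i else 0) -
          (\<Sum>j\<in>supp \<mu>. real (\<mu> j) * (\<Sum>i'\<in>I. \<Psi> j i i' * mderiv_y (\<mu>(j := \<mu> j - 1)) c (y(J := t)) i'))"
      have L: "(?L has_real_derivative
          (\<Sum>i'\<in>I. \<Psi> J i i' * mderiv_y \<mu> c y i' + mderiv_y \<nu> c y i' * B y i i')) (at (y J) within ?S)"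
        using DERIV_mult[OF dB dmu] by (intro DERIV_sum) auto
      have R: "(?R has_real_derivative
          0 - (\<Sum>j\<in>supp \<mu>. real (\<mu> j) * (\<Sum>i'\<in>I. \<Psi> j i i' * mderiv_y (\<nu>(j := \<nu> j - 1)) c y i')))
          (at (y J) within ?S)"
        by (intro DERIV_diff DERIV_sum DERIV_cmult dpred DERIV_const)
      have "?L t = ?R t" if "t \<in> ?S" for t
        using IHeq[OF \<mu>(1) lt] param_box_upd[OF y that] i by blast
      then have "(?L has_real_derivative
          0 - (\<Sum>j\<in>supp \<mu>. real (\<mu> j) * (\<Sum>i'\<in>I. \<Psi> j i i' * mderiv_y (\<nu>(j := \<nu> j - 1)) c y i')))
          (at (y J) within ?S)"
        by (intro has_field_derivative_transform_within[OF R zero_less_one yJ]) simp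
      with L have "(\<Sum>i'\<in>I. \<Psi> J i i' * mderiv_y \<mu> c y i' + mderiv_y \<nu> c y i' * B y i i') =
          0 - (\<Sum>j\<in>supp \<mu>. real (\<mu> j) * (\<Sum>i'\<in>I. \<Psi> j i i' * mderiv_y (\<nu>(j := \<nu> j - 1)) c y i'))"
        using yJ by (intro vector_derivative_unique_within_closed_interval[of "-1/2" "1/2" "y J" ?L])
          (auto simp: has_real_derivative_iff_has_vector_derivative)
      then have main: "(\<Sum>i'\<in>I. B y i i' * mderiv_y \<nu> c y i') =
          - ((\<Sum>i'\<in>I. \<Psi> J i i' * mderiv_y \<mu> c y i') +
          (\<Sum>j\<in>supp \<mu>. real (\<mu> j) * (\<Sum>i'\<in>I. \<Psi> j i i' * mderiv_y (\<nu>(j := \<nu> j - 1)) c y i')))"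
        by (simp add: sum.distrib mult.commute)
      define g where "g = (\<lambda>j. \<Sum>i'\<in>I. \<Psi> j i i' * mderiv_y (\<nu>(j := \<nu> j - 1)) c y i')"
      have gJ: "g J = (\<Sum>i'\<in>I. \<Psi> J i i' * mderiv_y \<mu> c y i')" by (simp add: g_def \<nu>)
      \<comment> \<open>The term with \<Psi>_J produced by the product rule raises the coefficient
        of \<open>g J\<close> from \<mu>_J to \<mu>_J + 1. If J is not in the support of \<mu>, it
        may be added to the sum with coefficient 0.\<close>
      have "(\<Sum>j\<in>supp \<nu>. real (\<nu> j) * g j) = g J + (\<Sum>j\<in>supp \<mu>. real (\<mu> j) * g j)"
      proof -
        have supp: "supp \<nu> = insert J (supp \<mu>)" by (auto simp: \<nu> supp_def)
        have "(\<Sum>j\<in>insert J (supp \<mu>). real (\<nu> j) * g j) =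
            (\<Sum>j\<in>insert J (supp \<mu>). (if j = J then g j else 0) + real (\<mu> j) * g j)"
          by (intro sum.cong) (auto simp: \<nu> algebra_simps)
        also have "\<dots> = g J + (\<Sum>j\<in>insert J (supp \<mu>). real (\<mu> j) * g j)"
          using \<mu>(1) by (simp add: sum.distrib)
        also have "(\<Sum>j\<in>insert J (supp \<mu>). real (\<mu> j) * g j) = (\<Sum>j\<in>supp \<mu>. real (\<mu> j) * g j)"
          using \<mu>(1) by (intro sum.mono_neutral_right) (auto simp: supp_def)
        finally show ?thesis by (simp add: supp)
      qed
      with main gJ show "(\<Sum>i'\<in>I. B y i i' * mderiv_y \<nu> c y i') =
          (if \<nu> = (\<lambda>_. 0) then l i else 0) -
          (\<Sum>j\<in>supp \<nu>. real (\<nu> j) * (\<Sum>i'\<in>I. \<Psi> j i i' * mderiv_y (\<nu>(j := \<nu> j - 1)) c y i'))"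
        using False by (simp add: g_def)
    qed
  qed
  moreover have "?diff \<nu>"
  proof (intro ballI allI)
    fix y j assume y: "y \<in> param_box"
    have yj: "y j \<in> ?S" using y param_boxD by blast
    \<comment> \<open>Only derivatives of lower order occur here, which are differentiable by
      induction. So the derivative of order \<nu> solves a positive definite system with
      differentiable data.\<close>
    let ?b = "\<lambda>t i. (if \<nu> = (\<lambda>_. 0) then l i else 0) -
      (\<Sum>j'\<in>supp \<nu>. real (\<nu> j') * (\<Sum>i'\<in>I. \<Psi> j' i i' * mderiv_y (\<nu>(j' := \<nu> j' - 1)) c (y(j := t)) i'))"
    have "\<forall>i\<in>I. (\<lambda>t. mderiv_y \<nu> c (y(j := t)) i) differentiable (at (y j) within ?S)"
    proof (rule positive_definite_solution_differentiable[OF I yj,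
          where A = "\<lambda>t. B (y(j := t))" and b = ?b])
      show "(\<lambda>t. B (y(j := t)) i i') differentiable (at (y j) within ?S)" if "i \<in> I" "i' \<in> I" for i i'
      proof (rule differentiable_cong_within[OF _ yj])
        show "(\<lambda>t. B y i i' + (t - y j) * \<Psi> j i i') differentiable (at (y j) within ?S)"
          by (intro differentiable_add differentiable_mult differentiable_diff) auto
      qed (use aff[OF y _ that] in auto)
      show "(\<lambda>t. ?b t i) differentiable (at (y j) within ?S)" for i
      proof (intro differentiable_diff differentiable_sum differentiable_mult ballI)
        fix j' i' assume j': "j' \<in> supp \<nu>" and i': "i' \<in> I"
        have "finite (supp (\<nu>(j' := \<nu> j' - 1)))" using fin by simp
        moreover have "mi_abs (\<nu>(j' := \<nu> j' - 1)) < mi_abs \<nu>"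
          using mi_abs_pred[OF fin j'] by linarith
        ultimately show "(\<lambda>t. mderiv_y (\<nu>(j' := \<nu> j' - 1)) c (y(j := t)) i') differentiable (at (y j) within ?S)"
          using IHdiff y i' by blast
      qed (auto simp: I fin)
      show "0 < (\<Sum>i\<in>I. x i * (\<Sum>i'\<in>I. B (y(j := t)) i i' * x i'))" if "t \<in> ?S" "\<exists>i\<in>I. x i \<noteq> 0" for t x
        using pos[OF param_box_upd[OF y that(1)] that(2)] by blast
      show "(\<Sum>i'\<in>I. B (y(j := t)) i i' * mderiv_y \<nu> c (y(j := t)) i') = ?b t i" if "t \<in> ?S" "i \<in> I" for t i
        using eq param_box_upd[OF y that(1)] that(2) by blast
    qed
    then show "\<And>i. i \<in> I \<Longrightarrow> (\<lambda>t. mderiv_y \<nu> c (y(j := t)) i) differentiable (at (y j) within ?S)" by blast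
  qed
  ultimately show ?case by blast
qed

text \<open>Here \<open>\<phi> i\<close> stands for the value of a basis function at the fixed point
  x. Since \<open>pderiv_y\<close> is total, it may be taken inside the sum only because the
  coefficients are known to be differentiable.\<close>

lemma mderiv_y_sum:
  fixes c :: "(nat \<Rightarrow> real) \<Rightarrow> 'i \<Rightarrow> real" and u :: "(nat \<Rightarrow> real) \<Rightarrow> 'a \<Rightarrow> real"
  assumes I: "finite I"
    and diff: "\<And>\<nu> y j i. \<lbrakk>finite (supp \<nu>); y \<in> param_box; i \<in> I\<rbrakk> \<Longrightarrow>
      (\<lambda>t. mderiv_y \<nu> c (y(j := t)) i) differentiable (at (y j) within {-1/2..1/2})"
    and u: "\<And>y. y \<in> param_box \<Longrightarrow> u y x = (\<Sum>i\<in>I. c y i * \<phi> i)"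
    and \<nu>: "finite (supp \<nu>)" and y: "y \<in> param_box"
  shows "mderiv_y \<nu> u y x = (\<Sum>i\<in>I. mderiv_y \<nu> c y i * \<phi> i)"
  using \<nu> y
proof (induction "mi_abs \<nu>" arbitrary: \<nu> y rule: less_induct)
  case less
  note y = less.prems(2)
  show ?case
  proof (cases "\<nu> = (\<lambda>_. 0)")
    case True
    then show ?thesis using u[OF y] by simp
  next
    case False
    obtain J \<mu> where \<mu>: "finite (supp \<mu>)" "\<And>i. i \<in> supp \<mu> \<Longrightarrow> i \<le> J"
      and \<nu>: "\<nu> = \<mu>(J := Suc (\<mu> J))" and lt: "mi_abs \<mu> < mi_abs \<nu>"
      by (rule multi_index_last_cases[OF less.prems(1) False]) blast
    have e: "mderiv_y \<nu> G = pderiv_y J (mderiv_y \<mu> G)" for G :: "(nat \<Rightarrow> real) \<Rightarrow> 'a \<Rightarrow> real"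
      unfolding \<nu> by (rule mderiv_y_Suc[OF \<mu>])
    have e': "mderiv_y \<nu> c = pderiv_y J (mderiv_y \<mu> c)"
      unfolding \<nu> by (rule mderiv_y_Suc[OF \<mu>])
    have "((\<lambda>t. \<Sum>i\<in>I. mderiv_y \<mu> c (y(J := t)) i * \<phi> i) has_real_derivative
        (\<Sum>i\<in>I. mderiv_y \<nu> c y i * \<phi> i)) (at (y J) within {-1/2..1/2})"
      unfolding e'
      by (intro DERIV_sum DERIV_cmult_right pderiv_y_works[of "mderiv_y \<mu> c"] diff \<mu>(1) y)
    then have "((\<lambda>t. mderiv_y \<mu> u (y(J := t)) x) has_real_derivative
        (\<Sum>i\<in>I. mderiv_y \<nu> c y i * \<phi> i)) (at (y J) within {-1/2..1/2})"
      by (rule has_field_derivative_transform_within[OF _ zero_less_one param_boxD[OF y]])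
         (use less.hyps[OF lt \<mu>(1)] param_box_upd[OF y] in auto)
    from pderiv_yI[of "mderiv_y \<mu> u", OF this y] show ?thesis
      by (simp add: e)
  qed
qed

section \<open>Square-integrable functions\<close>

text \<open>For positive A and B the minimiser t = sqrt B / sqrt A turns the right-hand side into
  twice the geometric mean. This is the optimisation step behind the Cauchy-Schwarz inequality
  below.\<close>

lemma weighted_AM_GM_imp_le_geometric_mean:
  fixes A B c :: real
  assumes "A \<ge> 0" "B \<ge> 0" and le: "\<And>t. t > 0 \<Longrightarrow> 2 * c \<le> t * A + B / t"
  shows "c \<le> sqrt A * sqrt B"
proof (rule ccontr)
  assume "\<not> ?thesis"
  then have c: "sqrt A * sqrt B < c" by simp
  then have c0: "c > 0" using assms by (meson le_less_trans mult_nonneg_nonneg real_sqrt_ge_zero)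
  consider "A = 0" | "B = 0" | "A > 0" "B > 0" using assms by linarith
  then show False
  proof cases
    case 1
    \<comment> \<open>If A = 0 there is no such minimiser, but with t = (B + 1) / c the right-hand
      side is already at most c. The case B = 0 is symmetric, with t = c / (A + 1).\<close>
    have "2 * c \<le> B / ((B + 1) / c)" using le[of "(B + 1) / c"] 1 c0 assms by simp
    also have "\<dots> \<le> c" using c0 assms by (simp add: field_simps)
    finally show False using c0 by simp
  next
    case 2
    have "2 * c \<le> (c / (A + 1)) * A" using le[of "c / (A + 1)"] 2 c0 assms by simp
    also have "\<dots> \<le> c" using c0 assms by (simp add: field_simps)
    finally show False using c0 by simp
  next
    case 3
    have "2 * c \<le> (sqrt B / sqrt A) * A + B / (sqrt B / sqrt A)"
      by (rule le) (use 3 in simp)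
    also have "\<dots> = 2 * (sqrt A * sqrt B)"
    proof -
      have "A = sqrt A * sqrt A" "B = sqrt B * sqrt B" using 3 by simp_all
      then show ?thesis using 3 by (simp add: field_simps)
    qed
    finally show False using c by simp
  qed
qed

lemma L2_norm_on_nonneg [simp]: "L2_norm_on M g \<ge> 0"
  by (simp add: L2_norm_on_def)

lemma L2_norm_on_squared: "(L2_norm_on M g)\<^sup>2 = (LINT x|M. (norm (g x))\<^sup>2)"
  by (simp add: L2_norm_on_def)

lemma L2_norm_on_cong:
  assumes "\<And>x. x \<in> space M \<Longrightarrow> f x = g x"
  shows "L2_norm_on M f = L2_norm_on M g"
proof -
  have "(LINT x|M. (norm (f x))\<^sup>2) = (LINT x|M. (norm (g x))\<^sup>2)"
    using assms by (intro Bochner_Integration.integral_cong) auto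
  then show ?thesis by (simp add: L2_norm_on_def)
qed

text \<open>Cauchy-Schwarz: the pointwise Young inequality with weight t is integrated and then
  optimised over t. Only the norms of f and g enter, so they may take values in different spaces.
  The factor q is put under both roots.\<close>

lemma abs_integral_le_L2_norms:
  fixes h :: "'a \<Rightarrow> real" and f :: "'a \<Rightarrow> 'b::real_normed_vector" and g :: "'a \<Rightarrow> 'c::real_normed_vector"
  assumes h: "integrable M h" and f: "integrable M (\<lambda>x. (norm (f x))\<^sup>2)"
    and g: "integrable M (\<lambda>x. (norm (g x))\<^sup>2)"
    and le: "\<And>x. x \<in> space M \<Longrightarrow> \<bar>h x\<bar> \<le> q * (norm (f x) * norm (g x))" and q: "q \<ge> 0"
  shows "\<bar>LINT x|M. h x\<bar> \<le> q * (L2_norm_on M f * L2_norm_on M g)"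
proof -
  let ?A = "LINT x|M. (norm (f x))\<^sup>2" and ?B = "LINT x|M. (norm (g x))\<^sup>2"
  have "\<bar>LINT x|M. h x\<bar> \<le> sqrt (q * ?A) * sqrt (q * ?B)"
  proof (rule weighted_AM_GM_imp_le_geometric_mean)
    fix t :: real assume t: "t > 0"
    have "\<bar>LINT x|M. h x\<bar> \<le> (LINT x|M. \<bar>h x\<bar>)" by (rule integral_abs_bound)
    also have "\<dots> \<le> (LINT x|M. q / 2 * (t * (norm (f x))\<^sup>2 + (norm (g x))\<^sup>2 / t))"
    proof (rule integral_mono)
      fix x assume x: "x \<in> space M"
      have "0 \<le> (t * norm (f x) - norm (g x))\<^sup>2" by simp
      then have "2 * (t * (norm (f x) * norm (g x))) \<le> t\<^sup>2 * (norm (f x))\<^sup>2 + (norm (g x))\<^sup>2"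
        by (simp add: power2_eq_square algebra_simps)
      then have "2 * (t * (norm (f x) * norm (g x))) / t \<le> (t\<^sup>2 * (norm (f x))\<^sup>2 + (norm (g x))\<^sup>2) / t"
        using t by (intro divide_right_mono) auto
      then have "norm (f x) * norm (g x) \<le> (t * (norm (f x))\<^sup>2 + (norm (g x))\<^sup>2 / t) / 2"
        using t by (simp add: power2_eq_square add_divide_distrib)
      then have "q * (norm (f x) * norm (g x)) \<le> q * ((t * (norm (f x))\<^sup>2 + (norm (g x))\<^sup>2 / t) / 2)"
        using q by (rule mult_left_mono)
      then show "\<bar>h x\<bar> \<le> q / 2 * (t * (norm (f x))\<^sup>2 + (norm (g x))\<^sup>2 / t)"
        using le[OF x] by simp
    qed (use h f g in auto)
    also have "\<dots> = q / 2 * (t * ?A + ?B / t)" using f g by simp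
    also have "\<dots> = (t * (q * ?A) + q * ?B / t) / 2"
      using t by (simp add: field_simps)
    finally show "2 * \<bar>LINT x|M. h x\<bar> \<le> t * (q * ?A) + q * ?B / t"
      unfolding le_divide_eq_numeral1 by (simp only: mult.commute)
  qed (use q in auto)
  also have "\<dots> = q * (L2_norm_on M f * L2_norm_on M g)"
    using q by (simp add: L2_norm_on_def real_sqrt_mult)
  finally show ?thesis .
qed

lemma L2_space_add: 
  assumes "v \<in> L2_space D" "w \<in> L2_space D"
  shows "(\<lambda>x. v x + w x) \<in> L2_space D"
proof -
  have m: "v \<in> borel_measurable (lebesgue_on D)" "w \<in> borel_measurable (lebesgue_on D)"
    and i: "integrable (lebesgue_on D) (\<lambda>x. (v x)\<^sup>2)" "integrable (lebesgue_on D) (\<lambda>x. (w x)\<^sup>2)"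
    using assms by (auto simp: L2_space_def)
  have "integrable (lebesgue_on D) (\<lambda>x. (v x + w x)\<^sup>2)"
  proof (rule Bochner_Integration.integrable_bound)
    show "integrable (lebesgue_on D) (\<lambda>x. 2 * (v x)\<^sup>2 + 2 * (w x)\<^sup>2)" using i by simp
    show "(\<lambda>x. (v x + w x)\<^sup>2) \<in> borel_measurable (lebesgue_on D)" using m by measurable
    have "(v x + w x)\<^sup>2 \<le> 2 * (v x)\<^sup>2 + 2 * (w x)\<^sup>2" for x
      using sum_squares_bound[of "v x" "w x"] by (simp add: power2_sum)
    then show "AE x in lebesgue_on D. norm ((v x + w x)\<^sup>2) \<le> norm (2 * (v x)\<^sup>2 + 2 * (w x)\<^sup>2)"
      by simp
  qed
  with m show ?thesis by (simp add: L2_space_def)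
qed

lemma L2_space_scale:
  assumes "v \<in> L2_space D"
  shows "(\<lambda>x. s * v x) \<in> L2_space D"
  using assms by (auto simp: L2_space_def power_mult_distrib)

lemma integrable_L2_mult:
  assumes "v \<in> L2_space D" "w \<in> L2_space D"
  shows "integrable (lebesgue_on D) (\<lambda>x. v x * w x)"
proof -
  have m: "v \<in> borel_measurable (lebesgue_on D)" "w \<in> borel_measurable (lebesgue_on D)"
    and i: "integrable (lebesgue_on D) (\<lambda>x. (v x)\<^sup>2)" "integrable (lebesgue_on D) (\<lambda>x. (w x)\<^sup>2)"
    using assms by (auto simp: L2_space_def)
  show ?thesis
  proof (rule Bochner_Integration.integrable_bound)
    show "integrable (lebesgue_on D) (\<lambda>x. (v x)\<^sup>2 + (w x)\<^sup>2)" using i by simp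
    show "(\<lambda>x. v x * w x) \<in> borel_measurable (lebesgue_on D)" using m by measurable
    have "\<bar>v x * w x\<bar> \<le> (v x)\<^sup>2 + (w x)\<^sup>2" for x
    proof -
      have "2 * (v x * w x) \<le> (v x)\<^sup>2 + (w x)\<^sup>2" "- 2 * (v x * w x) \<le> (v x)\<^sup>2 + (w x)\<^sup>2"
        using sum_squares_bound[of "v x" "w x"] sum_squares_bound[of "- v x" "w x"] by simp_all
      moreover have "0 \<le> (v x)\<^sup>2 + (w x)\<^sup>2" by simp
      ultimately show ?thesis by linarith
    qed
    then show "AE x in lebesgue_on D. norm (v x * w x) \<le> norm ((v x)\<^sup>2 + (w x)\<^sup>2)"
      by simp
  qed
qed

section \<open>Essential suprema\<close>

text \<open>On a null domain the essential supremum is minus infinity, or infinity for a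
  non-measurable function; \<open>real_of_ereal\<close> sends both to 0.\<close>

lemma Linf_norm_nonneg: "Linf_norm D v \<ge> 0"
proof (cases "emeasure (lebesgue_on D) (space (lebesgue_on D)) = 0")
  case True
  have "esssup (lebesgue_on D) (\<lambda>x. ereal (norm (v x))) = - \<infinity>
      \<or> esssup (lebesgue_on D) (\<lambda>x. ereal (norm (v x))) = \<infinity>"
    using True esssup_zero_space[of "lebesgue_on D"] esssup_non_measurable[of "\<lambda>x. ereal (norm (v x))" "lebesgue_on D" ]
    by (auto simp: top_ereal_def)
  then show ?thesis by (auto simp: Linf_norm_def)
next
  case False
  have "0 = esssup (lebesgue_on D) (\<lambda>x. 0 :: ereal)" using False by (simp add: esssup_const)
  also have "\<dots> \<le> esssup (lebesgue_on D) (\<lambda>x. ereal (norm (v x)))"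
    by (intro esssup_mono) auto
  finally show ?thesis unfolding Linf_norm_def by (rule real_of_ereal_pos)
qed

lemma AE_norm_le_Linf_norm:
  assumes "v \<in> Linf_space D"
  shows "AE x in lebesgue_on D. norm (v x) \<le> Linf_norm D v"
proof -
  let ?e = "esssup (lebesgue_on D) (\<lambda>x. ereal (norm (v x)))"
  have fin: "?e < \<infinity>" using assms by (simp add: Linf_space_def)
  have "AE x in lebesgue_on D. ereal (norm (v x)) \<le> ?e" by (rule esssup_AE)
  then show ?thesis
  proof (eventually_elim)
    case (elim x)
    have "?e \<noteq> -\<infinity>" using elim by auto
    then have "?e = ereal (Linf_norm D v)" using fin by (auto simp: Linf_norm_def ereal_real)
    with elim show ?case by simp
  qed
qed

text \<open>A nonempty open set has positive measure, so it cannot miss the set where P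
  holds.\<close>

lemma AE_imp_dense:
  fixes D :: "'a::euclidean_space set"
  assumes "open D" and ae: "AE x in lebesgue_on D. P x" and U: "open U" "U \<inter> D \<noteq> {}"
  shows "\<exists>x\<in>U \<inter> D. P x"
proof (rule ccontr)
  assume neg: "\<not> ?thesis"
  have oU: "open (U \<inter> D)" using assms by auto
  have "AE x in lebesgue. x \<in> D \<longrightarrow> P x"
    using ae assms(1) by (subst (asm) AE_restrict_space_iff) auto
  then have "AE x in lebesgue. x \<notin> U \<inter> D" by eventually_elim (use neg in blast)
  then have "U \<inter> D \<in> null_sets lebesgue"
    using oU by (subst AE_iff_null_sets) auto
  then have "negligible (U \<inter> D)" by (simp add: negligible_iff_null_sets)
  then show False using open_not_negligible[OF oU U(2)] by blast
qed

text \<open>If the bound failed at x, continuity would make it fail on a neighbourhood, and this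
  neighbourhood meets D in a nonempty open set. The closure matters: bounds on the null sets formed
  by the faces come from here.\<close>

lemma norm_le_Linf_norm:
  fixes D :: "'a::euclidean_space set" and v :: "'a \<Rightarrow> 'b::real_normed_vector"
  assumes D: "open D" and v: "v \<in> Linf_space D" and cont: "continuous_on (closure D) v"
    and x: "x \<in> closure D"
  shows "norm (v x) \<le> Linf_norm D v"
proof (rule ccontr)
  assume "\<not> ?thesis"
  then have gt: "norm (v x) > Linf_norm D v" by simp
  have "continuous (at x within closure D) (\<lambda>z. norm (v z))"
    using cont x by (auto simp: continuous_on_eq_continuous_within intro: continuous_norm)
  then have "eventually (\<lambda>z. norm (v z) > Linf_norm D v) (at x within closure D)"
    using gt by (auto simp: continuous_within order_tendsto_iff)
  then obtain U where U: "open U" "x \<in> U" "\<And>z. z \<in> U \<Longrightarrow> z \<noteq> x \<Longrightarrow> z \<in> closure D \<Longrightarrow> norm (v z) > Linf_norm D v"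
    by (auto simp: eventually_at_topological)
  have "U \<inter> D \<noteq> {}" using U x open_Int_closure_eq_empty[OF U(1), of D] by blast
  with AE_imp_dense[OF D AE_norm_le_Linf_norm[OF v] U(1)]
  obtain z where z: "z \<in> U" "z \<in> D" "norm (v z) \<le> Linf_norm D v" by blast
  moreover have "norm (v z) > Linf_norm D v"
    using U(3)[of z] gt z closure_subset by (cases "z = x") auto
  ultimately show False by simp
qed

section \<open>Traces of functions with a continuous extension\<close>

text \<open>The functions for which \<open>trace\<close> acts like restriction to the closure.
  Outside T the values of q are arbitrary, in particular on the faces of T.\<close>

definition extends_to_closure ::
  "'a::euclidean_space set \<Rightarrow> ('a \<Rightarrow> 'b::real_normed_vector) \<Rightarrow> bool" where
  "extends_to_closure T q \<longleftrightarrow> (\<exists>q'. continuous_on (closure T) q' \<and> (\<forall>x\<in>T. q x = q' x))"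

text \<open>Every point of the closure of an open set is a limit point of it, so the filter that
  defines the trace is proper and the limit is unique.\<close>

lemma trace_eq:
  assumes T: "open T" and q': "continuous_on (closure T) q'" and eq: "\<And>z. z \<in> T \<Longrightarrow> q z = q' z"
    and x: "x \<in> closure T"
  shows "trace T q x = q' x"
proof -
  have lim: "(q' \<longlongrightarrow> q' x) (at x within T)"
    using q' x closure_subset by (auto simp: continuous_on_def intro: tendsto_within_subset)
  have "eventually (\<lambda>z. q' z = q z) (at x within T)"
    using eq by (auto simp: eventually_at_filter)
  with lim have "(q \<longlongrightarrow> q' x) (at x within T)" by (rule Lim_transform_eventually)
  moreover have "x islimpt T"
    using x open_imp_islimpt[OF T] by (auto simp: closure_def)
  then have "at x within T \<noteq> bot"
    by (simp add: trivial_limit_within)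
  ultimately show ?thesis unfolding trace_def by (intro tendsto_Lim) auto
qed

lemma trace_inside:
  assumes "open T" "extends_to_closure T q" "x \<in> T"
  shows "trace T q x = q x"
  using assms trace_eq[of T _ q x] closure_subset unfolding extends_to_closure_def by force

lemma continuous_on_trace:
  assumes "open T" "extends_to_closure T q"
  shows "continuous_on (closure T) (trace T q)"
proof -
  obtain q' where q': "continuous_on (closure T) q'" "\<forall>x\<in>T. q x = q' x"
    using assms by (auto simp: extends_to_closure_def)
  have "trace T q x = q' x" if "x \<in> closure T" for x
    using trace_eq[OF assms(1) q'(1) _ that] q'(2) by simp
  with q'(1) show ?thesis by (simp cong: continuous_on_cong)
qed

text \<open>No limit has to exist: both sides are the same definite description, as it sees only
  values inside T.\<close>

lemma trace_cong:
  assumes "\<And>x. x \<in> T \<Longrightarrow> q x = q' x"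
  shows "trace T q = trace T q'"
proof
  fix x
  have "eventually (\<lambda>z. q z = q' z) (at x within T)"
    using assms by (auto simp: eventually_at_filter)
  then have "(q \<longlongrightarrow> l) (at x within T) \<longleftrightarrow> (q' \<longlongrightarrow> l) (at x within T)" for l
    by (rule tendsto_cong)
  then show "trace T q x = trace T q' x" by (simp add: trace_def Topological_Spaces.Lim_def)
qed

lemma extends_to_closureI:
  "continuous_on (closure T) q' \<Longrightarrow> (\<And>x. x \<in> T \<Longrightarrow> q x = q' x) \<Longrightarrow> extends_to_closure T q"
  by (auto simp: extends_to_closure_def)

lemma trace_add:
  fixes q r :: "'a::euclidean_space \<Rightarrow> 'b::real_normed_vector"
  assumes T: "open T" and q: "extends_to_closure T q" and r: "extends_to_closure T r"
    and x: "x \<in> closure T"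
  shows "trace T (\<lambda>x. q x + r x) x = trace T q x + trace T r x"
proof -
  have c: "continuous_on (closure T) (\<lambda>x. trace T q x + trace T r x)"
    by (intro continuous_on_add continuous_on_trace T q r)
  have e: "q x + r x = trace T q x + trace T r x" if "x \<in> T" for x
    using that by (simp add: trace_inside T q r)
  show ?thesis by (rule trace_eq[OF T c e x])
qed

lemma
  fixes q :: "'a::euclidean_space \<Rightarrow> real" and r :: "'a::euclidean_space \<Rightarrow> 'b::real_normed_vector"
  assumes T: "open T" and q: "extends_to_closure T q" and r: "extends_to_closure T r"
  shows extends_to_closure_scaleR: "extends_to_closure T (\<lambda>x. q x *\<^sub>R r x)"
    and trace_scaleR: "x \<in> closure T \<Longrightarrow> trace T (\<lambda>x. q x *\<^sub>R r x) x = trace T q x *\<^sub>R trace T r x"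
proof -
  have c: "continuous_on (closure T) (\<lambda>x. trace T q x *\<^sub>R trace T r x)"
    by (intro continuous_on_scaleR continuous_on_trace T q r)
  have e: "q x *\<^sub>R r x = trace T q x *\<^sub>R trace T r x" if "x \<in> T" for x
    using that by (simp add: trace_inside T q r)
  show "extends_to_closure T (\<lambda>x. q x *\<^sub>R r x)" using c e by (rule extends_to_closureI)
  show "x \<in> closure T \<Longrightarrow> trace T (\<lambda>x. q x *\<^sub>R r x) x = trace T q x *\<^sub>R trace T r x"
    by (rule trace_eq[OF T c e])
qed

lemma
  fixes q r :: "'a::euclidean_space \<Rightarrow> 'b::real_inner"
  assumes T: "open T" and q: "extends_to_closure T q" and r: "extends_to_closure T r"
  shows extends_to_closure_inner: "extends_to_closure T (\<lambda>x. q x \<bullet> r x)"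
    and trace_inner: "x \<in> closure T \<Longrightarrow> trace T (\<lambda>x. q x \<bullet> r x) x = trace T q x \<bullet> trace T r x"
proof -
  have c: "continuous_on (closure T) (\<lambda>x. trace T q x \<bullet> trace T r x)"
    by (intro continuous_on_inner continuous_on_trace T q r)
  have e: "q x \<bullet> r x = trace T q x \<bullet> trace T r x" if "x \<in> T" for x
    using that by (simp add: trace_inside T q r)
  show "extends_to_closure T (\<lambda>x. q x \<bullet> r x)" using c e by (rule extends_to_closureI)
  show "x \<in> closure T \<Longrightarrow> trace T (\<lambda>x. q x \<bullet> r x) x = trace T q x \<bullet> trace T r x"
    by (rule trace_eq[OF T c e])
qed

lemma extends_to_closure_const [simp]: "extends_to_closure T (\<lambda>_. c)"
  by (rule extends_to_closureI[of T "\<lambda>_. c"]) auto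

lemma trace_const: "open T \<Longrightarrow> x \<in> closure T \<Longrightarrow> trace T (\<lambda>_. c) x = c"
  by (rule trace_eq) auto

lemma integrable_extends_to_closure:
  fixes q :: "'a::euclidean_space \<Rightarrow> 'b::{euclidean_space}"
  assumes T: "open T" "bounded T" and q: "extends_to_closure T q"
  shows "integrable (lebesgue_on T) q"
proof -
  interpret finite_measure "lebesgue_on T"
    using T by (intro finite_measure_lebesgue_on lmeasurable_open) auto
  obtain q' where q': "continuous_on (closure T) q'" "\<forall>x\<in>T. q x = q' x"
    using q by (auto simp: extends_to_closure_def)
  have "bounded (q' ` closure T)"
    using T q' by (intro compact_imp_bounded compact_continuous_image) auto
  then obtain M where M: "\<And>x. x \<in> closure T \<Longrightarrow> norm (q' x) \<le> M" by (auto simp: bounded_iff)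
  have "q' \<in> borel_measurable (lebesgue_on T)"
    using T q'(1) closure_subset
    by (intro continuous_imp_measurable_on_sets_lebesgue) (auto intro: continuous_on_subset sets_completionI_sets)
  then have "q \<in> borel_measurable (lebesgue_on T)"
    using q'(2) by (subst measurable_cong[where g = q']) auto
  then show ?thesis
    using M q'(2) by (intro integrable_const_bound[where B = M]) (auto intro!: AE_I2 M simp: closure_def)
qed

section \<open>Polynomials and their gradients\<close>

lemma poly_exponents_finite: "finite (poly_exponents k :: ('a::euclidean_space \<Rightarrow> nat) set)"
proof (rule finite_subset)
  show "poly_exponents k \<subseteq> (Basis :: 'a set) \<rightarrow>\<^sub>E {..k}"
  proof
    fix e :: "'a \<Rightarrow> nat" assume "e \<in> poly_exponents k"
    then have e: "e \<in> Basis \<rightarrow>\<^sub>E UNIV" and s: "sum e Basis \<le> k" by (auto simp: poly_exponents_def)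
    have "e b \<le> k" if "b \<in> Basis" for b using member_le_sum[of b Basis e] that s by auto
    with e show "e \<in> Basis \<rightarrow>\<^sub>E {..k}" by (auto simp: PiE_iff)
  qed
qed (auto intro: finite_PiE)

lemma is_poly_add:
  assumes "is_poly_of_degree_le k p" "is_poly_of_degree_le k q"
  shows "is_poly_of_degree_le k (\<lambda>x. p x + q x)"
proof -
  obtain c d where "\<And>x. p x = (\<Sum>e\<in>poly_exponents k. c e * (\<Prod>b\<in>Basis. (x \<bullet> b) ^ e b))"
    "\<And>x. q x = (\<Sum>e\<in>poly_exponents k. d e * (\<Prod>b\<in>Basis. (x \<bullet> b) ^ e b))"
    using assms by (auto simp: is_poly_of_degree_le_def)
  then have "p x + q x = (\<Sum>e\<in>poly_exponents k. (c e + d e) * (\<Prod>b\<in>Basis. (x \<bullet> b) ^ e b))" for x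
    by (simp add: sum.distrib distrib_right)
  then show ?thesis unfolding is_poly_of_degree_le_def by (intro exI[where x = "\<lambda>e. c e + d e"]) blast
qed

lemma is_poly_scale:
  assumes "is_poly_of_degree_le k p"
  shows "is_poly_of_degree_le k (\<lambda>x. s * p x)"
proof -
  obtain c where "\<And>x. p x = (\<Sum>e\<in>poly_exponents k. c e * (\<Prod>b\<in>Basis. (x \<bullet> b) ^ e b))"
    using assms by (auto simp: is_poly_of_degree_le_def)
  then have "s * p x = (\<Sum>e\<in>poly_exponents k. (s * c e) * (\<Prod>b\<in>Basis. (x \<bullet> b) ^ e b))" for x
    by (simp add: sum_distrib_left mult.assoc)
  then show ?thesis unfolding is_poly_of_degree_le_def by (intro exI[where x = "\<lambda>e. s * c e"]) blast
qed

lemma is_poly_monomial: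
  assumes "(\<Sum>b\<in>Basis. e b) \<le> k"
  shows "is_poly_of_degree_le k (\<lambda>x::'a::euclidean_space. \<Prod>b\<in>Basis. (x \<bullet> b) ^ e b)"
proof -
  \<comment> \<open>Elements of \<open>poly_exponents\<close> are extensional, so the values of e
    off the basis are discarded.\<close>
  define e' where "e' = restrict e (Basis :: 'a set)"
  have e': "e' \<in> poly_exponents k" using assms by (auto simp: e'_def poly_exponents_def)
  have "(\<Sum>d\<in>poly_exponents k. (if d = e' then 1 else 0) * (\<Prod>b\<in>Basis. (x \<bullet> b) ^ d b)) =
      (\<Sum>d\<in>poly_exponents k. if d = e' then (\<Prod>b\<in>Basis. (x \<bullet> b) ^ d b) else 0)" for x :: 'a
    by (intro sum.cong) auto
  also have "\<dots> x = (\<Prod>b\<in>Basis. (x \<bullet> b) ^ e b)" for x :: 'a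
    using e' by (simp add: poly_exponents_finite) (simp add: e'_def)
  finally show ?thesis unfolding is_poly_of_degree_le_def
    by (intro exI[where x = "\<lambda>d. if d = e' then 1 else 0"]) simp
qed

lemma is_poly_zero: "is_poly_of_degree_le k (\<lambda>_. 0)"
  unfolding is_poly_of_degree_le_def by (intro exI[where x = "\<lambda>_. 0"]) simp

lemma is_poly_sum:
  assumes "\<And>i. i \<in> I \<Longrightarrow> is_poly_of_degree_le k (p i)"
  shows "is_poly_of_degree_le k (\<lambda>x. \<Sum>i\<in>I. p i x)"
  using assms
  by (induction I rule: infinite_finite_induct) (auto intro: is_poly_zero is_poly_add)

text \<open>For e i = 0 the truncated exponent e i - 1 is 0 as well, but the factor
  \<open>real (e i)\<close> removes the term.\<close>

lemma monomial_GDERIV: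
  fixes x :: "'a::euclidean_space"
  shows "GDERIV (\<lambda>x. \<Prod>b\<in>Basis. (x \<bullet> b) ^ e b) x :>
    (\<Sum>i\<in>Basis. (real (e i) * (\<Prod>b\<in>Basis. (x \<bullet> b) ^ (e(i := e i - 1)) b)) *\<^sub>R i)"
proof -
  have "((\<lambda>x. \<Prod>b\<in>Basis. (x \<bullet> b) ^ e b) has_derivative
      (\<lambda>y. \<Sum>i\<in>Basis. (of_nat (e i) * (y \<bullet> i) * (x \<bullet> i) ^ (e i - 1)) * (\<Prod>j\<in>Basis - {i}. (x \<bullet> j) ^ e j))) (at x)"
    by (intro has_derivative_prod has_derivative_power has_derivative_inner_left has_derivative_ident)
  also have "(\<lambda>y. \<Sum>i\<in>Basis. (of_nat (e i) * (y \<bullet> i) * (x \<bullet> i) ^ (e i - 1)) * (\<Prod>j\<in>Basis - {i}. (x \<bullet> j) ^ e j)) =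
      (\<lambda>y. y \<bullet> (\<Sum>i\<in>Basis. (real (e i) * (\<Prod>b\<in>Basis. (x \<bullet> b) ^ (e(i := e i - 1)) b)) *\<^sub>R i))"
  proof (rule ext, unfold inner_sum_right, rule sum.cong[OF refl])
    fix y i :: 'a assume i: "i \<in> Basis"
    have "(\<Prod>b\<in>Basis. (x \<bullet> b) ^ (e(i := e i - 1)) b) =
        (x \<bullet> i) ^ (e i - 1) * (\<Prod>b\<in>Basis - {i}. (x \<bullet> b) ^ (e(i := e i - 1)) b)"
      using i by (simp add: prod.remove)
    also have "(\<Prod>b\<in>Basis - {i}. (x \<bullet> b) ^ (e(i := e i - 1)) b) = (\<Prod>b\<in>Basis - {i}. (x \<bullet> b) ^ e b)"
      by (intro prod.cong) auto
    finally show "(of_nat (e i) * (y \<bullet> i) * (x \<bullet> i) ^ (e i - 1)) * (\<Prod>j\<in>Basis - {i}. (x \<bullet> j) ^ e j) =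
        y \<bullet> (real (e i) * (\<Prod>b\<in>Basis. (x \<bullet> b) ^ (e(i := e i - 1)) b)) *\<^sub>R i"
      by simp
  qed
  finally show ?thesis by (simp add: gderiv_def)
qed

lemma GDERIV_sum:
  assumes "\<And>i. i \<in> I \<Longrightarrow> GDERIV (f i) x :> g i"
  shows "GDERIV (\<lambda>x. \<Sum>i\<in>I. f i x) x :> (\<Sum>i\<in>I. g i)"
  using assms by (induction I rule: infinite_finite_induct) (auto intro: GDERIV_const GDERIV_add simp del: gderiv_deriv)

lemma GDERIV_cmult: "GDERIV f x :> g \<Longrightarrow> GDERIV (\<lambda>x. s * f x) x :> s *\<^sub>R g"
  unfolding gderiv_def by (drule has_derivative_mult_right[of _ _ _ s]) (simp add: mult.commute)

lemma is_poly_continuous: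
  assumes "is_poly_of_degree_le k p"
  shows "continuous_on S p"
proof -
  obtain c where "p = (\<lambda>x. \<Sum>e\<in>poly_exponents k. c e * (\<Prod>b\<in>Basis. (x \<bullet> b) ^ e b))"
    using assms by (auto simp: is_poly_of_degree_le_def)
  then show ?thesis by (simp only:) (intro continuous_intros)
qed

text \<open>The degree bound k is kept for the partial derivatives, so that the components of the
  gradient lie in the same DG space and the trace inequality applies to them.\<close>

lemma is_poly_gradient:
  fixes p :: "'a::euclidean_space \<Rightarrow> real"
  assumes "is_poly_of_degree_le k p"
  obtains g where "\<And>x. GDERIV p x :> g x" "continuous_on UNIV g"
    "\<And>b. b \<in> Basis \<Longrightarrow> is_poly_of_degree_le k (\<lambda>x. g x \<bullet> b)"
proof -
  obtain c where p: "p = (\<lambda>x. \<Sum>e\<in>poly_exponents k. c e * (\<Prod>b\<in>Basis. (x \<bullet> b) ^ e b))"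
    using assms by (auto simp: is_poly_of_degree_le_def)
  define g where "g = (\<lambda>x::'a. \<Sum>e\<in>poly_exponents k. c e *\<^sub>R
    (\<Sum>i\<in>Basis. (real (e i) * (\<Prod>b\<in>Basis. (x \<bullet> b) ^ (e(i := e i - 1)) b)) *\<^sub>R i))"
  show ?thesis
  proof (rule that[of g])
    show "GDERIV p x :> g x" for x
      unfolding p g_def by (intro GDERIV_sum GDERIV_cmult monomial_GDERIV)
    show "continuous_on UNIV g" unfolding g_def by (intro continuous_intros)
    fix b :: 'a assume b: "b \<in> Basis"
    have "g x \<bullet> b = (\<Sum>e\<in>poly_exponents k. (c e * real (e b)) * (\<Prod>b'\<in>Basis. (x \<bullet> b') ^ (e(b := e b - 1)) b'))" for x
    proof -
      have "(\<Sum>i\<in>Basis. (real (e i) * (\<Prod>b\<in>Basis. (x \<bullet> b) ^ (e(i := e i - 1)) b)) *\<^sub>R i) \<bullet> b =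
          real (e b) * (\<Prod>b'\<in>Basis. (x \<bullet> b') ^ (e(b := e b - 1)) b')" for e :: "'a \<Rightarrow> nat"
        using b by (rule inner_sum_left_Basis)
      then show ?thesis by (simp add: g_def inner_sum_left mult.assoc del: fun_upd_apply)
    qed
    moreover have "is_poly_of_degree_le k (\<lambda>x::'a. \<Sum>e\<in>poly_exponents k. (c e * real (e b)) * (\<Prod>b'\<in>Basis. (x \<bullet> b') ^ (e(b := e b - 1)) b'))"
    proof (intro is_poly_sum is_poly_scale is_poly_monomial)
      fix e :: "'a \<Rightarrow> nat" assume "e \<in> poly_exponents k"
      then have "sum e Basis \<le> k" by (simp add: poly_exponents_def)
      moreover have "sum (e(b := e b - 1)) Basis \<le> sum e Basis" by (intro sum_mono) auto
      ultimately show "sum (e(b := e b - 1)) Basis \<le> k" by linarith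
    qed
    ultimately show "is_poly_of_degree_le k (\<lambda>x. g x \<bullet> b)" by simp
  qed
qed

lemma grad_eq:
  assumes "GDERIV v x :> g"
  shows "grad v x = g"
  unfolding grad_def
proof (rule the_equality)
  show "GDERIV v x :> g" by fact
  show "g' = g" if "GDERIV v x :> g'" for g'
  proof -
    have "(\<lambda>h. h \<bullet> g') = (\<lambda>h. h \<bullet> g)"
      using that assms has_derivative_unique unfolding gderiv_def by blast
    then show ?thesis by (metis inner_commute vector_eq_rdot)
  qed
qed

lemma GDERIV_transform_open:
  assumes "GDERIV p x :> g" "open T" "x \<in> T" "\<And>z. z \<in> T \<Longrightarrow> p z = v z"
  shows "GDERIV v x :> g"
  using assms unfolding gderiv_def by (rule has_derivative_transform_within_open)

section \<open>Faces of polyhedra\<close>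

lemma flat_face_facts:
  fixes T :: "'a::euclidean_space set"
  assumes F: "F \<in> flat_faces T" and T: "bounded T"
  shows "compact F" "F \<noteq> {}" "F \<subseteq> frontier T" "F \<subseteq> closure T"
    and "\<exists>n c. norm n = 1 \<and> F \<subseteq> {x. n \<bullet> x = c}"
proof -
  obtain C n c where FC: "F = closure C" and n: "n \<noteq> 0"
    and C: "C \<in> components (top_of_set {x. n \<bullet> x = c} interior_of (frontier T \<inter> {x. n \<bullet> x = c}))"
    using F unfolding flat_faces_def by blast
  have sub: "C \<subseteq> frontier T \<inter> {x. n \<bullet> x = c}"
    using order_trans[OF in_components_subset[OF C] interior_of_subset] .
  have cl: "closed (frontier T \<inter> {x. n \<bullet> x = c})"
    by (intro closed_Int closed_hyperplane) auto
  have Fsub: "F \<subseteq> frontier T \<inter> {x. n \<bullet> x = c}"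
    unfolding FC using closure_minimal[OF sub cl] .
  then show "F \<subseteq> frontier T" "F \<subseteq> closure T" by (auto simp: frontier_def)
  show "F \<noteq> {}" using in_components_nonempty[OF C] by (simp add: FC)
  have "bounded F" by (rule bounded_subset[OF bounded_closure[OF T]]) (use Fsub in \<open>auto simp: frontier_def\<close>)
  then show "compact F" by (simp add: FC compact_eq_bounded_closed)
  show "\<exists>n c. norm n = 1 \<and> F \<subseteq> {x. n \<bullet> x = c}"
  proof (intro exI conjI)
    show "norm (n /\<^sub>R norm n) = 1" using n by simp
    show "F \<subseteq> {x. (n /\<^sub>R norm n) \<bullet> x = c / norm n}" using Fsub by (auto simp: divide_inverse_commute)
  qed
qed

lemma flat_face_diameter_le:
  fixes T :: "'a::euclidean_space set"
  assumes "F \<in> flat_faces T" "bounded T"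
  shows "diameter F \<le> diameter T"
  using diameter_subset[OF flat_face_facts(4)[OF assms] bounded_closure[OF assms(2)]]
    diameter_closure[OF assms(2)] by simp

text \<open>The face is the closure of a component of a relatively open subset of the hyperplane.
  Such a component contains a relative ball, and in dimension at least 2 the hyperplane offers a
  direction orthogonal to n in which a second point is found.\<close>

lemma flat_face_diameter_pos:
  fixes T :: "'a::euclidean_space set"
  assumes F: "F \<in> flat_faces T" and T: "bounded T" and dim: "DIM('a) \<noteq> 1"
  shows "diameter F > 0"
proof -
  obtain C n c where FC: "F = closure C" and n: "n \<noteq> 0"
    and C: "C \<in> components (top_of_set {x. n \<bullet> x = c} interior_of (frontier T \<inter> {x. n \<bullet> x = c}))"
    using F unfolding flat_faces_def by blast
  define H where "H = {x. n \<bullet> x = c}"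
  define S where "S = top_of_set H interior_of (frontier T \<inter> H)"
  have C: "C \<in> components S" using C by (simp add: S_def H_def)
  obtain x where x: "x \<in> C" using in_components_nonempty[OF C] by blast
  then have xS: "x \<in> S" using in_components_subset[OF C] by blast
  have "openin (top_of_set H) S" by (simp add: S_def)
  then obtain e where e: "e > 0" "ball x e \<inter> H \<subseteq> S" and xH: "x \<in> H"
    using xS unfolding openin_contains_ball by blast
  have conv: "convex (ball x e \<inter> H)" unfolding H_def by (intro convex_Int convex_ball convex_hyperplane)
  have "ball x e \<inter> H \<subseteq> C"
    by (rule components_maximal[OF C convex_connected[OF conv] e(2)]) (use x xH e(1) in auto)
  moreover obtain m where m: "m \<noteq> 0" "orthogonal n m"
  proof -
    have "DIM('a) \<ge> 2" using dim DIM_positive[where 'a = 'a] by linarith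
    then show ?thesis using that by (metis orthogonal_to_vector_exists)
  qed
  moreover define z where "z = x + (e / 2 / norm m) *\<^sub>R m"
  have "dist x z < e" using m(1) e(1) by (simp add: z_def dist_norm)
  moreover have "z \<in> H" using xH m(2) by (simp add: z_def H_def inner_add_right orthogonal_def)
  ultimately have "z \<in> C" by (auto simp: subset_iff)
  then have "z \<in> F" using closure_subset by (auto simp: FC)
  moreover have "x \<in> F" using x closure_subset by (auto simp: FC)
  moreover have "bounded F" using flat_face_facts(1)[OF F T] compact_imp_bounded by blast
  ultimately have "dist x z \<le> diameter F" by (metis diameter_bounded_bound)
  moreover have "dist x z > 0" using m(1) e(1) by (simp add: z_def)
  ultimately show ?thesis by linarith
qed

text \<open>The unit normal and the offset behind \<open>face_measure\<close> come from a choice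
  operator, and only their defining property is used: the facts hold for any admissible
  choice.\<close>

lemma face_measure_facts:
  fixes F :: "'a::euclidean_space set"
  assumes F: "compact F" and ex: "\<exists>n c. norm n = 1 \<and> F \<subseteq> {x. n \<bullet> x = c}"
  shows "finite_measure (face_measure F)" "space (face_measure F) = F"
    "sets (face_measure F) = sets (restrict_space borel F)"
proof -
  define s where "s = (SOME (n, c). norm n = 1 \<and> F \<subseteq> {x. n \<bullet> x = c})"
  obtain n c where s: "s = (n, c)" by (cases s)
  have "case s of (n, c) \<Rightarrow> norm n = 1 \<and> F \<subseteq> {x. n \<bullet> x = c}"
    unfolding s_def by (rule someI_ex) (use ex in auto)
  then have n: "norm n = 1" and Fn: "F \<subseteq> {x. n \<bullet> x = c}" by (auto simp: s)
  have fm: "face_measure F = restrict_space (hyperplane_measure n c) F"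
    using s by (simp add: face_measure_def s_def)
  have Fb: "F \<in> sets borel" using F by (simp add: compact_imp_closed)
  show sp: "space (face_measure F) = F"
    by (simp add: fm space_restrict_space hyperplane_measure_def)
  have sets: "sets (hyperplane_measure n c) = sets borel" by (simp add: hyperplane_measure_def)
  show "sets (face_measure F) = sets (restrict_space borel F)"
    using sets by (simp add: fm sets_restrict_space)
  define S where "S = {x. c \<le> n \<bullet> x \<and> n \<bullet> x \<le> c + 1}"
  define P where "P = (\<lambda>x. x - (n \<bullet> x - c) *\<^sub>R n)"
  have Sb: "S \<in> sets borel"
  proof -
    have "S = {x. n \<bullet> x \<ge> c} \<inter> {x. n \<bullet> x \<le> c + 1}" by (auto simp: S_def)
    then show ?thesis by (simp add: closed_halfspace_ge closed_halfspace_le borel_closed sets.Int)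
  qed
  have Pm: "P \<in> borel_measurable borel" unfolding P_def
    by (intro borel_measurable_continuous_onI continuous_intros)
  then have Pm': "P \<in> restrict_space lborel S \<rightarrow>\<^sub>M borel"
    by (intro measurable_restrict_space1) simp
  have "emeasure (face_measure F) (space (face_measure F)) = emeasure (hyperplane_measure n c) F"
    unfolding sp unfolding fm using Fb sets by (intro emeasure_restrict_space) auto
  also have "\<dots> = emeasure (restrict_space lborel S) (P -` F \<inter> space (restrict_space lborel S))"
    unfolding hyperplane_measure_def S_def[symmetric] P_def[symmetric]
    by (rule emeasure_distr[OF Pm' Fb])
  also have "\<dots> = emeasure lborel (P -` F \<inter> S)"
    using Sb by (subst emeasure_restrict_space) (auto simp: space_restrict_space)
  \<comment> \<open>The set is the prism of height 1 over F; its points are within distance 1 of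
    F.\<close>
  also have "\<dots> < \<infinity>"
  proof (rule emeasure_bounded_finite)
    obtain B where B: "\<And>x. x \<in> F \<Longrightarrow> norm x \<le> B" 
      using compact_imp_bounded[OF F] by (auto simp: bounded_iff)
    have "norm x \<le> B + 1" if "x \<in> P -` F \<inter> S" for x
    proof -
      have "x = P x + (n \<bullet> x - c) *\<^sub>R n" by (simp add: P_def)
      then have "norm x \<le> norm (P x) + norm ((n \<bullet> x - c) *\<^sub>R n)" by (metis norm_triangle_ineq)
      moreover have "norm (P x) \<le> B" using B that by auto
      moreover have "norm ((n \<bullet> x - c) *\<^sub>R n) \<le> 1" using that n by (simp add: S_def)
      ultimately show ?thesis by linarith
    qed
    then show "bounded (P -` F \<inter> S)" by (auto simp: bounded_iff)
  qed
  finally show "finite_measure (face_measure F)" by (intro finite_measureI) auto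
qed

lemma integrable_face_measure:
  fixes F :: "'a::euclidean_space set" and q :: "'a \<Rightarrow> 'b::euclidean_space"
  assumes F: "F \<in> flat_faces T" "bounded T" and q: "continuous_on F q"
  shows "integrable (face_measure F) q"
proof -
  note facts = flat_face_facts[OF F]
  note fm = face_measure_facts[OF facts(1,5)]
  interpret finite_measure "face_measure F" by (rule fm(1))
  have "bounded (q ` F)" using facts(1) q by (intro compact_imp_bounded compact_continuous_image)
  then obtain M where M: "\<And>x. x \<in> F \<Longrightarrow> norm (q x) \<le> M" by (auto simp: bounded_iff)
  have "q \<in> borel_measurable (restrict_space borel F)"
    using q by (rule borel_measurable_continuous_on_restrict)
  then have "q \<in> borel_measurable (face_measure F)"
    using measurable_cong_sets[OF fm(3) refl] by blast
  then show ?thesis using M fm(2) by (intro integrable_const_bound[where B = M]) (auto intro!: AE_I2)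
qed

section \<open>Affine coefficients\<close>

lemma affine_coeff_upd:
  assumes "summable (\<lambda>j. \<bar>\<psi> j x\<bar>)" "y \<in> param_box" "t \<in> {-1/2..1/2}"
  shows "affine_coeff a0 \<psi> (y(j := t)) x = affine_coeff a0 \<psi> y x + (t - y j) * \<psi> j x"
proof -
  have sm: "summable (\<lambda>i. z i * \<psi> i x)" if "z \<in> param_box" for z
  proof (rule summable_comparison_test'[OF assms(1)])
    fix i show "norm (z i * \<psi> i x) \<le> \<bar>\<psi> i x\<bar>"
      using mult_right_mono[of "\<bar>z i\<bar>" 1 "\<bar>\<psi> i x\<bar>"] param_box_abs_le[OF that, of i]
      by (simp add: abs_mult)
  qed
  have "(\<Sum>i. (y(j := t)) i * \<psi> i x) - (\<Sum>i. y i * \<psi> i x) = (\<Sum>i. (y(j := t)) i * \<psi> i x - y i * \<psi> i x)"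
    by (intro suminf_diff sm param_box_upd assms)
  also have "\<dots> = (\<Sum>i. if i = j then (t - y j) * \<psi> j x else 0)"
    by (intro suminf_cong) (auto simp: algebra_simps)
  also have "\<dots> = (t - y j) * \<psi> j x"
    using suminf_finite[of "{j}" "\<lambda>i. if i = j then (t - y j) * \<psi> j x else 0"] by simp
  finally show ?thesis by (simp add: affine_coeff_def)
qed

text \<open>Weierstrass M-test, with \<bar>y_j\<bar> \<le> 1/2 on the parameter box.\<close>

lemma continuous_on_affine_coeff:
  fixes \<psi> :: "nat \<Rightarrow> 'a::topological_space \<Rightarrow> real"
  assumes a0: "continuous_on S a0" and \<psi>: "\<And>j. continuous_on S (\<psi> j)"
    and le: "\<And>j x. x \<in> S \<Longrightarrow> \<bar>\<psi> j x\<bar> \<le> M j" and M: "summable M" and y: "y \<in> param_box"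
  shows "continuous_on S (affine_coeff a0 \<psi> y)"
proof -
  have "uniform_limit S (\<lambda>n x. \<Sum>i<n. y i * \<psi> i x) (\<lambda>x. \<Sum>i. y i * \<psi> i x) sequentially"
  proof (rule Weierstrass_m_test[OF _ M])
    fix n x assume x: "x \<in> S"
    show "norm (y n * \<psi> n x) \<le> M n"
      using mult_right_mono[of "\<bar>y n\<bar>" 1 "\<bar>\<psi> n x\<bar>"] param_box_abs_le[OF y, of n] le[OF x, of n]
      by (simp add: abs_mult)
  qed
  then have "continuous_on S (\<lambda>x. \<Sum>i. y i * \<psi> i x)"
    by (rule uniform_limit_theorem[rotated]) (auto intro!: always_eventually continuous_intros \<psi>)
  then have "continuous_on S (\<lambda>x. a0 x + (\<Sum>i. y i * \<psi> i x))" by (intro continuous_on_add a0)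
  then show ?thesis by (simp add: affine_coeff_def[abs_def])
qed

section \<open>The DG space on one mesh\<close>

lemma GDERIV_cong_open:
  assumes "open T" "x \<in> T" "\<And>z. z \<in> T \<Longrightarrow> v z = w z"
  shows "GDERIV v x :> g \<longleftrightarrow> GDERIV w x :> g"
  using GDERIV_transform_open[of v x g T w] GDERIV_transform_open[of w x g T v] assms by metis

lemma grad_cong_open:
  assumes "open T" "x \<in> T" "\<And>z. z \<in> T \<Longrightarrow> v z = w z"
  shows "grad v x = grad w x"
proof -
  have "GDERIV v x :> g \<longleftrightarrow> GDERIV w x :> g" for g by (rule GDERIV_cong_open[OF assms])
  then show ?thesis by (simp add: grad_def)
qed

locale dg_mesh =
  fixes D :: "'a::euclidean_space set" and \<T> :: "'a set set" and k :: nat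
  assumes D: "open D" "bounded D" and mesh: "is_mesh D \<T>"
begin

abbreviation V :: "('a \<Rightarrow> real) set" where "V \<equiv> DG_space D \<T> k"

abbreviation faces :: "'a set set" where "faces \<equiv> mesh_faces \<T>"

lemma finite_mesh: "finite \<T>" using mesh by (simp add: is_mesh_def)

lemma element:
  assumes "T \<in> \<T>"
  shows "open T" "bounded T" "T \<subseteq> D" "closure T \<subseteq> closure D" "finite (flat_faces T)" "T \<noteq> {}"
  using assms mesh closure_mono[of T D] by (auto simp: is_mesh_def polyhedral_def)

lemma finite_faces: "finite faces"
  using finite_mesh element(5) by (auto simp: mesh_faces_def)

lemma element_unique: "T \<in> \<T> \<Longrightarrow> S \<in> \<T> \<Longrightarrow> x \<in> T \<Longrightarrow> x \<in> S \<Longrightarrow> S = T"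
  using mesh by (metis is_mesh_def pairwise_def disjnt_iff)

lemma adjacentD:
  assumes "T \<in> adjacent \<T> F"
  shows "T \<in> \<T>" "F \<in> flat_faces T" "F \<subseteq> closure T"
proof -
  show T: "T \<in> \<T>" and F: "F \<in> flat_faces T" using assms by (auto simp: adjacent_def)
  show "F \<subseteq> closure T" using flat_face_facts(4)[OF F element(2)[OF T]] .
qed

lemma finite_adjacent: "finite (adjacent \<T> F)"
  using finite_mesh by (auto simp: adjacent_def)

lemma face_element:
  assumes "F \<in> faces"
  obtains T where "T \<in> \<T>" "F \<in> flat_faces T" "bounded T" "T \<in> adjacent \<T> F" "F \<subseteq> closure D"
proof -
  obtain T where T: "T \<in> \<T>" "F \<in> flat_faces T" using assms by (auto simp: mesh_faces_def)
  then have a: "T \<in> adjacent \<T> F" by (simp add: adjacent_def)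
  show ?thesis using that[OF T element(2)[OF T(1)] a] adjacentD(3)[OF a] element(4)[OF T(1)] by blast
qed

lemma space_face_measure: "F \<in> faces \<Longrightarrow> space (face_measure F) = F"
  using flat_face_facts face_measure_facts(2) by (metis face_element)

lemma integrable_face:
  fixes q :: "'a \<Rightarrow> 'b::euclidean_space"
  assumes "F \<in> faces" "continuous_on F q"
  shows "integrable (face_measure F) q"
  using assms integrable_face_measure by (metis face_element)

lemma DG_spaceD: "v \<in> V \<Longrightarrow> T \<in> \<T> \<Longrightarrow> \<exists>p. is_poly_of_degree_le k p \<and> (\<forall>x\<in>T. v x = p x)"
  by (simp add: DG_space_def)

lemma DG_polynomial:
  assumes "v \<in> V" "T \<in> \<T>"
  obtains p g where "is_poly_of_degree_le k p" "\<And>x. x \<in> T \<Longrightarrow> v x = p x"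
    "\<And>x. x \<in> T \<Longrightarrow> GDERIV v x :> g x" "\<And>x. x \<in> T \<Longrightarrow> grad v x = g x" "continuous_on UNIV g"
    "\<And>b. b \<in> Basis \<Longrightarrow> is_poly_of_degree_le k (\<lambda>x. g x \<bullet> b)"
proof -
  obtain p where p: "is_poly_of_degree_le k p" "\<And>x. x \<in> T \<Longrightarrow> v x = p x"
    using DG_spaceD[OF assms] by auto
  obtain g where g: "\<And>x. GDERIV p x :> g x" "continuous_on UNIV g"
    "\<And>b. b \<in> Basis \<Longrightarrow> is_poly_of_degree_le k (\<lambda>x. g x \<bullet> b)"
    using is_poly_gradient[OF p(1)] by metis
  have d: "GDERIV v x :> g x" if "x \<in> T" for x
    by (rule GDERIV_transform_open[OF g(1) element(1)[OF assms(2)] that]) (simp add: p)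
  show ?thesis by (rule that[OF p d _ g(2,3)]) (use d grad_eq in blast)+
qed

lemma
  assumes "v \<in> V" "T \<in> \<T>"
  shows extends_DG: "extends_to_closure T v"
    and extends_grad: "extends_to_closure T (grad v)"
    and GDERIV_grad: "x \<in> T \<Longrightarrow> GDERIV v x :> grad v x"
proof -
  obtain p g where pg: "is_poly_of_degree_le k p" "\<And>x. x \<in> T \<Longrightarrow> v x = p x"
    "\<And>x. x \<in> T \<Longrightarrow> GDERIV v x :> g x" "\<And>x. x \<in> T \<Longrightarrow> grad v x = g x" "continuous_on UNIV g"
    by (rule DG_polynomial[OF assms]) blast
  show "extends_to_closure T v" using is_poly_continuous[OF pg(1)] pg(2) by (rule extends_to_closureI)
  show "extends_to_closure T (grad v)"
    using continuous_on_subset[OF pg(5) subset_UNIV] pg(4) by (rule extends_to_closureI)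
  show "x \<in> T \<Longrightarrow> GDERIV v x :> grad v x" using pg(3,4) by (simp del: gderiv_deriv)
qed

lemma DG_add_scale:
  assumes "v \<in> V" "w \<in> V"
  shows "(\<lambda>x. v x + s * w x) \<in> V"
proof -
  have "\<exists>p. is_poly_of_degree_le k p \<and> (\<forall>x\<in>T. v x + s * w x = p x)" if T: "T \<in> \<T>" for T
  proof -
    obtain p where p: "is_poly_of_degree_le k p" "\<forall>x\<in>T. v x = p x"
      using DG_spaceD[OF assms(1) T] by auto
    obtain q where q: "is_poly_of_degree_le k q" "\<forall>x\<in>T. w x = q x"
      using DG_spaceD[OF assms(2) T] by auto
    show ?thesis
    proof (intro exI conjI ballI)
      show "is_poly_of_degree_le k (\<lambda>x. p x + s * q x)"
        by (rule is_poly_add[OF p(1) is_poly_scale[OF q(1)]])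
      show "v x + s * w x = p x + s * q x" if "x \<in> T" for x
        using that by (simp only: p(2)[rule_format] q(2)[rule_format])
    qed
  qed
  moreover have "(\<lambda>x. v x + s * w x) \<in> L2_space D"
    using assms L2_space_add[OF _ L2_space_scale] by (auto simp: DG_space_def)
  ultimately show ?thesis by (simp add: DG_space_def)
qed

lemma L2_space_cutoff:
  assumes T: "T \<in> \<T>" and p: "continuous_on UNIV p"
  shows "(\<lambda>x. indicator T x * p x) \<in> L2_space D"
proof -
  interpret finite_measure "lebesgue_on D"
    using D by (intro finite_measure_lebesgue_on lmeasurable_open) auto
  have "(\<lambda>x. indicator T x * p x) \<in> borel_measurable borel"
    using element(1)[OF T] borel_measurable_continuous_onI[OF p]
    by (intro borel_measurable_times borel_measurable_indicator) auto
  then have m: "(\<lambda>x. indicator T x * p x) \<in> borel_measurable (lebesgue_on D)"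
    by (intro measurable_restrict_space1 measurable_completion) simp
  have "bounded (p ` closure T)"
    using element(2)[OF T] p
    by (intro compact_imp_bounded compact_continuous_image) (auto intro: continuous_on_subset)
  then obtain M where M: "\<And>x. x \<in> closure T \<Longrightarrow> norm (p x) \<le> M" by (auto simp: bounded_iff)
  have "norm ((indicator T x * p x)\<^sup>2) \<le> M\<^sup>2" for x
    using M[of x] closure_subset[of T] power_mono[of "\<bar>p x\<bar>" M 2]
    by (cases "x \<in> T") (auto simp: subset_iff)
  then have "integrable (lebesgue_on D) (\<lambda>x. (indicator T x * p x)\<^sup>2)"
    using m by (intro integrable_const_bound[where B = "M\<^sup>2"]) auto
  with m show ?thesis by (simp add: L2_space_def)
qed

lemma zero_L2_space: "(\<lambda>_. 0) \<in> L2_space D"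
  by (simp add: L2_space_def)

text \<open>Since q vanishes off the elements, it equals a finite sum of cut-off polynomials at
  every point; this gives its square integrability over D.\<close>

lemma DG_piecewise:
  assumes p: "\<And>T. T \<in> \<T> \<Longrightarrow> \<exists>p. is_poly_of_degree_le k p \<and> (\<forall>x\<in>T. q x = p x)"
    and out: "\<And>x. x \<notin> \<Union>\<T> \<Longrightarrow> q x = 0"
  shows "q \<in> V"
proof -
  obtain p where p': "\<And>T. T \<in> \<T> \<Longrightarrow> is_poly_of_degree_le k (p T) \<and> (\<forall>x\<in>T. q x = p T x)"
    using p by metis
  have "q x = (\<Sum>T\<in>\<T>. indicator T x * p T x)" for x
  proof (cases "x \<in> \<Union>\<T>")
    case True
    then obtain S where S: "S \<in> \<T>" "x \<in> S" by blast
    have "(\<Sum>T\<in>\<T>. indicator T x * p T x) = (\<Sum>T\<in>\<T>. if T = S then q x else 0)"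
    proof (rule sum.cong)
      fix T assume T: "T \<in> \<T>"
      show "indicator T x * p T x = (if T = S then q x else 0)"
      proof (cases "x \<in> T")
        case True
        then have "T = S" using element_unique[OF S(1) T S(2)] by blast
        with p'[OF T] True show ?thesis by simp
      qed (use S in auto)
    qed simp
    then show ?thesis using S finite_mesh by simp
  next
    case False
    then show ?thesis using out by (auto simp: indicator_def intro!: sum.neutral[symmetric])
  qed
  then have q: "q = (\<lambda>x. \<Sum>T\<in>\<T>. indicator T x * p T x)" by blast
  have "(\<lambda>x. \<Sum>T\<in>\<S>. indicator T x * p T x) \<in> L2_space D" if "finite \<S>" "\<S> \<subseteq> \<T>" for \<S>
    using that
  proof (induction \<S> rule: finite_induct)
    case (insert T \<S>)
    have "(\<lambda>x. indicator T x * p T x) \<in> L2_space D"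
    proof (rule L2_space_cutoff)
      show "T \<in> \<T>" using insert.prems by simp
      then show "continuous_on UNIV (p T)" using p' is_poly_continuous by metis
    qed
    moreover have "(\<lambda>x. \<Sum>T\<in>\<S>. indicator T x * p T x) \<in> L2_space D"
      using insert.IH insert.prems by simp
    ultimately have "(\<lambda>x. indicator T x * p T x + (\<Sum>T\<in>\<S>. indicator T x * p T x)) \<in> L2_space D"
      by (rule L2_space_add)
    then show ?case by (simp only: sum.insert[OF insert.hyps])
  qed (simp add: zero_L2_space)
  from this[OF finite_mesh order_refl] have "q \<in> L2_space D" by (simp only: q[symmetric])
  then show ?thesis using p by (auto simp: DG_space_def)
qed

lemma zero_DG: "(\<lambda>_. 0) \<in> V"
  by (rule DG_piecewise) (auto intro: is_poly_zero)

lemma DG_sum: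
  assumes "finite I" "\<And>i. i \<in> I \<Longrightarrow> \<phi> i \<in> V"
  shows "(\<lambda>x. \<Sum>i\<in>I. c i * \<phi> i x) \<in> V"
  using assms
proof (induction I rule: finite_induct)
  case empty
  then show ?case using zero_DG by simp
next
  case (insert i I)
  then have "(\<lambda>x. (\<Sum>i\<in>I. c i * \<phi> i x) + c i * \<phi> i x) \<in> V" by (intro DG_add_scale) auto
  with insert.hyps show ?case by (simp add: add.commute)
qed

text \<open>Makes the trace inequality, which speaks of scalar DG functions, available for
  gradients.\<close>

lemma grad_component_DG:
  assumes v: "v \<in> V" and b: "b \<in> Basis"
  shows "(\<lambda>x. if x \<in> \<Union>\<T> then grad v x \<bullet> b else 0) \<in> V"
proof (rule DG_piecewise)
  fix T assume T: "T \<in> \<T>"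
  obtain p g where "is_poly_of_degree_le k (\<lambda>x. g x \<bullet> b)" "\<And>x. x \<in> T \<Longrightarrow> grad v x = g x"
    by (rule DG_polynomial[OF v T]) (use b in blast)
  then show "\<exists>p. is_poly_of_degree_le k p \<and> (\<forall>x\<in>T. (if x \<in> \<Union>\<T> then grad v x \<bullet> b else 0) = p x)"
    using T by (intro exI[where x = "\<lambda>x. g x \<bullet> b"]) auto
qed simp

lemma grad_add_scale:
  assumes "v \<in> V" "w \<in> V" "T \<in> \<T>" "x \<in> T"
  shows "grad (\<lambda>x. v x + s * w x) x = grad v x + s *\<^sub>R grad w x"
  by (rule grad_eq[OF GDERIV_add[OF GDERIV_grad[OF assms(1,3,4)]
        GDERIV_cmult[OF GDERIV_grad[OF assms(2,3,4)]]]])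

lemma trace_add_scale:
  assumes v: "v \<in> V" and w: "w \<in> V" and T: "T \<in> \<T>" and x: "x \<in> closure T"
  shows "trace T (\<lambda>x. v x + s * w x) x = trace T v x + s * trace T w x"
  using trace_add[OF element(1)[OF T] extends_DG[OF v T]
      extends_to_closure_scaleR[OF element(1)[OF T] extends_to_closure_const[of T s] extends_DG[OF w T]] x]
    trace_scaleR[OF element(1)[OF T] extends_to_closure_const[of T s] extends_DG[OF w T] x]
    trace_const[OF element(1)[OF T] x, of s]
  by simp

lemma trace_grad_add_scale:
  assumes v: "v \<in> V" and w: "w \<in> V" and T: "T \<in> \<T>" and x: "x \<in> closure T"
  shows "trace T (grad (\<lambda>x. v x + s * w x)) x = trace T (grad v) x + s *\<^sub>R trace T (grad w) x"
proof -
  have "trace T (grad (\<lambda>x. v x + s * w x)) = trace T (\<lambda>x. grad v x + s *\<^sub>R grad w x)"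
    by (rule trace_cong) (rule grad_add_scale[OF v w T])
  then show ?thesis
    using trace_add[OF element(1)[OF T] extends_grad[OF v T]
        extends_to_closure_scaleR[OF element(1)[OF T] extends_to_closure_const[of T s] extends_grad[OF w T]] x]
      trace_scaleR[OF element(1)[OF T] extends_to_closure_const[of T s] extends_grad[OF w T] x]
      trace_const[OF element(1)[OF T] x, of s]
    by simp
qed

section \<open>Averages and jumps on faces\<close>

lemma extends_coefficient: "continuous_on (closure D) g \<Longrightarrow> T \<in> \<T> \<Longrightarrow> extends_to_closure T g"
  using continuous_on_subset element(4) by (blast intro: extends_to_closureI)

text \<open>The coefficient is continuous across the face, so its trace from either side is its own
  value and can be taken out of the average.\<close>

lemma average_coefficient:
  assumes g: "continuous_on (closure D) g" and v: "v \<in> V" and x: "x \<in> F"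
  shows "average \<T> F (\<lambda>z. g z *\<^sub>R grad v z) x = g x *\<^sub>R average \<T> F (grad v) x"
proof -
  have "trace T (\<lambda>z. g z *\<^sub>R grad v z) x = g x *\<^sub>R trace T (grad v) x" if "T \<in> adjacent \<T> F" for T
  proof -
    note T = adjacentD[OF that]
    have xT: "x \<in> closure T" using T(3) x by blast
    have "trace T g x = g x"
      using trace_eq[OF element(1)[OF T(1)] continuous_on_subset[OF g element(4)[OF T(1)]] refl xT] .
    then show ?thesis
      using trace_scaleR[OF element(1)[OF T(1)] extends_coefficient[OF g T(1)] extends_grad[OF v T(1)] xT]
      by simp
  qed
  then show ?thesis by (simp add: average_def scaleR_sum_right mult.commute)
qed

lemma jump_add_scale:
  assumes v: "v \<in> V" and w: "w \<in> V" and x: "x \<in> F"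
  shows "jump \<T> F (\<lambda>x. v x + s * w x) x = jump \<T> F v x + s *\<^sub>R jump \<T> F w x"
proof -
  have "trace T (\<lambda>x. v x + s * w x) x = trace T v x + s * trace T w x" if "T \<in> adjacent \<T> F" for T
    using adjacentD[OF that] x by (intro trace_add_scale v w) auto
  then show ?thesis by (simp add: jump_def scaleR_sum_right sum.distrib scaleR_add_left)
qed

lemma average_add_scale:
  assumes v: "v \<in> V" and w: "w \<in> V" and x: "x \<in> F"
  shows "average \<T> F (grad (\<lambda>x. v x + s * w x)) x = average \<T> F (grad v) x + s *\<^sub>R average \<T> F (grad w) x"
proof -
  have "trace T (grad (\<lambda>x. v x + s * w x)) x = trace T (grad v) x + s *\<^sub>R trace T (grad w) x"
    if "T \<in> adjacent \<T> F" for T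
    using adjacentD[OF that] x by (intro trace_grad_add_scale v w) auto
  then show ?thesis by (simp add: average_def scaleR_sum_right sum.distrib scaleR_add_right mult.commute)
qed

lemma continuous_on_jump: "v \<in> V \<Longrightarrow> continuous_on F (jump \<T> F v)"
  unfolding jump_def using adjacentD
  by (intro continuous_on_sum continuous_on_scaleR continuous_on_const
      continuous_on_subset[OF continuous_on_trace[OF element(1) extends_DG]]) auto

lemma continuous_on_trace_grad: "v \<in> V \<Longrightarrow> T \<in> adjacent \<T> F \<Longrightarrow> continuous_on F (trace T (grad v))"
  using adjacentD
  by (intro continuous_on_subset[OF continuous_on_trace[OF element(1) extends_grad]]) auto

lemma continuous_on_average: "v \<in> V \<Longrightarrow> continuous_on F (average \<T> F (grad v))"
  unfolding average_def
  by (intro continuous_on_sum continuous_on_scaleR continuous_on_const continuous_on_trace_grad)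

lemma integrable_volume:
  assumes "continuous_on (closure D) g" "v \<in> V" "w \<in> V" "T \<in> \<T>"
  shows "integrable (lebesgue_on T) (\<lambda>x. g x * (grad v x \<bullet> grad w x))"
proof -
  have "extends_to_closure T (\<lambda>x. g x *\<^sub>R (grad v x \<bullet> grad w x))"
    by (intro extends_to_closure_scaleR extends_to_closure_inner element(1) extends_coefficient extends_grad assms)
  then show ?thesis
    using integrable_extends_to_closure[OF element(1)[OF assms(4)] element(2)[OF assms(4)]] by simp
qed

definition face_integrand ::
  "real \<Rightarrow> real \<Rightarrow> ('a \<Rightarrow> real) \<Rightarrow> ('a \<Rightarrow> real) \<Rightarrow> ('a \<Rightarrow> real) \<Rightarrow> 'a set \<Rightarrow> 'a \<Rightarrow> real" where
  "face_integrand \<theta> \<eta> g w v F x =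
     \<theta> * (g x * (average \<T> F (grad v) x \<bullet> jump \<T> F w x))
     - g x * (average \<T> F (grad w) x \<bullet> jump \<T> F v x)
     + \<eta> / face_size \<T> F * (jump \<T> F w x \<bullet> jump \<T> F v x)"

lemma DG_form_eq:
  assumes "continuous_on (closure D) g" "w \<in> V" "v \<in> V"
  shows "DG_form \<T> \<theta> \<eta> g w v =
    (\<Sum>T\<in>\<T>. LINT x|lebesgue_on T. g x * (grad w x \<bullet> grad v x)) +
    (\<Sum>F\<in>faces. LINT x|face_measure F. face_integrand \<theta> \<eta> g w v F x)"
  unfolding DG_form_def face_integrand_def
  by (intro arg_cong2[where f = "(+)"] sum.cong Bochner_Integration.integral_cong refl)
     (simp_all add: average_coefficient assms space_face_measure)

lemma continuous_on_coefficient_face: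
  "continuous_on (closure D) g \<Longrightarrow> F \<in> faces \<Longrightarrow> continuous_on F g"
  by (meson continuous_on_subset face_element)

lemma integrable_face_integrand:
  assumes "continuous_on (closure D) g" "w \<in> V" "v \<in> V" "F \<in> faces"
  shows "integrable (face_measure F) (face_integrand \<theta> \<eta> g w v F)"
proof (rule integrable_face[OF assms(4)])
  note cont = continuous_on_coefficient_face[OF assms(1,4)] continuous_on_average[of w F]
    continuous_on_average[of v F] continuous_on_jump[of w F] continuous_on_jump[of v F]
  show "continuous_on F (face_integrand \<theta> \<eta> g w v F)"
    unfolding face_integrand_def[abs_def]
    by (intro continuous_on_add continuous_on_diff continuous_on_mult continuous_on_inner
        continuous_on_const cont assms)
qed

section \<open>Bilinearity of the DG form and its dependence on the coefficient\<close>

lemma DG_form_left: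
  assumes g: "continuous_on (closure D) g" and V: "w1 \<in> V" "w2 \<in> V" "v \<in> V"
  shows "DG_form \<T> \<theta> \<eta> g (\<lambda>x. w1 x + s * w2 x) v = DG_form \<T> \<theta> \<eta> g w1 v + s * DG_form \<T> \<theta> \<eta> g w2 v"
proof -
  have "(LINT x|lebesgue_on T. g x * (grad (\<lambda>x. w1 x + s * w2 x) x \<bullet> grad v x)) =
      (LINT x|lebesgue_on T. g x * (grad w1 x \<bullet> grad v x)) + s * (LINT x|lebesgue_on T. g x * (grad w2 x \<bullet> grad v x))"
    if T: "T \<in> \<T>" for T
  proof -
    have "(LINT x|lebesgue_on T. g x * (grad (\<lambda>x. w1 x + s * w2 x) x \<bullet> grad v x)) =
        (LINT x|lebesgue_on T. g x * (grad w1 x \<bullet> grad v x) + s * (g x * (grad w2 x \<bullet> grad v x)))"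
      by (intro Bochner_Integration.integral_cong refl)
         (simp add: grad_add_scale[OF V(1,2) T] inner_add_left algebra_simps)
    then show ?thesis using integrable_volume[OF g _ _ T] V by simp
  qed
  moreover have "(LINT x|face_measure F. face_integrand \<theta> \<eta> g (\<lambda>x. w1 x + s * w2 x) v F x) =
      (LINT x|face_measure F. face_integrand \<theta> \<eta> g w1 v F x) + s * (LINT x|face_measure F. face_integrand \<theta> \<eta> g w2 v F x)"
    if F: "F \<in> faces" for F
  proof -
    have "(LINT x|face_measure F. face_integrand \<theta> \<eta> g (\<lambda>x. w1 x + s * w2 x) v F x) =
        (LINT x|face_measure F. face_integrand \<theta> \<eta> g w1 v F x + s * face_integrand \<theta> \<eta> g w2 v F x)"
      by (intro Bochner_Integration.integral_cong refl)
         (simp add: space_face_measure[OF F] face_integrand_def jump_add_scale[OF V(1,2)]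
           average_add_scale[OF V(1,2)] inner_add_left inner_add_right algebra_simps add_divide_distrib)
    then show ?thesis using integrable_face_integrand[OF g _ _ F] V by simp
  qed
  ultimately show ?thesis
    by (simp add: DG_form_eq g V DG_add_scale sum.distrib sum_distrib_left distrib_left)
qed

lemma DG_form_right:
  assumes g: "continuous_on (closure D) g" and V: "v1 \<in> V" "v2 \<in> V" "w \<in> V"
  shows "DG_form \<T> \<theta> \<eta> g w (\<lambda>x. v1 x + s * v2 x) = DG_form \<T> \<theta> \<eta> g w v1 + s * DG_form \<T> \<theta> \<eta> g w v2"
proof -
  have "(LINT x|lebesgue_on T. g x * (grad w x \<bullet> grad (\<lambda>x. v1 x + s * v2 x) x)) =
      (LINT x|lebesgue_on T. g x * (grad w x \<bullet> grad v1 x)) + s * (LINT x|lebesgue_on T. g x * (grad w x \<bullet> grad v2 x))"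
    if T: "T \<in> \<T>" for T
  proof -
    have "(LINT x|lebesgue_on T. g x * (grad w x \<bullet> grad (\<lambda>x. v1 x + s * v2 x) x)) =
        (LINT x|lebesgue_on T. g x * (grad w x \<bullet> grad v1 x) + s * (g x * (grad w x \<bullet> grad v2 x)))"
      by (intro Bochner_Integration.integral_cong refl)
         (simp add: grad_add_scale[OF V(1,2) T] inner_add_right algebra_simps)
    then show ?thesis using integrable_volume[OF g _ _ T] V by simp
  qed
  moreover have "(LINT x|face_measure F. face_integrand \<theta> \<eta> g w (\<lambda>x. v1 x + s * v2 x) F x) =
      (LINT x|face_measure F. face_integrand \<theta> \<eta> g w v1 F x) + s * (LINT x|face_measure F. face_integrand \<theta> \<eta> g w v2 F x)"
    if F: "F \<in> faces" for F
  proof -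
    have "(LINT x|face_measure F. face_integrand \<theta> \<eta> g w (\<lambda>x. v1 x + s * v2 x) F x) =
        (LINT x|face_measure F. face_integrand \<theta> \<eta> g w v1 F x + s * face_integrand \<theta> \<eta> g w v2 F x)"
      by (intro Bochner_Integration.integral_cong refl)
         (simp add: space_face_measure[OF F] face_integrand_def jump_add_scale[OF V(1,2)]
           average_add_scale[OF V(1,2)] inner_add_left inner_add_right algebra_simps add_divide_distrib)
    then show ?thesis using integrable_face_integrand[OF g _ _ F] V by simp
  qed
  ultimately show ?thesis
    by (simp add: DG_form_eq g V DG_add_scale sum.distrib sum_distrib_left distrib_left)
qed

text \<open>The penalty term does not contain the coefficient, hence the parameter \<open>\<eta> = 0\<close>.\<close>

lemma DG_form_coefficient:
  assumes g: "continuous_on (closure D) g" and r: "continuous_on (closure D) r" and V: "w \<in> V" "v \<in> V"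
    and a: "\<And>x. x \<in> closure D \<Longrightarrow> a x = g x + s * r x"
  shows "DG_form \<T> \<theta> \<eta> a w v = DG_form \<T> \<theta> \<eta> g w v + s * DG_form \<T> \<theta> 0 r w v"
proof -
  \<comment> \<open>\<open>DG_form_eq\<close> requires a continuous coefficient; for a this follows
    from the representation by g and r on the closure.\<close>
  have a_cont: "continuous_on (closure D) a"
    using continuous_on_add[OF g continuous_on_mult_left[OF r, of s]] a by (simp cong: continuous_on_cong)
  have "(LINT x|lebesgue_on T. a x * (grad w x \<bullet> grad v x)) =
      (LINT x|lebesgue_on T. g x * (grad w x \<bullet> grad v x)) + s * (LINT x|lebesgue_on T. r x * (grad w x \<bullet> grad v x))"
    if T: "T \<in> \<T>" for T
  proof -
    have "(LINT x|lebesgue_on T. a x * (grad w x \<bullet> grad v x)) =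
        (LINT x|lebesgue_on T. g x * (grad w x \<bullet> grad v x) + s * (r x * (grad w x \<bullet> grad v x)))"
      using element(4)[OF T] closure_subset[of T]
      by (intro Bochner_Integration.integral_cong refl) (simp add: a subset_iff algebra_simps)
    then show ?thesis using integrable_volume[OF _ V T] g r by simp
  qed
  moreover have "(LINT x|face_measure F. face_integrand \<theta> \<eta> a w v F x) =
      (LINT x|face_measure F. face_integrand \<theta> \<eta> g w v F x) + s * (LINT x|face_measure F. face_integrand \<theta> 0 r w v F x)"
    if F: "F \<in> faces" for F
  proof -
    have "F \<subseteq> closure D" using F face_element by blast
    then have "(LINT x|face_measure F. face_integrand \<theta> \<eta> a w v F x) =
        (LINT x|face_measure F. face_integrand \<theta> \<eta> g w v F x + s * face_integrand \<theta> 0 r w v F x)"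
      by (intro Bochner_Integration.integral_cong refl)
         (simp add: space_face_measure[OF F] face_integrand_def a subset_iff algebra_simps)
    then show ?thesis using integrable_face_integrand[OF _ V F] g r by simp
  qed
  ultimately show ?thesis
    by (simp add: DG_form_eq a_cont g r V sum.distrib sum_distrib_left distrib_left)
qed

text \<open>Linearity applied to 0 = 0 + 1 * 0.\<close>

lemma DG_form_zero:
  assumes "continuous_on (closure D) g" "v \<in> V"
  shows "DG_form \<T> \<theta> \<eta> g (\<lambda>_. 0) v = 0" "DG_form \<T> \<theta> \<eta> g v (\<lambda>_. 0) = 0"
  using DG_form_left[OF assms(1) zero_DG zero_DG assms(2), of \<theta> \<eta> 1]
    DG_form_right[OF assms(1) zero_DG zero_DG assms(2), of \<theta> \<eta> 1] by simp_all

lemma DG_form_sum_left: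
  assumes g: "continuous_on (closure D) g" and v: "v \<in> V" and "finite I" "\<And>i. i \<in> I \<Longrightarrow> \<phi> i \<in> V"
  shows "DG_form \<T> \<theta> \<eta> g (\<lambda>x. \<Sum>i\<in>I. c i * \<phi> i x) v = (\<Sum>i\<in>I. c i * DG_form \<T> \<theta> \<eta> g (\<phi> i) v)"
  using assms(3,4)
proof (induction I rule: finite_induct)
  case empty
  then show ?case using DG_form_zero(1)[OF g v] by simp
next
  case (insert i I)
  have "DG_form \<T> \<theta> \<eta> g (\<lambda>x. (\<Sum>i\<in>I. c i * \<phi> i x) + c i * \<phi> i x) v =
      DG_form \<T> \<theta> \<eta> g (\<lambda>x. \<Sum>i\<in>I. c i * \<phi> i x) v + c i * DG_form \<T> \<theta> \<eta> g (\<phi> i) v"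
    using insert by (intro DG_form_left g v DG_sum) auto
  with insert show ?case by (simp add: add.commute)
qed

lemma DG_form_sum_right:
  assumes g: "continuous_on (closure D) g" and v: "v \<in> V" and "finite I" "\<And>i. i \<in> I \<Longrightarrow> \<phi> i \<in> V"
  shows "DG_form \<T> \<theta> \<eta> g v (\<lambda>x. \<Sum>i\<in>I. c i * \<phi> i x) = (\<Sum>i\<in>I. c i * DG_form \<T> \<theta> \<eta> g v (\<phi> i))"
  using assms(3,4)
proof (induction I rule: finite_induct)
  case empty
  then show ?case using DG_form_zero(2)[OF g v] by simp
next
  case (insert i I)
  have "DG_form \<T> \<theta> \<eta> g v (\<lambda>x. (\<Sum>i\<in>I. c i * \<phi> i x) + c i * \<phi> i x) =
      DG_form \<T> \<theta> \<eta> g v (\<lambda>x. \<Sum>i\<in>I. c i * \<phi> i x) + c i * DG_form \<T> \<theta> \<eta> g v (\<phi> i)"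
    using insert by (intro DG_form_right g v DG_sum) auto
  with insert show ?case by (simp add: add.commute)
qed

section \<open>Independence of the values outside the mesh elements\<close>

lemma jump_cong:
  assumes "\<And>x. x \<in> \<Union>\<T> \<Longrightarrow> v x = w x"
  shows "jump \<T> F v = jump \<T> F w"
proof -
  have "trace T v = trace T w" if "T \<in> adjacent \<T> F" for T
    using assms adjacentD(1)[OF that] by (intro trace_cong) auto
  then show ?thesis by (auto simp: jump_def fun_eq_iff)
qed

lemma grad_cong: "(\<And>x. x \<in> \<Union>\<T> \<Longrightarrow> v x = w x) \<Longrightarrow> T \<in> \<T> \<Longrightarrow> x \<in> T \<Longrightarrow> grad v x = grad w x"
  using grad_cong_open[of T x v w] element(1) by blast

text \<open>The parametric derivatives of a solution are identified only inside the elements, and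
  this suffices for their norms.\<close>

lemma DG_norm_cong:
  assumes "\<And>x. x \<in> \<Union>\<T> \<Longrightarrow> v x = w x"
  shows "DG_norm \<T> \<eta> a v = DG_norm \<T> \<eta> a w"
proof -
  have "L2_norm_on (lebesgue_on T) (\<lambda>x. sqrt (a x) *\<^sub>R grad v x) =
      L2_norm_on (lebesgue_on T) (\<lambda>x. sqrt (a x) *\<^sub>R grad w x)" if "T \<in> \<T>" for T
    using grad_cong[OF assms that] by (intro L2_norm_on_cong) simp
  moreover have "jump \<T> F v = jump \<T> F w" for F by (rule jump_cong[OF assms])
  ultimately show ?thesis by (simp add: DG_norm_def)
qed

text \<open>Allows a solution to be replaced by its basis expansion, with which it agrees only
  inside the elements.\<close>

lemma DG_form_cong_left:
  assumes V: "v \<in> V" "w \<in> V" "z \<in> V" and g: "continuous_on (closure D) g"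
    and eq: "\<And>x. x \<in> \<Union>\<T> \<Longrightarrow> v x = w x"
  shows "DG_form \<T> \<theta> \<eta> g v z = DG_form \<T> \<theta> \<eta> g w z"
proof -
  have "trace T (grad v) = trace T (grad w)" if "T \<in> \<T>" for T
    using grad_cong[OF eq that] by (intro trace_cong) simp
  then have "average \<T> F (grad v) = average \<T> F (grad w)" for F
    using adjacentD(1) by (auto simp: average_def fun_eq_iff intro!: sum.cong)
  then have "face_integrand \<theta> \<eta> g v z F = face_integrand \<theta> \<eta> g w z F" for F
    using jump_cong[OF eq] by (simp add: face_integrand_def fun_eq_iff)
  moreover have "(LINT x|lebesgue_on T. g x * (grad v x \<bullet> grad z x)) =
      (LINT x|lebesgue_on T. g x * (grad w x \<bullet> grad z x))" if "T \<in> \<T>" for T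
    using grad_cong[OF eq that] by (intro Bochner_Integration.integral_cong) auto
  ultimately show ?thesis by (simp add: DG_form_eq V g)
qed

text \<open>Monomials cut off to single elements span the space, because the elements are disjoint.
  Independence results from thinning out this finite family, so the linear independence of monomials
  on an open set is never proved directly.\<close>

lemma DG_basis:
  obtains J :: "('a set \<times> ('a \<Rightarrow> nat)) set" and \<phi> where "finite J" "\<And>i. i \<in> J \<Longrightarrow> \<phi> i \<in> V"
    "\<And>v. v \<in> V \<Longrightarrow> \<exists>c. \<forall>x\<in>\<Union>\<T>. v x = (\<Sum>i\<in>J. c i * \<phi> i x)"
    "\<And>c. (\<And>x. x \<in> \<Union>\<T> \<Longrightarrow> (\<Sum>i\<in>J. c i * \<phi> i x) = 0) \<Longrightarrow> \<forall>i\<in>J. c i = 0"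
proof -
  define K where "K = \<T> \<times> (poly_exponents k :: ('a \<Rightarrow> nat) set)"
  define \<phi> where "\<phi> = (\<lambda>(T :: 'a set, e) (x :: 'a). if x \<in> T then \<Prod>b\<in>Basis. (x \<bullet> b) ^ e b else (0::real))"
  have K: "finite K" unfolding K_def using finite_mesh poly_exponents_finite by blast
  have \<phi>V: "\<phi> i \<in> V" if iK: "i \<in> K" for i
  proof -
    obtain T e where i: "i = (T, e)" and T: "T \<in> \<T>" and e: "e \<in> poly_exponents k"
      using iK unfolding K_def by blast
    have pe: "is_poly_of_degree_le k (\<lambda>x::'a. \<Prod>b\<in>Basis. (x \<bullet> b) ^ e b)"
      using e by (intro is_poly_monomial) (simp add: poly_exponents_def)
    show ?thesis
    proof (rule DG_piecewise)
      fix S assume S: "S \<in> \<T>"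
      show "\<exists>p. is_poly_of_degree_le k p \<and> (\<forall>x\<in>S. \<phi> i x = p x)"
      proof (cases "S = T")
        case True
        then show ?thesis using pe by (intro exI[where x = "\<lambda>x. \<Prod>b\<in>Basis. (x \<bullet> b) ^ e b"]) (simp add: \<phi>_def i)
      next
        case False
        then have "\<phi> i x = 0" if "x \<in> S" for x
          using element_unique[OF S T that] by (auto simp: \<phi>_def i)
        then show ?thesis using is_poly_zero by blast
      qed
    qed (use T in \<open>auto simp: \<phi>_def i\<close>)
  qed
  have span: "\<exists>c. \<forall>x\<in>\<Union>\<T>. v x = (\<Sum>i\<in>K. c i * \<phi> i x)" if v: "v \<in> V" for v
  proof -
    have "\<forall>T\<in>\<T>. \<exists>c. \<forall>x\<in>T. v x = (\<Sum>e\<in>poly_exponents k. c e * (\<Prod>b\<in>Basis. (x \<bullet> b) ^ e b))"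
      using v by (fastforce simp: DG_space_def is_poly_of_degree_le_def)
    then obtain c where c: "\<And>T x. T \<in> \<T> \<Longrightarrow> x \<in> T \<Longrightarrow>
        v x = (\<Sum>e\<in>poly_exponents k. c T e * (\<Prod>b\<in>Basis. (x \<bullet> b) ^ e b))" by metis
    have "v x = (\<Sum>i\<in>K. case_prod c i * \<phi> i x)" if xT: "x \<in> \<Union>\<T>" for x
    proof -
      obtain S where S: "S \<in> \<T>" "x \<in> S" using xT by blast
      have "(\<Sum>i\<in>K. case_prod c i * \<phi> i x) = (\<Sum>T\<in>\<T>. \<Sum>e\<in>poly_exponents k. c T e * \<phi> (T, e) x)"
        unfolding K_def by (simp add: sum.cartesian_product split_def)
      also have "\<dots> = (\<Sum>T\<in>\<T>. if T = S then v x else 0)"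
      proof (rule sum.cong)
        fix T assume T: "T \<in> \<T>"
        show "(\<Sum>e\<in>poly_exponents k. c T e * \<phi> (T, e) x) = (if T = S then v x else 0)"
        proof (cases "T = S")
          case True
          with S(2) c[OF S] show ?thesis by (simp add: \<phi>_def)
        next
          case False
          then have "x \<notin> T" using element_unique[OF S(1) T S(2)] by blast
          with False show ?thesis by (simp add: \<phi>_def)
        qed
      qed simp
      finally show ?thesis using S finite_mesh by simp
    qed
    then show ?thesis by blast
  qed
  obtain J where J: "J \<subseteq> K" "\<And>c. \<exists>c'. \<forall>x\<in>\<Union>\<T>. (\<Sum>i\<in>K. c i * \<phi> i x) = (\<Sum>i\<in>J. c' i * \<phi> i x)"
    "\<And>c. \<forall>x\<in>\<Union>\<T>. (\<Sum>i\<in>J. c i * \<phi> i x) = 0 \<Longrightarrow> \<forall>i\<in>J. c i = 0"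
    using finite_family_has_basis[OF K, of "\<Union>\<T>" \<phi>] by blast
  show ?thesis
  proof (rule that[of J \<phi>])
    show "finite J" using J(1) K finite_subset by blast
    show "\<phi> i \<in> V" if "i \<in> J" for i using that J(1) \<phi>V by blast
    show "\<exists>c. \<forall>x\<in>\<Union>\<T>. v x = (\<Sum>i\<in>J. c i * \<phi> i x)" if v: "v \<in> V" for v
    proof -
      obtain c where c: "\<forall>x\<in>\<Union>\<T>. v x = (\<Sum>i\<in>K. c i * \<phi> i x)" using span[OF v] by blast
      obtain c' where "\<forall>x\<in>\<Union>\<T>. (\<Sum>i\<in>K. c i * \<phi> i x) = (\<Sum>i\<in>J. c' i * \<phi> i x)" using J(2) by blast
      with c show ?thesis by (intro exI[of _ c']) simp
    qed
    show "\<forall>i\<in>J. c i = 0" if "\<And>x. x \<in> \<Union>\<T> \<Longrightarrow> (\<Sum>i\<in>J. c i * \<phi> i x) = 0" for c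
      using J(3) that by blast
  qed
qed

end

section \<open>Boundedness and coercivity of the DG form\<close>

lemma norm_sum_squared_le:
  assumes "finite I"
  shows "(norm (\<Sum>i\<in>I. f i))\<^sup>2 \<le> real (card I) * (\<Sum>i\<in>I. (norm (f i))\<^sup>2)"
proof -
  have "(norm (\<Sum>i\<in>I. f i))\<^sup>2 \<le> (\<Sum>i\<in>I. norm (f i))\<^sup>2"
    by (intro power_mono norm_sum) auto
  also have "\<dots> \<le> (\<Sum>i\<in>I. (norm (f i))\<^sup>2) * card I" by (rule sum_squared_le_sum_of_squares)
  finally show ?thesis by (simp add: mult.commute)
qed

text \<open>The trace constant and the face number enter as numbers that are valid on this one mesh.
  Constants built from these numbers alone are therefore the same for every mesh of the
  sequence.\<close>

locale dg_form = dg_mesh D \<T> k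
  for D :: "'a::euclidean_space set" and \<T> k +
  fixes C_tr \<eta> a_min a_max :: real and N :: nat
  assumes C_tr: "\<And>v T F. \<lbrakk>v \<in> DG_space D \<T> k; T \<in> \<T>; F \<in> flat_faces T\<rbrakk> \<Longrightarrow>
      sqrt (diameter T) * L2_norm_on (face_measure F) (trace T v) \<le> C_tr * L2_norm_on (lebesgue_on T) v"
    and N: "\<And>T. T \<in> \<T> \<Longrightarrow> card (flat_faces T) \<le> N"
    and \<eta>: "\<eta> > 0" and a_min: "a_min > 0" and a_max: "a_max > 0"
begin

text \<open>The constant K of the consistency terms: \<open>a_max\<close> bounds the coefficient on
  faces, \<open>C_tr\<close> comes from the trace inequality, \<open>sqrt N\<close> from counting
  each element once per face. Dividing by \<open>sqrt a_min\<close> passes from gradients to the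
  energy, dividing by \<open>sqrt \<eta>\<close> from jumps to the penalty. The absolute value is
  taken because the sign of \<open>C_tr\<close> is not prescribed.\<close>

definition face_const :: real where
  "face_const = a_max * \<bar>C_tr\<bar> * sqrt (real N) / sqrt (a_min * \<eta>)"

lemma face_const_nonneg: "face_const \<ge> 0"
  using a_max a_min \<eta> by (simp add: face_const_def)

lemma diameter_element_pos: "T \<in> \<T> \<Longrightarrow> diameter T > 0"
proof -
  assume T: "T \<in> \<T>"
  obtain x where x: "x \<in> T" using element(6)[OF T] by blast
  then have "x islimpt T" by (rule open_imp_islimpt[OF element(1)[OF T]])
  then obtain y where "y \<in> T" "y \<noteq> x" by (metis UNIV_I islimpt_def open_UNIV)
  then have "0 < dist x y" by simp
  also have "dist x y \<le> diameter T" using diameter_bounded_bound[OF element(2)[OF T] x \<open>y \<in> T\<close>] .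
  finally show ?thesis .
qed

lemma face_size_pos:
  assumes "F \<in> faces"
  shows "face_size \<T> F > 0"
proof -
  obtain T where T: "T \<in> \<T>" "F \<in> flat_faces T" "bounded T" "T \<in> adjacent \<T> F"
    using face_element[OF assms] by metis
  show ?thesis
  proof (cases "DIM('a) = 1")
    case True
    have "Min (diameter ` adjacent \<T> F) \<in> diameter ` adjacent \<T> F"
      using T(4) finite_adjacent by (intro Min_in) auto
    then show ?thesis using True adjacentD(1) diameter_element_pos by (auto simp: face_size_def)
  next
    case False
    then show ?thesis using flat_face_diameter_pos[OF T(2,3)] by (simp add: face_size_def)
  qed
qed

text \<open>Lets the weight diam T of the trace inequality be replaced by the weight h_F of the
  penalty.\<close>

lemma face_size_le_diameter:
  assumes "T \<in> adjacent \<T> F"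
  shows "face_size \<T> F \<le> diameter T"
  using flat_face_diameter_le[OF adjacentD(2)[OF assms] element(2)[OF adjacentD(1)[OF assms]]]
    assms finite_adjacent by (simp add: face_size_def)

section \<open>Face averages of gradients controlled by element gradients\<close>

definition grad_norm :: "('a \<Rightarrow> real) \<Rightarrow> 'a set \<Rightarrow> real" where
  "grad_norm v T = L2_norm_on (lebesgue_on T) (grad v)"

lemma integrable_grad_squared: "v \<in> V \<Longrightarrow> T \<in> \<T> \<Longrightarrow> integrable (lebesgue_on T) (\<lambda>x. (norm (grad v x))\<^sup>2)"
  using integrable_volume[of "\<lambda>_. 1" v v T] by (simp add: power2_norm_eq_inner)

lemma integrable_face_norm_squared:
  fixes q :: "'a \<Rightarrow> 'a"
  shows "F \<in> faces \<Longrightarrow> continuous_on F q \<Longrightarrow> integrable (face_measure F) (\<lambda>x. (norm (q x))\<^sup>2)"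
  by (intro integrable_face continuous_on_power continuous_on_norm)

text \<open>The trace inequality is applied to every component of the gradient.\<close>

lemma trace_grad_bound:
  assumes v: "v \<in> V" and T: "T \<in> adjacent \<T> F"
  shows "face_size \<T> F * (L2_norm_on (face_measure F) (trace T (grad v)))\<^sup>2 \<le> C_tr\<^sup>2 * (grad_norm v T)\<^sup>2"
proof -
  note T' = adjacentD[OF T]
  have F: "F \<in> faces" using T' by (auto simp: mesh_faces_def)
  define w where "w = (\<lambda>b x. if x \<in> \<Union>\<T> then grad v x \<bullet> b else 0)"
  have w: "w b \<in> V" if "b \<in> Basis" for b unfolding w_def by (rule grad_component_DG[OF v that])
  have tr: "trace T (w b) x = trace T (grad v) x \<bullet> b" if x: "x \<in> F" for b x
  proof -
    have "trace T (w b) = trace T (\<lambda>x. grad v x \<bullet> b)"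
      using T'(1) by (intro trace_cong) (auto simp: w_def)
    moreover have xT: "x \<in> closure T" using x T'(3) by blast
    ultimately show ?thesis
      using trace_inner[OF element(1)[OF T'(1)] extends_grad[OF v T'(1)] extends_to_closure_const[of T b] xT]
        trace_const[OF element(1)[OF T'(1)] xT, of b] by simp
  qed
  have sq: "(norm z)\<^sup>2 = (\<Sum>b\<in>Basis. (z \<bullet> b)\<^sup>2)" for z :: 'a
    unfolding power2_norm_eq_inner by (subst euclidean_inner) (simp add: power2_eq_square)
  have "(L2_norm_on (face_measure F) (trace T (grad v)))\<^sup>2 = (LINT x|face_measure F. (\<Sum>b\<in>Basis. (trace T (w b) x)\<^sup>2))"
    unfolding L2_norm_on_squared
    by (intro Bochner_Integration.integral_cong refl) (simp add: space_face_measure[OF F] sq tr)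
  also have "\<dots> = (\<Sum>b\<in>Basis. LINT x|face_measure F. (trace T (w b) x)\<^sup>2)"
  proof (rule Bochner_Integration.integral_sum)
    fix b :: 'a assume b: "b \<in> Basis"
    show "integrable (face_measure F) (\<lambda>x. (trace T (w b) x)\<^sup>2)"
      by (intro integrable_face[OF F] continuous_on_power
          continuous_on_subset[OF continuous_on_trace[OF element(1) extends_DG[OF w[OF b]]]] T')
  qed
  finally have face: "(L2_norm_on (face_measure F) (trace T (grad v)))\<^sup>2 =
      (\<Sum>b\<in>Basis. (L2_norm_on (face_measure F) (trace T (w b)))\<^sup>2)"
    by (simp add: L2_norm_on_squared)
  have "(grad_norm v T)\<^sup>2 = (LINT x|lebesgue_on T. (\<Sum>b\<in>Basis. (w b x)\<^sup>2))"
    unfolding grad_norm_def L2_norm_on_squared using T'(1)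
    by (intro Bochner_Integration.integral_cong refl) (auto simp: sq w_def intro!: sum.cong)
  also have "\<dots> = (\<Sum>b\<in>Basis. LINT x|lebesgue_on T. (w b x)\<^sup>2)"
  proof (rule Bochner_Integration.integral_sum)
    fix b :: 'a assume b: "b \<in> Basis"
    have "integrable (lebesgue_on T) (\<lambda>x. w b x \<bullet> w b x)"
      by (intro integrable_extends_to_closure[OF element(1) element(2)] extends_to_closure_inner
          element(1) extends_DG w b T')
    then show "integrable (lebesgue_on T) (\<lambda>x. (w b x)\<^sup>2)" by (simp add: power2_eq_square)
  qed
  finally have vol: "(grad_norm v T)\<^sup>2 = (\<Sum>b\<in>Basis. (L2_norm_on (lebesgue_on T) (w b))\<^sup>2)"
    by (simp add: L2_norm_on_squared)
  have comp: "face_size \<T> F * (L2_norm_on (face_measure F) (trace T (w b)))\<^sup>2 \<le> C_tr\<^sup>2 * (L2_norm_on (lebesgue_on T) (w b))\<^sup>2"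
    if b: "b \<in> Basis" for b
  proof -
    have d: "diameter T > 0" using diameter_element_pos T'(1) .
    have "face_size \<T> F * (L2_norm_on (face_measure F) (trace T (w b)))\<^sup>2 \<le>
        diameter T * (L2_norm_on (face_measure F) (trace T (w b)))\<^sup>2"
      by (intro mult_right_mono face_size_le_diameter T) auto
    also have "\<dots> = (sqrt (diameter T) * L2_norm_on (face_measure F) (trace T (w b)))\<^sup>2"
      using d by (simp add: power_mult_distrib)
    also have "\<dots> \<le> (C_tr * L2_norm_on (lebesgue_on T) (w b))\<^sup>2"
      by (intro power_mono C_tr w b T') (use d in auto)
    finally show ?thesis by (simp add: power_mult_distrib)
  qed
  show ?thesis unfolding face vol sum_distrib_left by (intro sum_mono comp)
qed

text \<open>With m adjacent elements, the square of the average carries 1 / m^2 and the square of a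
  sum of m terms costs a factor m. The remaining 1 / m is bounded by 1, so interior and boundary
  faces need no distinction.\<close>

lemma average_bound:
  assumes v: "v \<in> V" and F: "F \<in> faces"
  shows "face_size \<T> F * (L2_norm_on (face_measure F) (average \<T> F (grad v)))\<^sup>2
    \<le> C_tr\<^sup>2 * (\<Sum>T\<in>adjacent \<T> F. (grad_norm v T)\<^sup>2)"
proof -
  let ?m = "real (card (adjacent \<T> F))"
  have m: "?m \<ge> 1"
    using face_element[OF F] finite_adjacent by (metis One_nat_def Suc_leI card_gt_0_iff empty_iff of_nat_1 of_nat_mono)
  have pt: "(norm (average \<T> F (grad v) x))\<^sup>2 \<le> (\<Sum>T\<in>adjacent \<T> F. (norm (trace T (grad v) x))\<^sup>2)" for x
  proof -
    have "(norm (average \<T> F (grad v) x))\<^sup>2 = (norm (\<Sum>T\<in>adjacent \<T> F. trace T (grad v) x))\<^sup>2 / ?m\<^sup>2"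
      by (simp add: average_def power_divide)
    also have "\<dots> \<le> (?m * (\<Sum>T\<in>adjacent \<T> F. (norm (trace T (grad v) x))\<^sup>2)) / ?m\<^sup>2"
      by (intro divide_right_mono norm_sum_squared_le finite_adjacent) auto
    also have "\<dots> = (\<Sum>T\<in>adjacent \<T> F. (norm (trace T (grad v) x))\<^sup>2) / ?m"
      using m by (simp add: power2_eq_square)
    also have "\<dots> \<le> (\<Sum>T\<in>adjacent \<T> F. (norm (trace T (grad v) x))\<^sup>2) / 1"
      using m by (intro divide_left_mono sum_nonneg) auto
    finally show ?thesis by simp
  qed
  have int: "integrable (face_measure F) (\<lambda>x. (norm (trace T (grad v) x))\<^sup>2)" if "T \<in> adjacent \<T> F" for T
    by (intro integrable_face_norm_squared F continuous_on_trace_grad v that)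
  have "(L2_norm_on (face_measure F) (average \<T> F (grad v)))\<^sup>2 \<le>
      (LINT x|face_measure F. (\<Sum>T\<in>adjacent \<T> F. (norm (trace T (grad v) x))\<^sup>2))"
    unfolding L2_norm_on_squared
    by (intro integral_mono pt integrable_face_norm_squared F continuous_on_average v
        Bochner_Integration.integrable_sum int)
  also have "\<dots> = (\<Sum>T\<in>adjacent \<T> F. (L2_norm_on (face_measure F) (trace T (grad v)))\<^sup>2)"
    unfolding L2_norm_on_squared by (intro Bochner_Integration.integral_sum int)
  finally have "face_size \<T> F * (L2_norm_on (face_measure F) (average \<T> F (grad v)))\<^sup>2 \<le>
      face_size \<T> F * (\<Sum>T\<in>adjacent \<T> F. (L2_norm_on (face_measure F) (trace T (grad v)))\<^sup>2)"
    using face_size_pos[OF F] by (intro mult_left_mono) auto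
  also have "\<dots> \<le> (\<Sum>T\<in>adjacent \<T> F. C_tr\<^sup>2 * (grad_norm v T)\<^sup>2)"
    unfolding sum_distrib_left by (intro sum_mono trace_grad_bound v)
  finally show ?thesis by (simp add: sum_distrib_left)
qed

text \<open>Double counting: after exchanging the sums over faces and adjacent elements, each
  element occurs once for each of its faces, that is, at most N times.\<close>

lemma sum_average_bound:
  assumes v: "v \<in> V"
  shows "(\<Sum>F\<in>faces. face_size \<T> F * (L2_norm_on (face_measure F) (average \<T> F (grad v)))\<^sup>2)
    \<le> C_tr\<^sup>2 * real N * (\<Sum>T\<in>\<T>. (grad_norm v T)\<^sup>2)"
proof -
  have "(\<Sum>F\<in>faces. face_size \<T> F * (L2_norm_on (face_measure F) (average \<T> F (grad v)))\<^sup>2)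
      \<le> (\<Sum>F\<in>faces. C_tr\<^sup>2 * (\<Sum>T\<in>adjacent \<T> F. (grad_norm v T)\<^sup>2))"
    by (intro sum_mono average_bound v)
  also have "\<dots> = C_tr\<^sup>2 * (\<Sum>F\<in>faces. \<Sum>T | T \<in> \<T> \<and> F \<in> flat_faces T. (grad_norm v T)\<^sup>2)"
    by (simp add: sum_distrib_left adjacent_def)
  also have "(\<Sum>F\<in>faces. \<Sum>T | T \<in> \<T> \<and> F \<in> flat_faces T. (grad_norm v T)\<^sup>2) =
      (\<Sum>T\<in>\<T>. \<Sum>F | F \<in> faces \<and> F \<in> flat_faces T. (grad_norm v T)\<^sup>2)"
    by (rule sum.swap_restrict[OF finite_faces finite_mesh])
  also have "\<dots> = (\<Sum>T\<in>\<T>. real (card (flat_faces T)) * (grad_norm v T)\<^sup>2)"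
  proof (rule sum.cong)
    fix T assume "T \<in> \<T>"
    then have "{F. F \<in> faces \<and> F \<in> flat_faces T} = flat_faces T" by (auto simp: mesh_faces_def)
    then show "(\<Sum>F | F \<in> faces \<and> F \<in> flat_faces T. (grad_norm v T)\<^sup>2) = real (card (flat_faces T)) * (grad_norm v T)\<^sup>2"
      by simp
  qed simp
  also have "\<dots> \<le> (\<Sum>T\<in>\<T>. real N * (grad_norm v T)\<^sup>2)"
    using N by (intro sum_mono mult_right_mono) auto
  finally show ?thesis by (simp add: sum_distrib_left mult.assoc mult_left_mono)
qed

end

section \<open>The energy norm for a fixed coefficient\<close>

locale dg_coefficient = dg_form D \<T> k C_tr \<eta> a_min a_max N
  for D :: "'a::euclidean_space set" and \<T> k C_tr \<eta> a_min a_max N +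
  fixes a :: "'a \<Rightarrow> real"
  assumes a_cont: "continuous_on (closure D) a"
    and a_bounds: "\<And>x. x \<in> closure D \<Longrightarrow> a_min \<le> a x \<and> a x \<le> a_max"
begin

definition energy :: "('a \<Rightarrow> real) \<Rightarrow> 'a set \<Rightarrow> real" where
  "energy v T = L2_norm_on (lebesgue_on T) (\<lambda>x. sqrt (a x) *\<^sub>R grad v x)"

text \<open>The two parts of the energy norm are kept apart because a consistency term couples the
  gradients of one argument with the jumps of the other. Writing both as \<open>L2_set\<close> makes
  the discrete Cauchy-Schwarz inequality applicable.\<close>

definition energy_part :: "('a \<Rightarrow> real) \<Rightarrow> real" where
  "energy_part v = L2_set (energy v) \<T>"

definition jump_norm :: "('a \<Rightarrow> real) \<Rightarrow> 'a set \<Rightarrow> real" where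
  "jump_norm v F = L2_norm_on (face_measure F) (jump \<T> F v)"

definition jump_part :: "('a \<Rightarrow> real) \<Rightarrow> real" where
  "jump_part v = L2_set (\<lambda>F. sqrt (\<eta> / face_size \<T> F) * jump_norm v F) faces"

lemma a_pos: "x \<in> closure D \<Longrightarrow> a x > 0"
  using a_bounds[of x] a_min by linarith

lemma a_pos_element: "T \<in> \<T> \<Longrightarrow> x \<in> T \<Longrightarrow> a x > 0"
  using a_pos element(3) closure_subset by blast

lemma parts_nonneg [simp]: "energy_part v \<ge> 0" "jump_part v \<ge> 0"
  by (simp_all add: energy_part_def jump_part_def)

lemma energy_part_squared: "(energy_part v)\<^sup>2 = (\<Sum>T\<in>\<T>. (energy v T)\<^sup>2)"
  by (simp add: energy_part_def L2_set_def sum_nonneg)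

lemma jump_part_squared: "(jump_part v)\<^sup>2 = (\<Sum>F\<in>faces. \<eta> / face_size \<T> F * (jump_norm v F)\<^sup>2)"
proof -
  have "(jump_part v)\<^sup>2 = (\<Sum>F\<in>faces. (sqrt (\<eta> / face_size \<T> F) * jump_norm v F)\<^sup>2)"
    by (simp add: jump_part_def L2_set_def sum_nonneg)
  also have "\<dots> = (\<Sum>F\<in>faces. \<eta> / face_size \<T> F * (jump_norm v F)\<^sup>2)"
  proof (rule sum.cong)
    fix F assume "F \<in> faces"
    then have "\<eta> / face_size \<T> F \<ge> 0" using \<eta> face_size_pos[of F] by simp
    then show "(sqrt (\<eta> / face_size \<T> F) * jump_norm v F)\<^sup>2 = \<eta> / face_size \<T> F * (jump_norm v F)\<^sup>2"
      by (simp only: power_mult_distrib real_sqrt_pow2)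
  qed simp
  finally show ?thesis .
qed

lemma DG_norm_squared: "(DG_norm \<T> \<eta> a v)\<^sup>2 = (energy_part v)\<^sup>2 + (jump_part v)\<^sup>2"
proof -
  have "DG_norm \<T> \<eta> a v = sqrt ((energy_part v)\<^sup>2 + (jump_part v)\<^sup>2)"
    by (simp add: DG_norm_def energy_part_squared jump_part_squared energy_def jump_norm_def)
  then show ?thesis by simp
qed

lemma DG_norm_nonneg: "DG_norm \<T> \<eta> a v \<ge> 0"
proof -
  have "(\<Sum>F\<in>faces. \<eta> / face_size \<T> F * (L2_norm_on (face_measure F) (jump \<T> F v))\<^sup>2) \<ge> 0"
    using \<eta> face_size_pos by (intro sum_nonneg mult_nonneg_nonneg) (auto intro: less_imp_le)
  then show ?thesis by (simp add: DG_norm_def sum_nonneg)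
qed

lemma part_le_norm: "energy_part v \<le> DG_norm \<T> \<eta> a v" "jump_part v \<le> DG_norm \<T> \<eta> a v"
  by (rule power2_le_imp_le[OF _ DG_norm_nonneg], simp add: DG_norm_squared)+

lemma energy_squared:
  assumes "v \<in> V" "T \<in> \<T>"
  shows "(energy v T)\<^sup>2 = (LINT x|lebesgue_on T. a x * (grad v x \<bullet> grad v x))"
  unfolding energy_def L2_norm_on_squared
  by (intro Bochner_Integration.integral_cong refl)
     (use a_pos_element[OF assms(2)] in \<open>auto simp: power_mult_distrib power2_norm_eq_inner less_imp_le\<close>)

lemma integrable_energy:
  assumes "v \<in> V" "T \<in> \<T>"
  shows "integrable (lebesgue_on T) (\<lambda>x. (norm (sqrt (a x) *\<^sub>R grad v x))\<^sup>2)"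
proof -
  have "integrable (lebesgue_on T) (\<lambda>x. a x * (grad v x \<bullet> grad v x))"
    by (intro integrable_volume a_cont assms)
  then show ?thesis
    by (rule Bochner_Integration.integrable_cong[THEN iffD1, rotated 2])
       (use a_pos_element[OF assms(2)] in \<open>auto simp: power_mult_distrib power2_norm_eq_inner less_imp_le\<close>)
qed

lemma grad_norm_le_energy:
  assumes "v \<in> V" "T \<in> \<T>"
  shows "a_min * (grad_norm v T)\<^sup>2 \<le> (energy v T)\<^sup>2"
proof -
  have "a_min * (grad_norm v T)\<^sup>2 = (LINT x|lebesgue_on T. a_min * (norm (grad v x))\<^sup>2)"
    by (simp add: grad_norm_def L2_norm_on_squared)
  also have "\<dots> \<le> (LINT x|lebesgue_on T. a x * (grad v x \<bullet> grad v x))"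
  proof (rule integral_mono)
    fix x assume "x \<in> space (lebesgue_on T)"
    then have "x \<in> closure D" using element(3)[OF assms(2)] closure_subset by auto
    then show "a_min * (norm (grad v x))\<^sup>2 \<le> a x * (grad v x \<bullet> grad v x)"
      using a_bounds by (simp add: power2_norm_eq_inner mult_right_mono)
  qed (use integrable_grad_squared integrable_volume a_cont assms in auto)
  finally show ?thesis by (simp add: energy_squared assms)
qed

text \<open>The weight a is split evenly over the two gradients; Cauchy-Schwarz is then used on each
  element and once more over the elements.\<close>

lemma volume_bound:
  assumes g: "continuous_on (closure D) g" and q: "q \<ge> 0" "\<And>x. x \<in> closure D \<Longrightarrow> \<bar>g x\<bar> \<le> q * a x"
    and V: "w \<in> V" "v \<in> V"
  shows "\<bar>\<Sum>T\<in>\<T>. LINT x|lebesgue_on T. g x * (grad w x \<bullet> grad v x)\<bar> \<le> q * (energy_part w * energy_part v)"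
proof -
  have "\<bar>\<Sum>T\<in>\<T>. LINT x|lebesgue_on T. g x * (grad w x \<bullet> grad v x)\<bar> \<le>
      (\<Sum>T\<in>\<T>. \<bar>LINT x|lebesgue_on T. g x * (grad w x \<bullet> grad v x)\<bar>)" by (rule sum_abs)
  also have "\<dots> \<le> (\<Sum>T\<in>\<T>. q * (\<bar>energy w T\<bar> * \<bar>energy v T\<bar>))"
  proof (rule sum_mono)
    fix T assume T: "T \<in> \<T>"
    have "\<bar>LINT x|lebesgue_on T. g x * (grad w x \<bullet> grad v x)\<bar> \<le> q * (energy w T * energy v T)"
      unfolding energy_def
    proof (rule abs_integral_le_L2_norms[OF _ integrable_energy integrable_energy])
      show "integrable (lebesgue_on T) (\<lambda>x. g x * (grad w x \<bullet> grad v x))"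
        by (intro integrable_volume g V T)
      fix x assume "x \<in> space (lebesgue_on T)"
      then have x: "x \<in> closure D" using element(3)[OF T] closure_subset by auto
      have "\<bar>g x * (grad w x \<bullet> grad v x)\<bar> \<le> (q * a x) * (norm (grad w x) * norm (grad v x))"
        unfolding abs_mult using q x a_pos[OF x] Cauchy_Schwarz_ineq2 by (intro mult_mono) auto
      also have "\<dots> = q * (norm (sqrt (a x) *\<^sub>R grad w x) * norm (sqrt (a x) *\<^sub>R grad v x))"
        using a_pos[OF x] by simp
      finally show "\<bar>g x * (grad w x \<bullet> grad v x)\<bar> \<le>
        q * (norm (sqrt (a x) *\<^sub>R grad w x) * norm (sqrt (a x) *\<^sub>R grad v x))" .
    qed (use V T q in auto)
    then show "\<bar>LINT x|lebesgue_on T. g x * (grad w x \<bullet> grad v x)\<bar> \<le> q * (\<bar>energy w T\<bar> * \<bar>energy v T\<bar>)"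
      by (simp add: energy_def)
  qed
  also have "\<dots> = q * (\<Sum>T\<in>\<T>. \<bar>energy w T\<bar> * \<bar>energy v T\<bar>)" by (simp add: sum_distrib_left)
  also have "\<dots> \<le> q * (energy_part w * energy_part v)"
    unfolding energy_part_def using q(1) by (intro mult_left_mono L2_set_mult_ineq)
  finally show ?thesis .
qed

definition consistency :: "('a \<Rightarrow> real) \<Rightarrow> ('a \<Rightarrow> real) \<Rightarrow> ('a \<Rightarrow> real) \<Rightarrow> real" where
  "consistency g w v = (\<Sum>F\<in>faces. LINT x|face_measure F. g x * (average \<T> F (grad w) x \<bullet> jump \<T> F v x))"

text \<open>Cauchy-Schwarz on each face and then over the faces, where sqrt h_F goes to the average
  and its inverse to the jump; the averages are then absorbed by the trace inequality. The bound on
  g is relative to a, so that the lemma serves both g = a with q = 1 and g = \<psi>_j with q the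
  norm of \<psi>_j / a.\<close>

lemma consistency_bound:
  assumes g: "continuous_on (closure D) g" and q: "q \<ge> 0" "\<And>x. x \<in> closure D \<Longrightarrow> \<bar>g x\<bar> \<le> q * a x"
    and V: "w \<in> V" "v \<in> V"
  shows "\<bar>consistency g w v\<bar> \<le> q * (face_const * (energy_part w * jump_part v))"
proof -
  define av where "av = (\<lambda>F. L2_norm_on (face_measure F) (average \<T> F (grad w)))"
  have "\<bar>consistency g w v\<bar> \<le>
      (\<Sum>F\<in>faces. \<bar>LINT x|face_measure F. g x * (average \<T> F (grad w) x \<bullet> jump \<T> F v x)\<bar>)"
    unfolding consistency_def by (rule sum_abs)
  also have "\<dots> \<le> (\<Sum>F\<in>faces. q * a_max / sqrt \<eta> *
      (\<bar>sqrt (face_size \<T> F) * av F\<bar> * \<bar>sqrt (\<eta> / face_size \<T> F) * jump_norm v F\<bar>))"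
  proof (rule sum_mono)
    fix F assume F: "F \<in> faces"
    have FD: "F \<subseteq> closure D" using F face_element by blast
    have "\<bar>LINT x|face_measure F. g x * (average \<T> F (grad w) x \<bullet> jump \<T> F v x)\<bar> \<le>
        q * a_max * (av F * jump_norm v F)"
      unfolding av_def jump_norm_def
    proof (rule abs_integral_le_L2_norms)
      show "integrable (face_measure F) (\<lambda>x. g x * (average \<T> F (grad w) x \<bullet> jump \<T> F v x))"
        by (intro integrable_face[OF F] continuous_on_mult continuous_on_inner
            continuous_on_coefficient_face[OF g F] continuous_on_average continuous_on_jump V)
      show "integrable (face_measure F) (\<lambda>x. (norm (average \<T> F (grad w) x))\<^sup>2)"
        "integrable (face_measure F) (\<lambda>x. (norm (jump \<T> F v x))\<^sup>2)"
        by (intro integrable_face_norm_squared F continuous_on_average continuous_on_jump V)+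
      fix x assume "x \<in> space (face_measure F)"
      then have x: "x \<in> closure D" using FD space_face_measure[OF F] by auto
      have "\<bar>g x\<bar> \<le> q * a x" using q(2) x .
      also have "\<dots> \<le> q * a_max" using a_bounds[OF x] q(1) by (intro mult_left_mono) auto
      finally show "\<bar>g x * (average \<T> F (grad w) x \<bullet> jump \<T> F v x)\<bar> \<le>
          q * a_max * (norm (average \<T> F (grad w) x) * norm (jump \<T> F v x))"
        unfolding abs_mult using Cauchy_Schwarz_ineq2 q(1) a_max by (intro mult_mono) auto
    qed (use q(1) a_max in simp)
    \<comment> \<open>The inserted weights sqrt h_F and sqrt (\<eta> / h_F) multiply to sqrt \<eta>,
      which the prefactor cancels.\<close>
    also have "\<dots> = q * a_max / sqrt \<eta> *
        ((sqrt (face_size \<T> F) * av F) * (sqrt (\<eta> / face_size \<T> F) * jump_norm v F))"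
      using face_size_pos[OF F] \<eta> by (simp add: real_sqrt_divide)
    also have "\<dots> \<le> q * a_max / sqrt \<eta> *
        (\<bar>sqrt (face_size \<T> F) * av F\<bar> * \<bar>sqrt (\<eta> / face_size \<T> F) * jump_norm v F\<bar>)"
      unfolding abs_mult[symmetric] using q(1) a_max \<eta> by (intro mult_left_mono abs_ge_self) auto
    finally show "\<bar>LINT x|face_measure F. g x * (average \<T> F (grad w) x \<bullet> jump \<T> F v x)\<bar> \<le> \<dots>" .
  qed
  also have "\<dots> \<le> q * a_max / sqrt \<eta> * (L2_set (\<lambda>F. sqrt (face_size \<T> F) * av F) faces * jump_part v)"
    unfolding sum_distrib_left[symmetric] jump_part_def using q(1) a_max \<eta>
    by (intro mult_left_mono L2_set_mult_ineq) auto
  also have "\<dots> \<le> q * a_max / sqrt \<eta> * ((\<bar>C_tr\<bar> * sqrt (real N) / sqrt a_min * energy_part w) * jump_part v)"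
  proof -
    have "(L2_set (\<lambda>F. sqrt (face_size \<T> F) * av F) faces)\<^sup>2 = (\<Sum>F\<in>faces. face_size \<T> F * (av F)\<^sup>2)"
      using face_size_pos by (simp add: L2_set_def sum_nonneg power_mult_distrib less_imp_le)
    also have "\<dots> \<le> C_tr\<^sup>2 * real N * (\<Sum>T\<in>\<T>. (grad_norm w T)\<^sup>2)"
      unfolding av_def by (rule sum_average_bound[OF V(1)])
    also have "\<dots> \<le> C_tr\<^sup>2 * real N * ((energy_part w)\<^sup>2 / a_min)"
    proof (intro mult_left_mono)
      have "(\<Sum>T\<in>\<T>. (grad_norm w T)\<^sup>2) \<le> (\<Sum>T\<in>\<T>. (energy w T)\<^sup>2 / a_min)"
        using grad_norm_le_energy[OF V(1)] a_min by (intro sum_mono) (simp add: field_simps)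
      then show "(\<Sum>T\<in>\<T>. (grad_norm w T)\<^sup>2) \<le> (energy_part w)\<^sup>2 / a_min"
        by (simp add: energy_part_def L2_set_def sum_nonneg sum_divide_distrib)
    qed auto
    also have "\<dots> = (\<bar>C_tr\<bar> * sqrt (real N) / sqrt a_min * energy_part w)\<^sup>2"
      using a_min by (simp add: power_mult_distrib power_divide)
    finally have "L2_set (\<lambda>F. sqrt (face_size \<T> F) * av F) faces \<le> \<bar>C_tr\<bar> * sqrt (real N) / sqrt a_min * energy_part w"
      using a_min by (rule_tac power2_le_imp_le) auto
    then show ?thesis using q(1) a_max \<eta> by (intro mult_left_mono mult_right_mono) auto
  qed
  also have "\<dots> = q * (face_const * (energy_part w * jump_part v))"
    using a_min \<eta> by (simp add: face_const_def real_sqrt_mult ac_simps)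
  finally show ?thesis .
qed

lemma DG_form_split:
  assumes g: "continuous_on (closure D) g" and V: "w \<in> V" "v \<in> V"
  shows "DG_form \<T> \<theta> e g w v = (\<Sum>T\<in>\<T>. LINT x|lebesgue_on T. g x * (grad w x \<bullet> grad v x)) +
    \<theta> * consistency g v w - consistency g w v +
    (\<Sum>F\<in>faces. e / face_size \<T> F * (LINT x|face_measure F. jump \<T> F w x \<bullet> jump \<T> F v x))"
proof -
  have "(LINT x|face_measure F. face_integrand \<theta> e g w v F x) =
      \<theta> * (LINT x|face_measure F. g x * (average \<T> F (grad v) x \<bullet> jump \<T> F w x)) -
      (LINT x|face_measure F. g x * (average \<T> F (grad w) x \<bullet> jump \<T> F v x)) +
      e / face_size \<T> F * (LINT x|face_measure F. jump \<T> F w x \<bullet> jump \<T> F v x)" if F: "F \<in> faces" for F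
  proof -
    have "integrable (face_measure F) (\<lambda>x. g x * (average \<T> F (grad v) x \<bullet> jump \<T> F w x))"
      "integrable (face_measure F) (\<lambda>x. g x * (average \<T> F (grad w) x \<bullet> jump \<T> F v x))"
      "integrable (face_measure F) (\<lambda>x. jump \<T> F w x \<bullet> jump \<T> F v x)"
      by (intro integrable_face[OF F] continuous_on_mult continuous_on_inner
          continuous_on_coefficient_face[OF g F] continuous_on_average continuous_on_jump V)+
    then show ?thesis by (simp add: face_integrand_def)
  qed
  then show ?thesis
    by (simp add: DG_form_eq g V consistency_def sum.distrib sum_subtractf sum_distrib_left)
qed

lemma DG_form_bound:
  assumes g: "continuous_on (closure D) g" and q: "q \<ge> 0" "\<And>x. x \<in> closure D \<Longrightarrow> \<bar>g x\<bar> \<le> q * a x"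
    and V: "w \<in> V" "v \<in> V" and \<theta>: "\<bar>\<theta>\<bar> \<le> 1"
  shows "\<bar>DG_form \<T> \<theta> 0 g w v\<bar> \<le> q * ((1 + 2 * face_const) * (DG_norm \<T> \<eta> a w * DG_norm \<T> \<eta> a v))"
proof -
  let ?n = "DG_norm \<T> \<eta> a w * DG_norm \<T> \<eta> a v"
  note fc = face_const_nonneg
  have "\<bar>\<Sum>T\<in>\<T>. LINT x|lebesgue_on T. g x * (grad w x \<bullet> grad v x)\<bar> \<le> q * (energy_part w * energy_part v)"
    by (rule volume_bound[OF g q V])
  also have "\<dots> \<le> q * ?n" using q(1) by (intro mult_left_mono mult_mono part_le_norm DG_norm_nonneg) auto
  finally have 1: "\<bar>\<Sum>T\<in>\<T>. LINT x|lebesgue_on T. g x * (grad w x \<bullet> grad v x)\<bar> \<le> q * ?n" .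
  have "\<bar>consistency g w v\<bar> \<le> q * (face_const * (energy_part w * jump_part v))"
    by (rule consistency_bound[OF g q V])
  also have "\<dots> \<le> q * (face_const * ?n)"
    using q(1) fc by (intro mult_left_mono mult_mono part_le_norm DG_norm_nonneg) auto
  finally have 2: "\<bar>consistency g w v\<bar> \<le> q * (face_const * ?n)" .
  have "\<bar>\<theta> * consistency g v w\<bar> \<le> 1 * \<bar>consistency g v w\<bar>"
    unfolding abs_mult using \<theta> by (intro mult_right_mono) auto
  also have "\<dots> \<le> q * (face_const * (energy_part v * jump_part w))"
    using consistency_bound[OF g q V(2,1)] by simp
  also have "\<dots> \<le> q * (face_const * (DG_norm \<T> \<eta> a v * DG_norm \<T> \<eta> a w))"
    using q(1) fc by (intro mult_left_mono mult_mono part_le_norm DG_norm_nonneg) auto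
  finally have 3: "\<bar>\<theta> * consistency g v w\<bar> \<le> q * (face_const * ?n)" by (simp add: mult.commute)
  have "DG_form \<T> \<theta> 0 g w v = (\<Sum>T\<in>\<T>. LINT x|lebesgue_on T. g x * (grad w x \<bullet> grad v x)) +
    \<theta> * consistency g v w - consistency g w v"
    by (simp add: DG_form_split[OF g V])
  with 1 2 3 have "\<bar>DG_form \<T> \<theta> 0 g w v\<bar> \<le> q * ?n + q * (face_const * ?n) + q * (face_const * ?n)"
    by linarith
  then show ?thesis by (simp add: algebra_simps)
qed

text \<open>With equal arguments the two consistency terms merge into one with factor \<theta> - 1.
  It is at most 2 s X Y for the gradient part X and the jump part Y, hence at most s times the
  squared norm. The lemma is applied with s = 1 / sqrt \<tau>.\<close>

lemma DG_form_coercive: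
  assumes v: "v \<in> V" and s0: "s \<ge> 0" and s: "\<bar>\<theta> - 1\<bar> * face_const \<le> 2 * s"
  shows "(1 - s) * (DG_norm \<T> \<eta> a v)\<^sup>2 \<le> DG_form \<T> \<theta> \<eta> a v v"
proof -
  let ?X = "energy_part v" and ?Y = "jump_part v"
  have vol: "(\<Sum>T\<in>\<T>. LINT x|lebesgue_on T. a x * (grad v x \<bullet> grad v x)) = ?X\<^sup>2"
    by (simp add: energy_part_squared energy_squared[OF v])
  have pen: "(\<Sum>F\<in>faces. \<eta> / face_size \<T> F * (LINT x|face_measure F. jump \<T> F v x \<bullet> jump \<T> F v x)) = ?Y\<^sup>2"
    unfolding jump_part_squared jump_norm_def L2_norm_on_squared power2_norm_eq_inner ..
  have form: "DG_form \<T> \<theta> \<eta> a v v = ?X\<^sup>2 + (\<theta> - 1) * consistency a v v + ?Y\<^sup>2"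
    unfolding DG_form_split[OF a_cont v v] vol pen by (simp add: algebra_simps)
  have "\<bar>consistency a v v\<bar> \<le> face_const * (?X * ?Y)"
    using consistency_bound[OF a_cont, of 1 v v] v a_pos by (simp add: less_imp_le)
  then have "\<bar>\<theta> - 1\<bar> * \<bar>consistency a v v\<bar> \<le> \<bar>\<theta> - 1\<bar> * (face_const * (?X * ?Y))"
    by (intro mult_left_mono) auto
  also have "\<dots> = (\<bar>\<theta> - 1\<bar> * face_const) * (?X * ?Y)" by simp
  also have "\<dots> \<le> (2 * s) * (?X * ?Y)" using s by (intro mult_right_mono) auto
  also have "\<dots> = s * (2 * ?X * ?Y)" by simp
  also have "\<dots> \<le> s * (?X\<^sup>2 + ?Y\<^sup>2)"
    using s0 by (intro mult_left_mono sum_squares_bound)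
  finally have "\<bar>(\<theta> - 1) * consistency a v v\<bar> \<le> s * (?X\<^sup>2 + ?Y\<^sup>2)" by (simp add: abs_mult)
  then show ?thesis unfolding form DG_norm_squared by (simp add: algebra_simps abs_le_iff)
qed

end

section \<open>The parametric problem on one mesh\<close>

text \<open>Nonnegativity of c covers an essential supremum of minus infinity, whose real value is
  0.\<close>

lemma Linf_norm_le:
  fixes v :: "'a::euclidean_space \<Rightarrow> 'b::real_normed_vector"
  assumes D: "open D" and v: "continuous_on D v" and le: "\<And>x. x \<in> D \<Longrightarrow> norm (v x) \<le> c" and c: "c \<ge> 0"
  shows "v \<in> Linf_space D" "Linf_norm D v \<le> c"
proof -
  have m: "v \<in> borel_measurable (lebesgue_on D)"
    using D v by (intro continuous_imp_measurable_on_sets_lebesgue) auto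
  let ?e = "esssup (lebesgue_on D) (\<lambda>x. ereal (norm (v x)))"
  have e: "?e \<le> ereal c" using m le by (intro esssup_I) (auto intro!: AE_I2)
  then show "v \<in> Linf_space D" using m by (auto simp: Linf_space_def)
  show "Linf_norm D v \<le> c" unfolding Linf_norm_def using e c by (cases ?e) auto
qed

lemma Linf_norm_cong:
  fixes v w :: "'a::euclidean_space \<Rightarrow> real"
  assumes "open D" "continuous_on D v" "\<And>x. x \<in> D \<Longrightarrow> w x = v x"
  shows "Linf_norm D w = Linf_norm D v"
proof -
  have "continuous_on D w" using assms(2,3) by (simp cong: continuous_on_cong)
  then have "w \<in> borel_measurable (lebesgue_on D)" "v \<in> borel_measurable (lebesgue_on D)"
    using assms by (auto intro!: continuous_imp_measurable_on_sets_lebesgue)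
  then have "esssup (lebesgue_on D) (\<lambda>x. ereal (norm (w x))) = esssup (lebesgue_on D) (\<lambda>x. ereal (norm (v x)))"
    using assms(3) by (intro esssup_AE_cong) (auto intro!: AE_I2)
  then show ?thesis by (simp add: Linf_norm_def)
qed

lemma finite_multi_indices_below:
  fixes \<nu> :: "nat \<Rightarrow> nat"
  assumes "finite (supp \<nu>)"
  shows "finite {m. \<forall>j. m j \<le> \<nu> j}"
proof (rule finite_subset)
  show "{m. \<forall>j. m j \<le> \<nu> j} \<subseteq> {m. \<forall>j. (j \<in> supp \<nu> \<longrightarrow> m j \<in> {..mi_abs \<nu>}) \<and> (j \<notin> supp \<nu> \<longrightarrow> m j = 0)}"
  proof (clarsimp, intro conjI impI)
    fix m :: "nat \<Rightarrow> nat" and j assume m: "\<forall>j. m j \<le> \<nu> j"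
    show "m j \<le> mi_abs \<nu>" if "j \<in> supp \<nu>"
      using m member_le_sum[OF that, of \<nu>] assms by (simp add: mi_abs_def) (meson le_trans)
    show "m j = 0" if "j \<notin> supp \<nu>" using m that by (metis (mono_tags) le_zero_eq mem_Collect_eq supp_def)
  qed
qed (intro finite_set_of_finite_funs assms finite_atMost)

lemma mi_choose_unit:
  assumes "finite (supp \<nu>)" "j \<in> supp \<nu>"
  shows "mi_choose \<nu> ((\<lambda>_. 0)(j := 1)) = \<nu> j"
proof -
  have "mi_choose \<nu> ((\<lambda>_. 0)(j := 1)) = (\<Prod>i\<in>supp \<nu>. if i = j then \<nu> j else 1)"
    unfolding mi_choose_def by (intro prod.cong) auto
  then show ?thesis using assms by simp
qed

text \<open>Bounds on the data are required on the closure of D, because they are used on faces. The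
  condition \<alpha> \<le> 1 is what allows a division by \<alpha> to enlarge the bound in the final
  induction.\<close>

locale dg_affine = dg_form D \<T> k C_tr \<eta> a_min a_max N
  for D :: "'a::euclidean_space set" and \<T> k C_tr \<eta> a_min a_max N +
  fixes a0 :: "'a \<Rightarrow> real" and \<psi> :: "nat \<Rightarrow> 'a \<Rightarrow> real" and a :: "(nat \<Rightarrow> real) \<Rightarrow> 'a \<Rightarrow> real"
    and f :: "'a \<Rightarrow> real" and u :: "(nat \<Rightarrow> real) \<Rightarrow> 'a \<Rightarrow> real" and \<theta> \<sigma> \<alpha> :: real
  assumes a_def: "a = affine_coeff a0 \<psi>"
    and a0_cont: "continuous_on (closure D) a0" and \<psi>_cont: "\<And>j. continuous_on (closure D) (\<psi> j)"
    and \<psi>_le: "\<And>j x. x \<in> closure D \<Longrightarrow> \<bar>\<psi> j x\<bar> \<le> Linf_norm D (\<psi> j)"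
    and \<psi>_summable: "summable (\<lambda>j. Linf_norm D (\<psi> j))"
    and a_bounds': "\<And>x y. x \<in> closure D \<Longrightarrow> y \<in> param_box \<Longrightarrow> a_min \<le> a y x \<and> a y x \<le> a_max"
    and \<theta>: "\<bar>\<theta>\<bar> \<le> 1" and \<sigma>: "\<sigma> > 0"
    and Poincare: "\<And>v. v \<in> DG_space D \<T> k \<Longrightarrow> L2_norm_on (lebesgue_on D) v \<le> \<sigma> * sqrt (
          (\<Sum>T\<in>\<T>. (L2_norm_on (lebesgue_on T) (grad v))\<^sup>2) +
          (\<Sum>F\<in>mesh_faces \<T>. 1 / face_size \<T> F * (L2_norm_on (face_measure F) (jump \<T> F v))\<^sup>2))"
    and \<alpha>: "0 < \<alpha>" "\<alpha> \<le> 1"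
    and coercive: "\<And>y v. y \<in> param_box \<Longrightarrow> v \<in> DG_space D \<T> k \<Longrightarrow>
          \<alpha> * (DG_norm \<T> \<eta> (a y) v)\<^sup>2 \<le> DG_form \<T> \<theta> \<eta> (a y) v v"
    and f: "f \<in> L2_space D"
    and u: "\<And>y. y \<in> param_box \<Longrightarrow> is_DG_solution D \<T> k \<theta> \<eta> (a y) f (u y)"
begin

lemma \<psi>_summable_at: "x \<in> closure D \<Longrightarrow> summable (\<lambda>j. \<bar>\<psi> j x\<bar>)"
  by (rule summable_comparison_test'[OF \<psi>_summable]) (use \<psi>_le in auto)

lemma a_cont: "y \<in> param_box \<Longrightarrow> continuous_on (closure D) (a y)"
  unfolding a_def by (rule continuous_on_affine_coeff[OF a0_cont \<psi>_cont \<psi>_le \<psi>_summable])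

lemma a_upd: "\<lbrakk>x \<in> closure D; y \<in> param_box; t \<in> {-1/2..1/2}\<rbrakk> \<Longrightarrow> a (y(j := t)) x = a y x + (t - y j) * \<psi> j x"
  unfolding a_def by (intro affine_coeff_upd \<psi>_summable_at)

lemma coefficient: "y \<in> param_box \<Longrightarrow> dg_coefficient D \<T> k C_tr \<eta> a_min a_max N (a y)"
  by unfold_locales (use a_cont a_bounds' in auto)

definition C_Poin :: real where "C_Poin = \<sigma> / min (sqrt a_min) (sqrt \<eta>)"

lemma C_Poin_nonneg: "C_Poin \<ge> 0"
  using \<sigma> a_min \<eta> by (simp add: C_Poin_def)

lemma DG_norm_nonneg': "y \<in> param_box \<Longrightarrow> DG_norm \<T> \<eta> (a y) v \<ge> 0"
  using dg_coefficient.DG_norm_nonneg[OF coefficient] .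

text \<open>The square of the minimum in \<open>C_Poin\<close> is a lower bound for both weights of
  the energy norm, a on the elements and \<eta> on the jumps.\<close>

lemma Poincare_DG_norm:
  assumes y: "y \<in> param_box" and v: "v \<in> V"
  shows "L2_norm_on (lebesgue_on D) v \<le> C_Poin * DG_norm \<T> \<eta> (a y) v"
proof -
  interpret dg_coefficient D \<T> k C_tr \<eta> a_min a_max N "a y" by (rule coefficient[OF y])
  define m where "m = min (sqrt a_min) (sqrt \<eta>)"
  have m: "m > 0" using a_min \<eta> by (simp add: m_def)
  have "m \<le> sqrt a_min" "m \<le> sqrt \<eta>" by (simp_all add: m_def)
  then have "m\<^sup>2 \<le> (sqrt a_min)\<^sup>2" "m\<^sup>2 \<le> (sqrt \<eta>)\<^sup>2" using m by (simp_all add: power_mono)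
  then have m2: "m\<^sup>2 \<le> a_min" "m\<^sup>2 \<le> \<eta>" using a_min \<eta> by simp_all
  define S where "S = (\<Sum>T\<in>\<T>. (L2_norm_on (lebesgue_on T) (grad v))\<^sup>2) +
          (\<Sum>F\<in>mesh_faces \<T>. 1 / face_size \<T> F * (L2_norm_on (face_measure F) (jump \<T> F v))\<^sup>2)"
  have "m\<^sup>2 * S \<le> (energy_part v)\<^sup>2 + (jump_part v)\<^sup>2"
    unfolding S_def distrib_left sum_distrib_left energy_part_squared jump_part_squared
  proof (intro add_mono sum_mono)
    fix T assume T: "T \<in> \<T>"
    have "m\<^sup>2 * (L2_norm_on (lebesgue_on T) (grad v))\<^sup>2 \<le> a_min * (grad_norm v T)\<^sup>2"
      unfolding grad_norm_def using m2 by (intro mult_right_mono) auto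
    also have "\<dots> \<le> (energy v T)\<^sup>2" by (rule grad_norm_le_energy[OF v T])
    finally show "m\<^sup>2 * (L2_norm_on (lebesgue_on T) (grad v))\<^sup>2 \<le> (energy v T)\<^sup>2" .
  next
    fix F assume F: "F \<in> faces"
    have "m\<^sup>2 * (1 / face_size \<T> F * (L2_norm_on (face_measure F) (jump \<T> F v))\<^sup>2) =
        m\<^sup>2 * ((L2_norm_on (face_measure F) (jump \<T> F v))\<^sup>2 / face_size \<T> F)" by simp
    also have "\<dots> \<le> \<eta> * ((L2_norm_on (face_measure F) (jump \<T> F v))\<^sup>2 / face_size \<T> F)"
      using m2 face_size_pos[OF F] by (intro mult_right_mono) auto
    finally show "m\<^sup>2 * (1 / face_size \<T> F * (L2_norm_on (face_measure F) (jump \<T> F v))\<^sup>2) \<le>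
        \<eta> / face_size \<T> F * (jump_norm v F)\<^sup>2" by (simp add: jump_norm_def)
  qed
  then have "sqrt (m\<^sup>2 * S) \<le> sqrt ((DG_norm \<T> \<eta> (a y) v)\<^sup>2)"
    unfolding DG_norm_squared by (rule real_sqrt_le_mono)
  then have "m * sqrt S \<le> DG_norm \<T> \<eta> (a y) v"
    using m DG_norm_nonneg by (simp add: real_sqrt_mult)
  then have "sqrt S \<le> DG_norm \<T> \<eta> (a y) v / m" using m by (simp add: field_simps)
  then have "\<sigma> * sqrt S \<le> \<sigma> * (DG_norm \<T> \<eta> (a y) v / m)" using \<sigma> by (intro mult_left_mono) auto
  moreover have "L2_norm_on (lebesgue_on D) v \<le> \<sigma> * sqrt S" unfolding S_def by (rule Poincare[OF v])
  ultimately show ?thesis by (simp add: C_Poin_def m_def)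
qed

text \<open>The Poincare inequality makes v vanish almost everywhere. Inside an element v is
  continuous, so a nonzero value would persist on a nonempty open set.\<close>

lemma DG_norm_definite:
  assumes y: "y \<in> param_box" and v: "v \<in> V" and zero: "DG_norm \<T> \<eta> (a y) v = 0" and x: "x \<in> \<Union>\<T>"
  shows "v x = 0"
proof (rule ccontr)
  assume nz: "v x \<noteq> 0"
  obtain T where T: "T \<in> \<T>" "x \<in> T" using x by blast
  have vL2: "v \<in> L2_space D" using v by (simp add: DG_space_def)
  have "L2_norm_on (lebesgue_on D) v = 0"
    using Poincare_DG_norm[OF y v] zero L2_norm_on_nonneg[of "lebesgue_on D" v] by simp
  then have "(LINT x|lebesgue_on D. (v x)\<^sup>2) = 0" by (simp add: L2_norm_on_def)
  then have ae: "AE x in lebesgue_on D. v x = 0"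
    using vL2 by (subst (asm) integral_nonneg_eq_0_iff_AE) (auto simp: L2_space_def)
  have "continuous_on T v"
    by (rule continuous_on_eq[OF continuous_on_subset[OF continuous_on_trace[OF element(1) extends_DG] closure_subset]])
       (use T v trace_inside[OF element(1) extends_DG] in auto)
  then have U: "open {z \<in> T. v z \<noteq> 0}"
    using continuous_open_preimage[of T v "- {0}"] element(1)[OF T(1)]
    by (simp add: open_Compl vimage_def Int_def)
  have "x \<in> {z \<in> T. v z \<noteq> 0} \<inter> D" using T nz element(3) by blast
  with AE_imp_dense[OF D(1) ae U] show False by blast
qed

section \<open>Derivatives of the coefficient and their relative size\<close>

lemma mderiv_coefficient:
  assumes y: "y \<in> param_box" and x: "x \<in> closure D"
  shows "mderiv_y ((\<lambda>_. 0)(j := 1)) a y x = \<psi> j x"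
proof -
  have "mderiv_y ((\<lambda>_. 0)(j := Suc ((\<lambda>_. 0) j))) a = pderiv_y j (mderiv_y (\<lambda>_. 0) a)"
    by (rule mderiv_y_Suc) auto
  then have "mderiv_y ((\<lambda>_. 0)(j := 1)) a y x = pderiv_y j a y x" by simp
  also have "\<dots> = \<psi> j x"
  proof (rule pderiv_yI[OF _ y])
    have "((\<lambda>t. a y x + (t - y j) * \<psi> j x) has_real_derivative \<psi> j x) (at (y j) within {-1/2..1/2})"
      by (auto intro!: derivative_eq_intros)
    then show "((\<lambda>t. a (y(j := t)) x) has_real_derivative \<psi> j x) (at (y j) within {-1/2..1/2})"
      by (rule has_field_derivative_transform_within[OF _ zero_less_one param_boxD[OF y]])
         (use a_upd[OF x y] in auto)
  qed
  finally show ?thesis .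
qed

definition ratio :: "(nat \<Rightarrow> real) \<Rightarrow> nat \<Rightarrow> real" where
  "ratio y j = Linf_norm D (\<lambda>x. \<psi> j x / a y x)"

text \<open>The quotient \<psi>_j / a is continuous up to the boundary, hence its essential supremum
  also bounds it on the faces. This is the relative bound required for the form with coefficient
  \<psi>_j.\<close>

lemma
  assumes y: "y \<in> param_box"
  shows ratio_le: "ratio y j \<le> Linf_norm D (\<psi> j) / a_min"
    and \<psi>_le_ratio: "x \<in> closure D \<Longrightarrow> \<bar>\<psi> j x\<bar> \<le> ratio y j * a y x"
    and ratio_nonneg: "ratio y j \<ge> 0"
    and ratio_eq: "Linf_norm D (\<lambda>x. mderiv_y ((\<lambda>_. 0)(j := 1)) a y x / a y x) = ratio y j"
proof -
  have pos: "a y x > 0" if "x \<in> closure D" for x using a_bounds'[OF that y] a_min by linarith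
  have cont: "continuous_on (closure D) (\<lambda>x. \<psi> j x / a y x)"
    using pos by (intro continuous_on_divide \<psi>_cont a_cont y) fastforce
  then have contD: "continuous_on D (\<lambda>x. \<psi> j x / a y x)" using closure_subset continuous_on_subset by blast
  have le: "norm (\<psi> j x / a y x) \<le> Linf_norm D (\<psi> j) / a_min" if "x \<in> D" for x
  proof -
    have x: "x \<in> closure D" using that closure_subset by blast
    show ?thesis
      unfolding real_norm_def abs_divide using \<psi>_le[OF x] a_bounds'[OF x y] a_min Linf_norm_nonneg
      by (intro frac_le) auto
  qed
  have c: "Linf_norm D (\<psi> j) / a_min \<ge> 0" using a_min Linf_norm_nonneg[of D "\<psi> j"] by simp
  show "ratio y j \<le> Linf_norm D (\<psi> j) / a_min"
    unfolding ratio_def by (rule Linf_norm_le(2)[OF D(1) contD le c])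
  show "ratio y j \<ge> 0" unfolding ratio_def by (rule Linf_norm_nonneg)
  show "\<bar>\<psi> j x\<bar> \<le> ratio y j * a y x" if x: "x \<in> closure D"
  proof -
    have "norm (\<psi> j x / a y x) \<le> ratio y j"
      unfolding ratio_def by (rule norm_le_Linf_norm[OF D(1) Linf_norm_le(1)[OF D(1) contD le c] cont x])
    then show ?thesis using pos[OF x] by (simp add: abs_divide field_simps)
  qed
  show "Linf_norm D (\<lambda>x. mderiv_y ((\<lambda>_. 0)(j := 1)) a y x / a y x) = ratio y j"
    unfolding ratio_def
    by (rule Linf_norm_cong[OF D(1) contD]) (use mderiv_coefficient[OF y] closure_subset in auto)
qed

text \<open>W is the derivative of u rebuilt from the derivatives of its basis coefficients. Unlike
  \<open>mderiv_y \<nu> u y\<close>, whose values outside the elements are not controlled, W lies in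
  the DG space by construction and may be inserted into the form.\<close>

lemma mderiv_solution:
  obtains W :: "(nat \<Rightarrow> nat) \<Rightarrow> (nat \<Rightarrow> real) \<Rightarrow> 'a \<Rightarrow> real"
  where "\<And>\<nu> y. W \<nu> y \<in> V"
    "\<And>\<nu> y x. \<lbrakk>finite (supp \<nu>); y \<in> param_box; x \<in> \<Union>\<T>\<rbrakk> \<Longrightarrow> mderiv_y \<nu> u y x = W \<nu> y x"
    "\<And>\<nu> y. \<lbrakk>finite (supp \<nu>); y \<in> param_box; \<nu> \<noteq> (\<lambda>_. 0)\<rbrakk> \<Longrightarrow> DG_form \<T> \<theta> \<eta> (a y) (W \<nu> y) (W \<nu> y) =
      - (\<Sum>j\<in>supp \<nu>. real (\<nu> j) * DG_form \<T> \<theta> 0 (\<psi> j) (W (\<nu>(j := \<nu> j - 1)) y) (W \<nu> y))"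
    "\<And>\<nu> y j x. \<lbrakk>finite (supp \<nu>); y \<in> param_box; x \<in> \<Union>\<T>\<rbrakk> \<Longrightarrow>
      (\<lambda>t. mderiv_y \<nu> u (y(j := t)) x) differentiable (at (y j) within {-1/2..1/2})"
proof -
  obtain J :: "('a set \<times> ('a \<Rightarrow> nat)) set" and \<phi> where J: "finite J" and \<phi>: "\<And>i. i \<in> J \<Longrightarrow> \<phi> i \<in> V"
    and span: "\<And>v. v \<in> V \<Longrightarrow> \<exists>c. \<forall>x\<in>\<Union>\<T>. v x = (\<Sum>i\<in>J. c i * \<phi> i x)"
    and indep: "\<And>c. (\<And>x. x \<in> \<Union>\<T> \<Longrightarrow> (\<Sum>i\<in>J. c i * \<phi> i x) = 0) \<Longrightarrow> \<forall>i\<in>J. c i = 0"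
    by (rule DG_basis) blast
  have uV: "u y \<in> V" if "y \<in> param_box" for y using u[OF that] by (simp add: is_DG_solution_def)
  have "\<forall>y. \<exists>c. y \<in> param_box \<longrightarrow> (\<forall>x\<in>\<Union>\<T>. u y x = (\<Sum>i\<in>J. c i * \<phi> i x))"
    using span uV by blast
  then obtain c where c: "\<And>y x. y \<in> param_box \<Longrightarrow> x \<in> \<Union>\<T> \<Longrightarrow> u y x = (\<Sum>i\<in>J. c y i * \<phi> i x)"
    by metis
  \<comment> \<open>The first index belongs to the test function, the second to the trial function,
    so row i is the equation tested with \<open>\<phi> i\<close>.\<close>
  define B where "B = (\<lambda>y i i'. DG_form \<T> \<theta> \<eta> (a y) (\<phi> i') (\<phi> i))"
  define \<Psi> where "\<Psi> = (\<lambda>j i i'. DG_form \<T> \<theta> 0 (\<psi> j) (\<phi> i') (\<phi> i))"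
  define l where "l = (\<lambda>i. LINT x|lebesgue_on D. f x * \<phi> i x)"
  have aff: "B (y(j := t)) i i' = B y i i' + (t - y j) * \<Psi> j i i'"
    if "y \<in> param_box" "t \<in> {-1/2..1/2}" "i \<in> J" "i' \<in> J" for y j t i i'
    unfolding B_def \<Psi>_def using that
    by (intro DG_form_coefficient a_cont \<psi>_cont \<phi> a_upd)
  have form: "DG_form \<T> \<theta> e g (\<lambda>x. \<Sum>i\<in>J. d i * \<phi> i x) (\<lambda>x. \<Sum>i\<in>J. d' i * \<phi> i x) =
      (\<Sum>i\<in>J. d' i * (\<Sum>i'\<in>J. DG_form \<T> \<theta> e g (\<phi> i') (\<phi> i) * d i'))"
    if g: "continuous_on (closure D) g" for e g d d'
  proof -
    have "DG_form \<T> \<theta> e g (\<lambda>x. \<Sum>i\<in>J. d i * \<phi> i x) (\<lambda>x. \<Sum>i\<in>J. d' i * \<phi> i x) =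
        (\<Sum>i\<in>J. d' i * DG_form \<T> \<theta> e g (\<lambda>x. \<Sum>i\<in>J. d i * \<phi> i x) (\<phi> i))"
      by (rule DG_form_sum_right[OF g DG_sum[OF J \<phi>] J \<phi>])
    also have "\<dots> = (\<Sum>i\<in>J. d' i * (\<Sum>i'\<in>J. d i' * DG_form \<T> \<theta> e g (\<phi> i') (\<phi> i)))"
      by (intro sum.cong refl arg_cong2[where f = "(*)"] DG_form_sum_left g \<phi> J)
    finally show ?thesis by (simp only: mult.commute[of "d _"])
  qed
  have pos: "(\<Sum>i\<in>J. z i * (\<Sum>i'\<in>J. B y i i' * z i')) > 0" if y: "y \<in> param_box" and z: "\<exists>i\<in>J. z i \<noteq> 0" for y z
  proof -
    define w where "w = (\<lambda>x. \<Sum>i\<in>J. z i * \<phi> i x)"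
    have w: "w \<in> V" unfolding w_def by (rule DG_sum[OF J \<phi>])
    \<comment> \<open>A vanishing norm would make w vanish on all elements, and there the basis is
      independent.\<close>
    have "DG_norm \<T> \<eta> (a y) w \<noteq> 0"
    proof
      assume "DG_norm \<T> \<eta> (a y) w = 0"
      then have "\<forall>i\<in>J. z i = 0"
        using DG_norm_definite[OF y w] unfolding w_def by (intro indep) blast
      with z show False by blast
    qed
    then have "0 < \<alpha> * (DG_norm \<T> \<eta> (a y) w)\<^sup>2" using \<alpha> by simp
    also have "\<dots> \<le> DG_form \<T> \<theta> \<eta> (a y) w w" by (rule coercive[OF y w])
    finally show ?thesis unfolding w_def form[OF a_cont[OF y]] B_def .
  qed
  have sol: "(\<Sum>i'\<in>J. B y i i' * c y i') = l i" if y: "y \<in> param_box" and i: "i \<in> J" for y i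
  proof -
    have "l i = DG_form \<T> \<theta> \<eta> (a y) (u y) (\<phi> i)"
      using u[OF y] \<phi>[OF i] by (simp add: is_DG_solution_def l_def)
    also have "\<dots> = DG_form \<T> \<theta> \<eta> (a y) (\<lambda>x. \<Sum>i\<in>J. c y i * \<phi> i x) (\<phi> i)"
      by (intro DG_form_cong_left uV DG_sum \<phi> i J a_cont y c)
    also have "\<dots> = (\<Sum>i'\<in>J. c y i' * DG_form \<T> \<theta> \<eta> (a y) (\<phi> i') (\<phi> i))"
      by (intro DG_form_sum_left a_cont y \<phi> i J)
    finally show ?thesis by (simp add: B_def mult.commute)
  qed
  have system: "(\<forall>y\<in>param_box. \<forall>i\<in>J. (\<Sum>i'\<in>J. B y i i' * mderiv_y \<nu> c y i') =
      (if \<nu> = (\<lambda>_. 0) then l i else 0) -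
      (\<Sum>j\<in>supp \<nu>. real (\<nu> j) * (\<Sum>i'\<in>J. \<Psi> j i i' * mderiv_y (\<nu>(j := \<nu> j - 1)) c y i'))) \<and>
    (\<forall>y\<in>param_box. \<forall>j. \<forall>i\<in>J.
      (\<lambda>t. mderiv_y \<nu> c (y(j := t)) i) differentiable (at (y j) within {-1/2..1/2}))"
    if \<nu>: "finite (supp \<nu>)" for \<nu>
    by (rule mderiv_y_linear_system[of J B \<Psi> c l, OF J _ _ _ \<nu>]) (fact aff pos sol)+
  have diff: "(\<lambda>t. mderiv_y \<nu> c (y(j := t)) i) differentiable (at (y j) within {-1/2..1/2})"
    if "finite (supp \<nu>)" "y \<in> param_box" "i \<in> J" for \<nu> y j i
    using conjunct2[OF system[OF that(1)]] that(2,3) by blast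
  define W where "W = (\<lambda>\<nu> y x. \<Sum>i\<in>J. mderiv_y \<nu> c y i * \<phi> i x)"
  have mW: "mderiv_y \<nu> u y x = W \<nu> y x" if "finite (supp \<nu>)" "y \<in> param_box" "x \<in> \<Union>\<T>" for \<nu> y x
    unfolding W_def by (rule mderiv_y_sum[of J c u x "\<lambda>i. \<phi> i x", OF J diff c[OF _ that(3)] that(1,2)])
  show ?thesis
  proof (rule that[of W])
    show "W \<nu> y \<in> V" for \<nu> y unfolding W_def by (rule DG_sum[OF J \<phi>])
    show "mderiv_y \<nu> u y x = W \<nu> y x" if "finite (supp \<nu>)" "y \<in> param_box" "x \<in> \<Union>\<T>" for \<nu> y x
      using mW that .
    show "DG_form \<T> \<theta> \<eta> (a y) (W \<nu> y) (W \<nu> y) =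
      - (\<Sum>j\<in>supp \<nu>. real (\<nu> j) * DG_form \<T> \<theta> 0 (\<psi> j) (W (\<nu>(j := \<nu> j - 1)) y) (W \<nu> y))"
      if \<nu>: "finite (supp \<nu>)" "\<nu> \<noteq> (\<lambda>_. 0)" and y: "y \<in> param_box" for \<nu> y
    proof -
      have row: "(\<Sum>i'\<in>J. B y i i' * mderiv_y \<nu> c y i') =
          - (\<Sum>j\<in>supp \<nu>. real (\<nu> j) * (\<Sum>i'\<in>J. \<Psi> j i i' * mderiv_y (\<nu>(j := \<nu> j - 1)) c y i'))"
        if "i \<in> J" for i
        using conjunct1[OF system[OF \<nu>(1)], rule_format, OF y that] \<nu>(2) by simp
      \<comment> \<open>Weighting row i with the i-th coefficient of W and summing amounts to
        testing with the derivative itself.\<close>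
      have "DG_form \<T> \<theta> \<eta> (a y) (W \<nu> y) (W \<nu> y) =
          (\<Sum>i\<in>J. mderiv_y \<nu> c y i * (\<Sum>i'\<in>J. B y i i' * mderiv_y \<nu> c y i'))"
        unfolding W_def form[OF a_cont[OF y]] B_def ..
      also have "\<dots> = - (\<Sum>i\<in>J. \<Sum>j\<in>supp \<nu>. real (\<nu> j) *
          (mderiv_y \<nu> c y i * (\<Sum>i'\<in>J. \<Psi> j i i' * mderiv_y (\<nu>(j := \<nu> j - 1)) c y i')))"
      proof -
        have "mderiv_y \<nu> c y i * (\<Sum>i'\<in>J. B y i i' * mderiv_y \<nu> c y i') = - (\<Sum>j\<in>supp \<nu>. real (\<nu> j) *
            (mderiv_y \<nu> c y i * (\<Sum>i'\<in>J. \<Psi> j i i' * mderiv_y (\<nu>(j := \<nu> j - 1)) c y i')))" if "i \<in> J" for i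
          unfolding row[OF that] mult_minus_right sum_distrib_left[of "mderiv_y \<nu> c y i" _ "supp \<nu>"]
          by (simp only: mult.left_commute)
        then show ?thesis by (simp only: sum_negf[symmetric] cong: sum.cong)
      qed
      also have "\<dots> = - (\<Sum>j\<in>supp \<nu>. real (\<nu> j) *
          (\<Sum>i\<in>J. mderiv_y \<nu> c y i * (\<Sum>i'\<in>J. \<Psi> j i i' * mderiv_y (\<nu>(j := \<nu> j - 1)) c y i')))"
        by (subst sum.swap) (simp only: sum_distrib_left)
      also have "\<dots> = - (\<Sum>j\<in>supp \<nu>. real (\<nu> j) * DG_form \<T> \<theta> 0 (\<psi> j) (W (\<nu>(j := \<nu> j - 1)) y) (W \<nu> y))"
        unfolding W_def form[OF \<psi>_cont] \<Psi>_def ..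
      finally show ?thesis .
    qed
    show "(\<lambda>t. mderiv_y \<nu> u (y(j := t)) x) differentiable (at (y j) within {-1/2..1/2})"
      if \<nu>: "finite (supp \<nu>)" and y: "y \<in> param_box" and x: "x \<in> \<Union>\<T>" for \<nu> y j x
    proof (rule differentiable_cong_within[OF _ param_boxD[OF y]])
      show "(\<lambda>t. W \<nu> (y(j := t)) x) differentiable (at (y j) within {-1/2..1/2})"
        unfolding W_def using diff[OF \<nu> y] J
        by (intro differentiable_sum differentiable_mult) auto
      show "mderiv_y \<nu> u (y(j := t)) x = W \<nu> (y(j := t)) x" if "t \<in> {-1/2..1/2}" for t
        using mW[OF \<nu> param_box_upd[OF y that] x] .
    qed
  qed
qed

lemma differentiable_mderiv_solution:
  "\<lbrakk>finite (supp \<nu>); y \<in> param_box; x \<in> \<Union>\<T>\<rbrakk> \<Longrightarrow>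
    (\<lambda>t. mderiv_y \<nu> u (y(j := t)) x) differentiable (at (y j) within {-1/2..1/2})"
  by (rule mderiv_solution)

section \<open>Derivative recursion and regularity bound\<close>

definition C_DG :: real where "C_DG = (1 + 2 * face_const) / \<alpha>"

lemma C_DG_pos: "C_DG > 0"
  using face_const_nonneg \<alpha> by (simp add: C_DG_def add_pos_nonneg)

text \<open>Coercivity bounds the tested equation from below, boundedness of the forms with
  coefficient \<psi>_j from above. Because a is affine in y, only the indices \<nu> - e_j appear;
  this is sharper than the recursion with all m, and it is the version used in the final
  induction.\<close>

lemma derivative_bound:
  assumes \<nu>: "finite (supp \<nu>)" "\<nu> \<noteq> (\<lambda>_. 0)" and y: "y \<in> param_box"
  shows "DG_norm \<T> \<eta> (a y) (mderiv_y \<nu> u y) \<le>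
    C_DG * (\<Sum>j\<in>supp \<nu>. real (\<nu> j) * ratio y j * DG_norm \<T> \<eta> (a y) (mderiv_y (\<nu>(j := \<nu> j - 1)) u y))"
proof -
  interpret dg_coefficient D \<T> k C_tr \<eta> a_min a_max N "a y" by (rule coefficient[OF y])
  obtain W where WV: "\<And>\<nu> y. W \<nu> y \<in> V"
    and mW: "\<And>\<nu> y x. \<lbrakk>finite (supp \<nu>); y \<in> param_box; x \<in> \<Union>\<T>\<rbrakk> \<Longrightarrow> mderiv_y \<nu> u y x = W \<nu> y x"
    and eq: "\<And>\<nu> y. \<lbrakk>finite (supp \<nu>); y \<in> param_box; \<nu> \<noteq> (\<lambda>_. 0)\<rbrakk> \<Longrightarrow> DG_form \<T> \<theta> \<eta> (a y) (W \<nu> y) (W \<nu> y) =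
      - (\<Sum>j\<in>supp \<nu>. real (\<nu> j) * DG_form \<T> \<theta> 0 (\<psi> j) (W (\<nu>(j := \<nu> j - 1)) y) (W \<nu> y))"
    by (rule mderiv_solution) (rule that; assumption)
  define n where "n = (\<lambda>\<mu>. DG_norm \<T> \<eta> (a y) (W \<mu> y))"
  have norm: "DG_norm \<T> \<eta> (a y) (mderiv_y \<mu> u y) = n \<mu>" if "finite (supp \<mu>)" for \<mu>
    unfolding n_def using mW[OF that y] by (intro DG_norm_cong) 
  define S where "S = (\<Sum>j\<in>supp \<nu>. real (\<nu> j) * ratio y j * n (\<nu>(j := \<nu> j - 1)))"
  have "\<alpha> * (n \<nu>)\<^sup>2 \<le> DG_form \<T> \<theta> \<eta> (a y) (W \<nu> y) (W \<nu> y)"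
    unfolding n_def by (rule coercive[OF y WV])
  also have "\<dots> \<le> (\<Sum>j\<in>supp \<nu>. real (\<nu> j) * \<bar>DG_form \<T> \<theta> 0 (\<psi> j) (W (\<nu>(j := \<nu> j - 1)) y) (W \<nu> y)\<bar>)"
    unfolding eq[OF \<nu>(1) y \<nu>(2)] sum_negf[symmetric] mult_minus_right[symmetric]
    by (intro sum_mono mult_left_mono abs_ge_minus_self) auto
  also have "\<dots> \<le> (\<Sum>j\<in>supp \<nu>. real (\<nu> j) *
      (ratio y j * ((1 + 2 * face_const) * (n (\<nu>(j := \<nu> j - 1)) * n \<nu>))))"
    unfolding n_def
    by (intro sum_mono mult_left_mono DG_form_bound \<psi>_cont ratio_nonneg \<psi>_le_ratio y WV \<theta>) auto
  also have "\<dots> = (1 + 2 * face_const) * S * n \<nu>"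
    unfolding S_def sum_distrib_left sum_distrib_right by (intro sum.cong refl) (simp only: ac_simps)
  finally have main: "\<alpha> * (n \<nu>)\<^sup>2 \<le> (1 + 2 * face_const) * S * n \<nu>" .
  have n0: "n \<mu> \<ge> 0" for \<mu> unfolding n_def by (rule DG_norm_nonneg)
  have S0: "S \<ge> 0" unfolding S_def by (intro sum_nonneg mult_nonneg_nonneg ratio_nonneg n0 y) auto
  have "n \<nu> \<le> C_DG * S"
  \<comment> \<open>Both sides of \<open>main\<close> carry a factor \<open>n \<nu>\<close>, which
    can be cancelled only if it is not 0.\<close>
  proof (cases "n \<nu> = 0")
    case True
    then show ?thesis using S0 C_DG_pos by simp
  next
    case False
    then have pos: "n \<nu> > 0" using n0[of \<nu>] by simp
    have "(\<alpha> * n \<nu>) * n \<nu> \<le> ((1 + 2 * face_const) * S) * n \<nu>"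
      using main by (simp add: power2_eq_square mult.assoc)
    then have "\<alpha> * n \<nu> \<le> (1 + 2 * face_const) * S" using pos by (simp only: mult_le_cancel_right_pos)
    then show ?thesis using \<alpha> by (simp add: C_DG_def field_simps)
  qed
  then show ?thesis using \<nu>(1) by (simp add: S_def norm)
qed

text \<open>The terms with m a unit multi-index reproduce \<open>derivative_bound\<close>, since the
  binomial coefficient is \<nu>_j and the derivative of a is \<psi>_j. The other summands are only
  required to be nonnegative.\<close>

lemma recursion_bound:
  assumes \<nu>: "\<nu> \<in> multi_indices" "\<nu> \<noteq> (\<lambda>_. 0)" and y: "y \<in> param_box"
  shows "DG_norm \<T> \<eta> (a y) (mderiv_y \<nu> u y) \<le>
    C_DG * (\<Sum>m | m \<noteq> (\<lambda>_. 0) \<and> (\<forall>j. m j \<le> \<nu> j).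
       real (mi_choose \<nu> m) * Linf_norm D (\<lambda>x. mderiv_y m a y x / a y x) *
       DG_norm \<T> \<eta> (a y) (mderiv_y (\<lambda>j. \<nu> j - m j) u y))" (is "_ \<le> C_DG * sum ?g ?M")
proof -
  have fin: "finite (supp \<nu>)" using \<nu>(1) by (simp add: multi_indices_def)
  define e where "e = (\<lambda>j::nat. (\<lambda>_::nat. 0 :: nat)(j := 1 :: nat))"
  have "inj_on e (supp \<nu>)" unfolding e_def by (rule inj_onI) (metis fun_upd_apply zero_neq_one)
  have "(\<Sum>j\<in>supp \<nu>. real (\<nu> j) * ratio y j * DG_norm \<T> \<eta> (a y) (mderiv_y (\<nu>(j := \<nu> j - 1)) u y)) =
      (\<Sum>j\<in>supp \<nu>. ?g (e j))"
  proof (rule sum.cong)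
    fix j assume j: "j \<in> supp \<nu>"
    have "(\<lambda>i. \<nu> i - e j i) = \<nu>(j := \<nu> j - 1)" by (auto simp: e_def)
    then show "real (\<nu> j) * ratio y j * DG_norm \<T> \<eta> (a y) (mderiv_y (\<nu>(j := \<nu> j - 1)) u y) = ?g (e j)"
      using mi_choose_unit[OF fin j] ratio_eq[OF y, of j] by (simp add: e_def)
  qed simp
  also have "\<dots> = sum ?g (e ` supp \<nu>)" using sum.reindex[OF \<open>inj_on e (supp \<nu>)\<close>, of ?g] by simp
  also have "\<dots> \<le> sum ?g ?M"
  proof (rule sum_mono2)
    show "finite ?M" by (rule finite_subset[OF _ finite_multi_indices_below[OF fin]]) auto
    show "e ` supp \<nu> \<subseteq> ?M"
    proof (rule image_subsetI)
      fix j assume "j \<in> supp \<nu>"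
      then have "e j i \<le> \<nu> i" for i by (auto simp: e_def supp_def)
      moreover have "e j j \<noteq> (\<lambda>_. 0) j" by (simp add: e_def)
      then have "e j \<noteq> (\<lambda>_. 0)" by metis
      ultimately show "e j \<in> ?M" by simp
    qed
    show "0 \<le> ?g m" for m
      by (intro mult_nonneg_nonneg Linf_norm_nonneg DG_norm_nonneg' y) auto
  qed
  finally have "C_DG * (\<Sum>j\<in>supp \<nu>. real (\<nu> j) * ratio y j * DG_norm \<T> \<eta> (a y) (mderiv_y (\<nu>(j := \<nu> j - 1)) u y))
      \<le> C_DG * sum ?g ?M"
    using C_DG_pos by (intro mult_left_mono) auto
  with derivative_bound[OF fin \<nu>(2) y] show ?thesis by linarith
qed

text \<open>The a priori bound for \<nu> = 0: the equation is tested with the solution, and the load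
  is estimated by Cauchy-Schwarz and the Poincare inequality.\<close>

lemma solution_bound:
  assumes y: "y \<in> param_box"
  shows "DG_norm \<T> \<eta> (a y) (u y) \<le> C_Poin / \<alpha> * L2_norm_on (lebesgue_on D) f"
proof -
  define n where "n = DG_norm \<T> \<eta> (a y) (u y)"
  have uV: "u y \<in> V" and eq: "DG_form \<T> \<theta> \<eta> (a y) (u y) (u y) = (LINT x|lebesgue_on D. f x * u y x)"
    using u[OF y] by (auto simp: is_DG_solution_def)
  have uL: "u y \<in> L2_space D" using uV by (simp add: DG_space_def)
  have "\<alpha> * n\<^sup>2 \<le> (LINT x|lebesgue_on D. f x * u y x)"
    using coercive[OF y uV] by (simp add: eq n_def)
  also have "\<dots> \<le> \<bar>LINT x|lebesgue_on D. f x * u y x\<bar>" by simp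
  also have "\<dots> \<le> 1 * (L2_norm_on (lebesgue_on D) f * L2_norm_on (lebesgue_on D) (u y))"
    by (rule abs_integral_le_L2_norms)
       (use integrable_L2_mult[OF f uL] f uL in \<open>auto simp: L2_space_def abs_mult\<close>)
  also have "\<dots> \<le> 1 * (L2_norm_on (lebesgue_on D) f * (C_Poin * n))"
    unfolding n_def by (intro mult_left_mono Poincare_DG_norm y uV) auto
  finally have main: "(\<alpha> * n) * n \<le> (C_Poin * L2_norm_on (lebesgue_on D) f) * n"
    by (simp add: power2_eq_square ac_simps)
  have n0: "n \<ge> 0" unfolding n_def by (rule DG_norm_nonneg'[OF y])
  show ?thesis
  proof (cases "n = 0")
    case True
    then show ?thesis using C_Poin_nonneg \<alpha> by (simp flip: n_def)
  next
    case False
    then have "\<alpha> * n \<le> C_Poin * L2_norm_on (lebesgue_on D) f"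
      using main n0 by (simp add: mult_le_cancel_right)
    then show ?thesis using \<alpha> by (simp add: field_simps flip: n_def)
  qed
qed

lemma regularity_bound:
  assumes \<nu>: "finite (supp \<nu>)" and y: "y \<in> param_box"
  shows "DG_norm \<T> \<eta> (a y) (mderiv_y \<nu> u y) \<le>
    fact (mi_abs \<nu>) * mi_power (\<lambda>j. C_DG * Linf_norm D (\<psi> j) / (\<alpha> * a_min)) \<nu> *
    (C_Poin / \<alpha>) * L2_norm_on (lebesgue_on D) f"
  using \<nu>
proof (induction "mi_abs \<nu>" arbitrary: \<nu> rule: less_induct)
  case less
  define b where "b = (\<lambda>j. C_DG * Linf_norm D (\<psi> j) / (\<alpha> * a_min))"
  define R where "R = (C_Poin / \<alpha>) * L2_norm_on (lebesgue_on D) f"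
  have R0: "R \<ge> 0" unfolding R_def using C_Poin_nonneg \<alpha> by simp
  have b0: "b j \<ge> 0" for j unfolding b_def using C_DG_pos Linf_norm_nonneg[of D "\<psi> j"] \<alpha> a_min by simp
  \<comment> \<open>The factor \<alpha> in the denominator of b_j is inserted here, by \<alpha>
    \<le> 1.\<close>
  have Cb: "C_DG * ratio y j \<le> b j" for j
  proof -
    have "C_DG * ratio y j \<le> C_DG * (Linf_norm D (\<psi> j) / a_min)"
      using ratio_le[OF y, of j] C_DG_pos by (intro mult_left_mono) auto
    also have "\<dots> \<le> C_DG * (Linf_norm D (\<psi> j) / (\<alpha> * a_min))"
      using C_DG_pos Linf_norm_nonneg[of D "\<psi> j"] \<alpha> a_min
      by (intro mult_left_mono divide_left_mono) (auto simp: mult_left_le_one_le)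
    finally show ?thesis by (simp add: b_def)
  qed
  show ?case
  proof (cases "\<nu> = (\<lambda>_. 0)")
    case True
    then show ?thesis using solution_bound[OF y] by (simp add: mi_abs_def mi_power_def)
  next
    case False
    have pos: "mi_abs \<nu> > 0"
    proof -
      obtain j where "j \<in> supp \<nu>" using False multi_index_zero(2)[of \<nu>] by blast
      then show ?thesis using mi_abs_pred[OF less.prems] by simp
    qed
    have "DG_norm \<T> \<eta> (a y) (mderiv_y \<nu> u y) \<le>
      (\<Sum>j\<in>supp \<nu>. real (\<nu> j) * ((C_DG * ratio y j) * DG_norm \<T> \<eta> (a y) (mderiv_y (\<nu>(j := \<nu> j - 1)) u y)))"
      using derivative_bound[OF less.prems False y] by (simp add: sum_distrib_left ac_simps)
    also have "\<dots> \<le> (\<Sum>j\<in>supp \<nu>. real (\<nu> j) * (b j * (fact (mi_abs \<nu> - 1) * mi_power b (\<nu>(j := \<nu> j - 1)) * R)))"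
    proof (intro sum_mono mult_left_mono mult_mono Cb DG_norm_nonneg' y b0)
      fix j assume j: "j \<in> supp \<nu>"
      have "mi_abs (\<nu>(j := \<nu> j - 1)) < mi_abs \<nu>" "finite (supp (\<nu>(j := \<nu> j - 1)))"
        using mi_abs_pred[OF less.prems j] less.prems by simp_all
      from less.hyps[OF this]
      show "DG_norm \<T> \<eta> (a y) (mderiv_y (\<nu>(j := \<nu> j - 1)) u y) \<le>
          fact (mi_abs \<nu> - 1) * mi_power b (\<nu>(j := \<nu> j - 1)) * R"
        using mi_abs_pred[OF less.prems j] by (simp add: b_def R_def mult.assoc)
    qed auto
    \<comment> \<open>The factor b_j restores the full power of b, so the summands differ only in
      \<nu>_j. These add up to the order of \<nu> and complete the factorial.\<close>
    also have "\<dots> = (\<Sum>j\<in>supp \<nu>. real (\<nu> j) * (fact (mi_abs \<nu> - 1) * mi_power b \<nu> * R))"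
    proof (rule sum.cong)
      fix j assume "j \<in> supp \<nu>"
      then show "real (\<nu> j) * (b j * (fact (mi_abs \<nu> - 1) * mi_power b (\<nu>(j := \<nu> j - 1)) * R)) =
          real (\<nu> j) * (fact (mi_abs \<nu> - 1) * mi_power b \<nu> * R)"
        by (subst mi_power_pred[OF less.prems]) (simp_all only: ac_simps)
    qed simp
    also have "\<dots> = real (mi_abs \<nu>) * fact (mi_abs \<nu> - 1) * (mi_power b \<nu> * R)"
      unfolding mi_abs_def[of \<nu>] of_nat_sum sum_distrib_right[symmetric] by (simp only: mult.assoc)
    also have "real (mi_abs \<nu>) * fact (mi_abs \<nu> - 1) = fact (mi_abs \<nu>)"
      using pos by (simp add: fact_reduce[of "mi_abs \<nu>"])
    finally show ?thesis by (simp add: b_def R_def mult.assoc)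
  qed
qed

end

section \<open>The regularity bound\<close>

text \<open>Squaring turns the left-hand side into the quotient that the penalty condition bounds by
  4 / \<tau>. The result is the hypothesis of \<open>DG_form_coercive\<close> for s = 1 / sqrt
  \<tau>.\<close>

lemma penalty_imp_face_const_le:
  assumes "a_min > 0" "a_max > 0" "\<eta> > 0" "\<tau> > 1"
    and \<eta>_ge: "\<eta> \<ge> \<tau> * (a_max\<^sup>2 * C_tr\<^sup>2 * real N * (\<theta> - 1)\<^sup>2 / (4 * a_min))"
  shows "\<bar>\<theta> - 1\<bar> * (a_max * \<bar>C_tr\<bar> * sqrt (real N) / sqrt (a_min * \<eta>)) \<le> 2 * (1 / sqrt \<tau>)"
proof (rule power2_le_imp_le)
  let ?X = "a_max\<^sup>2 * C_tr\<^sup>2 * real N * (\<theta> - 1)\<^sup>2"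
  have "(\<bar>\<theta> - 1\<bar> * (a_max * \<bar>C_tr\<bar> * sqrt (real N) / sqrt (a_min * \<eta>)))\<^sup>2 = ?X / (a_min * \<eta>)"
    using assms(1-3) by (simp add: power_mult_distrib power_divide)
  also have "\<dots> \<le> 4 / \<tau>"
  proof -
    have "?X * \<tau> \<le> 4 * (a_min * \<eta>)" using \<eta>_ge assms(1) by (simp add: field_simps)
    then show ?thesis using assms(1-4) by (simp add: field_simps)
  qed
  also have "\<dots> = (2 * (1 / sqrt \<tau>))\<^sup>2" using assms(4) by (simp add: power_mult_distrib power_divide)
  finally show "(\<bar>\<theta> - 1\<bar> * (a_max * \<bar>C_tr\<bar> * sqrt (real N) / sqrt (a_min * \<eta>)))\<^sup>2 \<le> (2 * (1 / sqrt \<tau>))\<^sup>2" .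
qed (use assms in simp)

theorem lemma6p1:
  fixes D :: "'a::euclidean_space set"
    and f a0 :: "'a \<Rightarrow> real"
    and \<psi> :: "nat \<Rightarrow> 'a \<Rightarrow> real"
    and a :: "(nat \<Rightarrow> real) \<Rightarrow> 'a \<Rightarrow> real"
    and \<T> :: "nat \<Rightarrow> 'a set set"
    and u :: "nat \<Rightarrow> (nat \<Rightarrow> real) \<Rightarrow> 'a \<Rightarrow> real"
    and a_min a_max p \<theta> \<eta> \<tau> \<tau>' C_tr \<sigma> C_Poin :: real
    and k N :: nat
  defines "a \<equiv> affine_coeff a0 \<psi>"
    and "C_Poin \<equiv> \<sigma> / min (sqrt a_min) (sqrt \<eta>)"
  assumes dim: "DIM('a) \<in> {1, 2, 3}"
    and f: "f \<in> L2_space D"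
    and U1: "a0 \<in> Linf_space D" "\<And>j. \<psi> j \<in> Linf_space D" "summable (\<lambda>j. Linf_norm D (\<psi> j))"
    and U2: "a_min > 0" "a_max > 0"
            "\<And>x y. x \<in> D \<Longrightarrow> y \<in> param_box \<Longrightarrow> a_min \<le> a y x \<and> a y x \<le> a_max"
    and U3: "0 < p" "p < 1" "summable (\<lambda>j. Linf_norm D (\<psi> j) powr p)"
    and U4: "a0 \<in> W1inf_space D" "\<And>j. \<psi> j \<in> W1inf_space D" "summable (\<lambda>j. W1inf_norm D (\<psi> j))"
    and U5: "D \<noteq> {}" "open D" "convex D" "bounded D" "polyhedron (closure D)"
    and mesh: "regular_mesh_sequence D \<T>"
    and N: "is_max_face_number \<T> N"
    and k: "k \<ge> 1"
    and C_tr: "is_trace_const D \<T> k C_tr"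
    and \<sigma>: "is_broken_Poincare_const D \<T> k \<sigma>"
    and \<theta>: "\<theta> \<in> {-1, 0, 1}"
    and \<eta>: "\<eta> > 0" "\<tau> > 1" "\<tau>' > 0"
            "\<eta> \<ge> \<tau> * (a_max\<^sup>2 * C_tr\<^sup>2 * real N * (\<theta> - 1)\<^sup>2 / (4 * a_min))"
            "\<eta> \<ge> \<tau>' * (a_max\<^sup>2 / a_min)"
    and u: "\<And>h y. y \<in> param_box \<Longrightarrow> is_DG_solution D (\<T> h) k \<theta> \<eta> (a y) f (u h y)"
  shows "\<exists>\<alpha> C_DG. is_coercivity_const D \<T> k \<theta> \<eta> a \<alpha> \<and>
           is_recursion_const D \<T> \<eta> a u C_DG \<and>
           has_all_derivs_y \<T> u \<and>
           (\<forall>h. \<forall>\<nu>\<in>multi_indices. \<forall>y\<in>param_box.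
              DG_norm (\<T> h) \<eta> (a y) (mderiv_y \<nu> (u h) y) \<le>
              fact (mi_abs \<nu>) * mi_power (\<lambda>j. C_DG * Linf_norm D (\<psi> j) / (\<alpha> * a_min)) \<nu> *
              (C_Poin / \<alpha>) * L2_norm_on (lebesgue_on D) f)"
proof -
  have a0_cont: "continuous_on (closure D) a0" and \<psi>_cont: "\<And>j. continuous_on (closure D) (\<psi> j)"
    using U4 by (auto simp: W1inf_space_def)
  have \<psi>_le: "\<bar>\<psi> j x\<bar> \<le> Linf_norm D (\<psi> j)" if "x \<in> closure D" for j x
    using norm_le_Linf_norm[OF U5(2) U1(2) \<psi>_cont that] by simp
  have a_cont: "continuous_on (closure D) (a y)" if "y \<in> param_box" for y
    unfolding a_def by (rule continuous_on_affine_coeff[OF a0_cont \<psi>_cont \<psi>_le U1(3) that])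
  \<comment> \<open>The bounds assumed on D pass to the closure by continuity of the
    coefficient.\<close>
  have a_bounds: "a_min \<le> a y x \<and> a y x \<le> a_max" if "x \<in> closure D" "y \<in> param_box" for x y
    using continuous_ge_on_closure[OF a_cont[OF that(2)] that(1), of a_min]
      continuous_le_on_closure[OF a_cont[OF that(2)] that(1), of a_max] U2(3)[OF _ that(2)] by blast
  have dg_form: "dg_form D (\<T> h) k C_tr \<eta> a_min a_max N" for h
  proof
    show "is_mesh D (\<T> h)" using mesh by (simp add: regular_mesh_sequence_def)
    show "sqrt (diameter T) * L2_norm_on (face_measure F) (trace T v) \<le> C_tr * L2_norm_on (lebesgue_on T) v"
      if "v \<in> DG_space D (\<T> h) k" "T \<in> \<T> h" "F \<in> flat_faces T" for v T F
      using C_tr that by (simp add: is_trace_const_def)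
    show "card (flat_faces T) \<le> N" if "T \<in> \<T> h" for T
      using N that by (auto simp: is_max_face_number_def)
  qed (use U2 U5 \<eta> in auto)
  define \<alpha> where "\<alpha> = 1 - 1 / sqrt \<tau>"
  have \<alpha>: "0 < \<alpha>" "\<alpha> \<le> 1" using \<eta>(2) by (auto simp: \<alpha>_def field_simps)
  have s: "0 \<le> 1 / sqrt \<tau>"
    "\<bar>\<theta> - 1\<bar> * (a_max * \<bar>C_tr\<bar> * sqrt (real N) / sqrt (a_min * \<eta>)) \<le> 2 * (1 / sqrt \<tau>)"
    using penalty_imp_face_const_le[OF U2(1,2) \<eta>(1,2,4)] \<eta>(2) by simp_all
  have coercive: "\<alpha> * (DG_norm (\<T> h) \<eta> (a y) v)\<^sup>2 \<le> DG_form (\<T> h) \<theta> \<eta> (a y) v v"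
    if y: "y \<in> param_box" and v: "v \<in> DG_space D (\<T> h) k" for h y v
  proof -
    interpret mesh: dg_form D "\<T> h" k C_tr \<eta> a_min a_max N by (rule dg_form)
    interpret dg_coefficient D "\<T> h" k C_tr \<eta> a_min a_max N "a y"
      by unfold_locales (use a_cont[OF y] a_bounds[OF _ y] in auto)
    show ?thesis unfolding \<alpha>_def
      by (rule DG_form_coercive[OF v])
         (use s in \<open>simp_all add: mesh.face_const_def\<close>)
  qed
  have affine: "dg_affine D (\<T> h) k C_tr \<eta> a_min a_max N a0 \<psi> a f (u h) \<theta> \<sigma> \<alpha>" for h
  proof -
    interpret mesh: dg_form D "\<T> h" k C_tr \<eta> a_min a_max N by (rule dg_form)
    show ?thesis
    proof
      show "a = affine_coeff a0 \<psi>" by (simp add: a_def)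
      show "\<bar>\<theta>\<bar> \<le> 1" using \<theta> by auto
      show "\<sigma> > 0" using \<sigma> by (simp add: is_broken_Poincare_const_def)
      show "L2_norm_on (lebesgue_on D) v \<le> \<sigma> * sqrt (
          (\<Sum>T\<in>\<T> h. (L2_norm_on (lebesgue_on T) (grad v))\<^sup>2) +
          (\<Sum>F\<in>mesh_faces (\<T> h). 1 / face_size (\<T> h) F * (L2_norm_on (face_measure F) (jump (\<T> h) F v))\<^sup>2))"
        if "v \<in> DG_space D (\<T> h) k" for v
        using \<sigma> that unfolding is_broken_Poincare_const_def by blast
    qed (fact a0_cont \<psi>_cont \<psi>_le U1(3) a_bounds \<alpha> coercive f u)+
  qed
  define C_DG where "C_DG = (1 + 2 * (a_max * \<bar>C_tr\<bar> * sqrt (real N) / sqrt (a_min * \<eta>))) / \<alpha>"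
  \<comment> \<open>The constant of the single-mesh problem depends on neither the mesh nor y, so
    one value serves for all h.\<close>
  have C_DG: "dg_affine.C_DG C_tr \<eta> a_min a_max N \<alpha> = C_DG"
    unfolding dg_affine.C_DG_def[OF affine] dg_form.face_const_def[OF dg_form] C_DG_def ..
  have C_P: "dg_affine.C_Poin \<eta> a_min \<sigma> = C_Poin"
    unfolding dg_affine.C_Poin_def[OF affine] C_Poin_def ..
  have "is_coercivity_const D \<T> k \<theta> \<eta> a \<alpha>"
    using \<alpha>(1) coercive by (simp add: is_coercivity_const_def)
  moreover have "is_recursion_const D \<T> \<eta> a u C_DG"
    using dg_affine.C_DG_pos[OF affine] dg_affine.recursion_bound[OF affine]
    unfolding is_recursion_const_def C_DG by blast
  moreover have "has_all_derivs_y \<T> u"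
    unfolding has_all_derivs_y_def
  proof (intro allI ballI)
    fix h \<nu> y j T x
    assume "\<nu> \<in> multi_indices" "y \<in> param_box" "T \<in> \<T> h" "x \<in> T"
    then show "(\<lambda>t. mderiv_y \<nu> (u h) (y(j := t)) x) differentiable (at (y j) within {-1/2..1/2})"
      by (intro dg_affine.differentiable_mderiv_solution[OF affine]) (auto simp: multi_indices_def)
  qed
  moreover have "\<forall>h. \<forall>\<nu>\<in>multi_indices. \<forall>y\<in>param_box.
      DG_norm (\<T> h) \<eta> (a y) (mderiv_y \<nu> (u h) y) \<le>
      fact (mi_abs \<nu>) * mi_power (\<lambda>j. C_DG * Linf_norm D (\<psi> j) / (\<alpha> * a_min)) \<nu> *
      (C_Poin / \<alpha>) * L2_norm_on (lebesgue_on D) f"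
    using dg_affine.regularity_bound[OF affine] unfolding C_DG C_P multi_indices_def by blast
  ultimately show ?thesis by blast
qed

end
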